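(* Let $M$ be a positive odd integer and let $m\in\frac14\mathbb Z$ be such that $n=-4m-2$ is a positive integer coprime to $M$. Put $C=\frac{3n}{2M}-\frac12$. Let $V$ denote the span of the following functions: (i) the modified characters and supercharacters of the representations of the $N=3$ superconformal algebra of central charge $C$ obtained by quantum Hamiltonian reduction from the principal admissible $\hat{\mathfrak g}$-modules $L(\Lambda)$ with $\Lambda=\Lambda^{[m;m_2]J}_{k_1,k_2}$ and $\dot\Lambda^{[m;m_2]J}_{k_1,k_2}$, where $J=\mathrm I$ or $\mathrm{III}$, $m_2=0$ or $1$, and $k_1,k_2$ are integers in the range for $J$ ($\mathrm I$: $k_1\ge0,\ k_2\ge0,\ 2(k_1+k_2)\le M-1$; $\mathrm{III}$: $k_1\ge0,\ k_2\ge1,\ 2(k_1+k_2)\le M-1$); (ii) the same as in (i), except that $\Lambda=\Lambda^{[m;m_2]J'}_{k_1,k_2}$, where $J'=\mathrm I'$ or $\mathrm{III}'$ and $k_1,k_2$ are integers in the range for $J'$ ($\mathrm I'$: $k_1\le0,\ k_1+k_2\ge0,\ k_1+2k_2\le M-1$; $\mathrm{III}'$: $k_1\le-1,\ k_1+k_2\ge0,\ k_1+2k_2\le M$); (iii) the modified characters of the representations of the Ramond twisted $N=3$ superconformal algebra with central charge $C$ obtained by quantum Hamiltonian reduction from the twisted $\hat{\mathfrak g}$-modules with the same highest weights as in (i) and (ii). Then: (a) The space $V$ coincides with the span of the functions $f^{[M;n;\epsilon](\sigma,\sigma')}_{j,k;\epsilon'}(\tau,z)$ with $(\sigma,\sigma')\neq(0,0)$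 (where $\epsilon,\epsilon',\sigma,\sigma'\in\{0,\frac12\}$ and $j,k\in\epsilon'+\mathbb Z$). (b) The space $V$ is invariant with respect to the following action of $SL_2(\mathbb Z)$: $$f\Big|_{\left(\begin{smallmatrix}a&b\\c&d\end{smallmatrix}\right)}(\tau,z)=(c\tau+d)^{-1}\,e^{-\frac{\pi i(C+\frac12)cz^2}{3(c\tau+d)}}\,f\Big(\frac{a\tau+b}{c\tau+d},\frac{z}{c\tau+d}\Big).$$
   Context: Throughout $\operatorname{Im}\tau>0$, $q=e^{2\pi i\tau}$. Mock theta functions and modifications. For a positive integer $\ell$ and $s\in\mathbb Z$ put $\Theta_{j,\ell}(\tau,z)=\sum_{r\in\mathbb Z+\frac{j}{2\ell}}q^{\ell r^2}e^{2\pi i\ell rz}$ ($j\in\mathbb Z/2\ell\mathbb Z$); $\Phi_1^{[\ell;s]}(\tau,z_1,z_2)=\sum_{j\in\mathbb Z}\frac{e^{2\pi i\ell j(z_1+z_2)+2\pi isz_1}q^{j^2\ell+js}}{1-e^{2\pi iz_1}q^j}$; $\Phi^{[\ell;s]}(\tau,z_1,z_2)=\Phi_1^{[\ell;s]}(\tau,z_1,z_2)-\Phi_1^{[\ell;s]}(\tau,-z_2,-z_1)$. Let $E(x)=2\int_0^xe^{-\pi u^2}du$, $R_{j;\ell}(\tau,v)=\sum_{r\in\mathbb Z,\ r\equiv j\,(2\ell)}\big(\mathrm{sgn}(r-\tfrac12-j+2\ell)-E((r-2\ell\tfrac{\operatorname{Im}v}{\operatorname{Im}\tau})\sqrt{\tfrac{\operatorname{Im}\tau}{\ell}})\big)e^{-\frac{\pi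 ir^2}{2\ell}\tau+2\pi irv}$, and $\tilde\Phi^{[\ell;s]}(\tau,z_1,z_2)=\Phi^{[\ell;s]}(\tau,z_1,z_2)+\frac12\sum_{j=s}^{s+2\ell-1}R_{j;\ell}(\tau,\tfrac{z_1-z_2}2)(\Theta_{-j,\ell}-\Theta_{j,\ell})(\tau,z_1+z_2)$ (the modification of $\Phi^{[\ell;s]}$; it is independent of $s\in\mathbb Z$). For $\epsilon,\epsilon'\in\{0,\frac12\}$, $j,k\in\epsilon'+\mathbb Z$: $\Psi^{[M,n;s;\epsilon]}_{j,k;\epsilon'}(\tau,z_1,z_2)=q^{\frac{njk}M}e^{\frac{2\pi in}M(kz_1+jz_2)}\Phi^{[n;s]}(M\tau,z_1+j\tau+\epsilon,z_2+k\tau+\epsilon)$, and its modification $\tilde\Psi^{[M,n;s;\epsilon]}_{j,k;\epsilon'}$ is obtained by replacing $\Phi^{[n;s]}$ by $\tilde\Phi^{[n;s]}$. For $\sigma,\sigma'\in\{0,\frac12\}$: $$f^{[M;n;\epsilon](\sigma,\sigma')}_{j,k;\epsilon'}(\tau,z)=q^{-\frac{n}{4M}\sigma'^2}\,\tilde\Psi^{[M,n;0;\epsilon]}_{j,k;\epsilon'}\Big(\tau,\frac{z+\sigma+\sigma'\tau}2,\frac{z-\sigma-\sigma'\tau}2\Big).$$ Representations. $\mathfrak g=spo_{2|3}$ with simple roots $\alpha_1,\alpha_2$, $(\alpha_1|\alpha_1)=0$, $(\alpha_2|\alpha_2)=-\frac12$, $(\alpha_1|\alpha_2)=\frac12$,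 highest root $\theta=2(\alpha_1+\alpha_2)$, $h^\vee=\frac12$, $\hat\rho=\frac12\Lambda_0-\frac12\alpha_1$; $\hat{\mathfrak g}$ is the affine Lie superalgebra and $L(\Lambda)$ its irreducible highest weight module. By the $N=3$ superconformal algebras one means the minimal $W$-algebra $W^K(\mathfrak g,e_{-\theta})$ (Neveu–Schwarz type) and its Ramond twisted analogue; here $K+\frac12=\frac{m+1/2}{M}$. The twisted modules are obtained from the $L(\Lambda)$ by the twist $t_{\frac12\theta}r_\theta$. The level $m$ weights are $\Lambda^{[m;m_2]}=m\Lambda_0-\frac12m_2\alpha_1$ and $\dot\Lambda^{[m;m_2]}=m\Lambda_0+(1+m)\alpha_1-(m+\frac12m_2)(\alpha_1+2\alpha_2)$. The level $K$ admissible weight associated to $\Lambda^0\in\{\Lambda^{[m;m_2]},\dot\Lambda^{[m;m_2]}\}$ is $t_\beta y(\Lambda^0-(M-1)(K+\frac12)\Lambda_0+\hat\rho)-\hat\rho$ (modulo $\mathbb C\delta$), where $t_\beta(\Lambda)=\Lambda+(\Lambda|\delta)\beta-((\Lambda|\beta)+\frac12(\Lambda|\delta)|\beta|^2)\delta$, with $y=1$, $\beta=-k_1(\alpha_1+2\alpha_2)-(k_1+2k_2)\alpha_1$ for $J=\mathrm I,\mathrm I'$, and $y=r_{\alpha_2}$, $\beta=-(k_1+2k_2)(\alpha_1+2\alpha_2)-k_1\alpha_1$ for $J=\mathrm{III},\mathrm{III}'$; it is denoted $\Lambda^{[m;m_2]J}_{k_1,k_2}$, resp. $\dot\Lambda^{[m;m_2]J}_{k_1,k_2}$.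 It is called principal admissible for $J=\mathrm I,\mathrm{III}$ in the ranges stated in (i), and non-principal admissible for $J'=\mathrm I',\mathrm{III}'$ in the ranges stated in (ii). The (super)characters of the resulting $N=3$ modules have the form numerator divided by denominator, with denominators $R^+=\frac{\eta(\tau/2)\eta(2\tau)\vartheta_{11}(\tau,z)}{\vartheta_{00}(\tau,z)}$ (Neveu–Schwarz characters), $R^-=\frac{\eta(\tau)^3\vartheta_{11}(\tau,z)}{\eta(\tau/2)\vartheta_{01}(\tau,z)}$ (Neveu–Schwarz supercharacters), $R^{\mathrm{tw}}=\frac{\eta(\tau)^3\vartheta_{11}(\tau,z)}{\eta(2\tau)\vartheta_{10}(\tau,z)}$ (Ramond characters; Ramond supercharacters vanish), where $\eta$ is the Dedekind eta function and $\vartheta_{00}=\Theta_{2,2}+\Theta_{0,2}$, $\vartheta_{01}=-\Theta_{2,2}+\Theta_{0,2}$, $\vartheta_{10}=\Theta_{1,2}+\Theta_{-1,2}$, $\vartheta_{11}=i\Theta_{1,2}-i\Theta_{-1,2}$. The numerators are expressed via the functions $\Psi$, and the modified (super)characters are by definition obtained from these expressions by replacing $\Psi$ by $\tilde\Psi$. For $m_2=0,1$ the modifications of the functions expressing the numerators are, up to non-zero scalar factors: Neveu–Schwarz character: $f^{[M;n;0](\frac12,\frac12)}_{j,k;\epsilon'}-(-1)^{m_2}f^{[M;n;\frac12](\frac12,\frac12)}_{j,k;\epsilon'}$; Neveu–Schwarz supercharacter: $f^{[M;n;0](0,\frac12)}_{j,k;\epsilon'}-(-1)^{m_2}f^{[M;n;\frac12](0,\frac12)}_{j,k;\epsilon'}$;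 Ramond character: $f^{[M;n;0](\frac12,0)}_{j,k;\epsilon'}-(-1)^{m_2}f^{[M;n;\frac12](\frac12,0)}_{j,k;\epsilon'}$; where $\epsilon'\in\{0,\frac12\}$ is such that $j,k\in\epsilon'+\mathbb Z$ and $(j,k)=(\frac{k_1}2,-\frac{k_1+2k_2}2)$ for $\Lambda^{[m;m_2]\mathrm I}_{k_1,k_2}$ and $\Lambda^{[m;m_2]\mathrm I'}_{k_1,k_2}$; $(j,k)=(\frac{k_1+2k_2}2,-\frac{k_1}2)$ for $\Lambda^{[m;m_2]\mathrm{III}}_{k_1,k_2}$ and $\Lambda^{[m;m_2]\mathrm{III}'}_{k_1,k_2}$; $(j,k)=(\frac{k_1+M}2,-\frac{k_1+2k_2-M}2)$ for $\dot\Lambda^{[m;m_2]\mathrm I}_{k_1,k_2}$; $(j,k)=(\frac{k_1+2k_2-M}2,-\frac{k_1+M}2)$ for $\dot\Lambda^{[m;m_2]\mathrm{III}}_{k_1,k_2}$.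
   Formalization: V is taken as the span of the modified (super)characters multiplied by their denominators R^+, R^-, R^tw, i.e. of the modified numerators; the quotients themselves are regular at the non-lattice half-periods where the f have poles, so (a) fails for them. *)

theory Defs
  imports
    "HOL-Analysis.Analysis"
    "HOL-Library.Function_Algebras"
    "HOL-Number_Theory.Cong"
begin

section \<open>Theta functions, mock theta functions and their modifications\<close>

text \<open>Throughout, \<open>q = exp (2 \<pi> i \<tau>)\<close>; real powers of \<open>q\<close> are taken through \<open>\<tau>\<close>.\<close>

definition qpow :: "complex \<Rightarrow> real \<Rightarrow> complex" where
  "qpow \<tau> x = exp (2 * of_real pi * \<i> * of_real x * \<tau>)"

definition theta :: "int \<Rightarrow> nat \<Rightarrow> complex \<Rightarrow> complex \<Rightarrow> complex" where
  "theta j l \<tau> z =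
     (\<Sum>\<^sub>\<infinity>r\<in>{r::real. r - of_int j / (2 * real l) \<in> \<int>}.
        qpow \<tau> (real l * r\<^sup>2) * exp (2 * of_real pi * \<i> * of_nat l * of_real r * z))"

definition Phi1 :: "nat \<Rightarrow> int \<Rightarrow> complex \<Rightarrow> complex \<Rightarrow> complex \<Rightarrow> complex" where
  "Phi1 l s \<tau> z1 z2 =
     (\<Sum>\<^sub>\<infinity>j\<in>(UNIV :: int set).
        exp (2 * of_real pi * \<i> * of_nat l * of_int j * (z1 + z2)
              + 2 * of_real pi * \<i> * of_int s * z1)
        * qpow \<tau> (of_int (j\<^sup>2 * int l + j * s))
        / (1 - exp (2 * of_real pi * \<i> * z1) * qpow \<tau> (of_int j)))"

definition Phi :: "nat \<Rightarrow> int \<Rightarrow> complex \<Rightarrow> complex \<Rightarrow> complex \<Rightarrow> complex" where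
  "Phi l s \<tau> z1 z2 = Phi1 l s \<tau> z1 z2 - Phi1 l s \<tau> (- z2) (- z1)"

text \<open>The interval integral is oriented, so this is also correct for negative \<open>x\<close>.\<close>

definition gaussE :: "real \<Rightarrow> real" where
  "gaussE x = 2 * (LBINT u=0..ereal x. exp (- pi * u\<^sup>2))"

definition Rfun :: "int \<Rightarrow> nat \<Rightarrow> complex \<Rightarrow> complex \<Rightarrow> complex" where
  "Rfun j l \<tau> v =
     (\<Sum>\<^sub>\<infinity>r\<in>{r::int. [r = j] (mod (2 * int l))}.
        of_real (sgn (of_int r - 1/2 - of_int j + 2 * real l)
                  - gaussE ((of_int r - 2 * real l * Im v / Im \<tau>) * sqrt (Im \<tau> / real l)))
        * exp (- (of_real pi * \<i> * of_int (r\<^sup>2) / (2 * of_nat l)) * \<tau>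
                + 2 * of_real pi * \<i> * of_int r * v))"

definition Phi_mod :: "nat \<Rightarrow> int \<Rightarrow> complex \<Rightarrow> complex \<Rightarrow> complex \<Rightarrow> complex" where
  "Phi_mod l s \<tau> z1 z2 =
     Phi l s \<tau> z1 z2
     + 1/2 * (\<Sum>j\<in>{s..s + 2 * int l - 1}.
          Rfun j l \<tau> ((z1 - z2) / 2) * (theta (- j) l \<tau> (z1 + z2) - theta j l \<tau> (z1 + z2)))"

text \<open>
  The additional index \<open>\<epsilon>'\<close> carried by \<open>\<Psi>\<close> and \<open>f\<close> in the literature only records that
  \<open>j, k \<in> \<epsilon>' + \<int>\<close>; it does not enter the formulas.
\<close>

definition Psi_mod ::
  "nat \<Rightarrow> nat \<Rightarrow> int \<Rightarrow> real \<Rightarrow> real \<Rightarrow> real \<Rightarrow> complex \<Rightarrow> complex \<Rightarrow> complex \<Rightarrow> complex" where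
  "Psi_mod M n s \<epsilon> j k \<tau> z1 z2 =
     qpow \<tau> (real n * j * k / real M)
     * exp (2 * of_real pi * \<i> * of_nat n / of_nat M * (of_real k * z1 + of_real j * z2))
     * Phi_mod n s (of_nat M * \<tau>) (z1 + of_real j * \<tau> + of_real \<epsilon>) (z2 + of_real k * \<tau> + of_real \<epsilon>)"

definition f_fun ::
  "nat \<Rightarrow> nat \<Rightarrow> real \<Rightarrow> real \<Rightarrow> real \<Rightarrow> real \<Rightarrow> real \<Rightarrow> complex \<Rightarrow> complex \<Rightarrow> complex" where
  "f_fun M n \<epsilon> \<sigma> \<sigma>' j k \<tau> z =
     qpow \<tau> (- (real n / (4 * real M)) * \<sigma>'\<^sup>2)
     * Psi_mod M n 0 \<epsilon> j k \<tau> ((z + of_real \<sigma> + of_real \<sigma>' * \<tau>) / 2)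
                           ((z - of_real \<sigma> - of_real \<sigma>' * \<tau>) / 2)"


section \<open>Spaces of functions of \<open>(\<tau>, z)\<close>\<close>

text \<open>
  As functions of \<open>z\<close>, the functions above have poles, all contained in \<open>(\<int> + \<int>\<tau>)/2\<close>. Functions are
  therefore compared on the dense \<open>SL\<^sub>2(\<int>)\<close>-invariant domain where \<open>Im \<tau> > 0\<close> and \<open>z\<close> is not such a
  point, and are extended by \<open>0\<close> to all arguments.
\<close>

definition fdom :: "(complex \<times> complex) set" where
  "fdom = {(\<tau>, z). Im \<tau> > 0 \<and> \<not> (\<exists>a b :: int. z = (of_int a + of_int b * \<tau>) / 2)}"

definition on_dom :: "(complex \<Rightarrow> complex \<Rightarrow> complex) \<Rightarrow> complex \<Rightarrow> complex \<Rightarrow> complex" where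
  "on_dom F = (\<lambda>\<tau> z. if (\<tau>, z) \<in> fdom then F \<tau> z else 0)"

definition fscale :: "complex \<Rightarrow> (complex \<Rightarrow> complex \<Rightarrow> complex) \<Rightarrow> complex \<Rightarrow> complex \<Rightarrow> complex" where
  "fscale c F = (\<lambda>\<tau> z. c * F \<tau> z)"

lemma vector_space_fscale: "vector_space fscale"
  by unfold_locales (auto simp: fscale_def fun_eq_iff algebra_simps)

definition cspan :: "(complex \<Rightarrow> complex \<Rightarrow> complex) set \<Rightarrow> (complex \<Rightarrow> complex \<Rightarrow> complex) set" where
  "cspan = module.span fscale"

definition slash ::
  "real \<Rightarrow> int \<Rightarrow> int \<Rightarrow> int \<Rightarrow> int \<Rightarrow> (complex \<Rightarrow> complex \<Rightarrow> complex) \<Rightarrow> complex \<Rightarrow> complex \<Rightarrow> complex" where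
  "slash C a b c d F = on_dom (\<lambda>\<tau> z.
     inverse (of_int c * \<tau> + of_int d)
     * exp (- (of_real pi * \<i> * of_real (C + 1/2) * of_int c * z\<^sup>2) / (3 * (of_int c * \<tau> + of_int d)))
     * F ((of_int a * \<tau> + of_int b) / (of_int c * \<tau> + of_int d)) (z / (of_int c * \<tau> + of_int d)))"


section \<open>Weights of the affine Lie superalgebra of type \<open>spo(2|3)\<close>\<close>

text \<open>\<open>(a, b, c, d)\<close> stands for \<open>a \<Lambda>\<^sub>0 + b \<alpha>\<^sub>1 + c \<alpha>\<^sub>2 + d \<delta>\<close>.\<close>

type_synonym weight = "real \<times> real \<times> real \<times> real"

definition Lambda0 :: weight where "Lambda0 = (1, 0, 0, 0)"
definition alpha1 :: weight where "alpha1 = (0, 1, 0, 0)"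
definition alpha2 :: weight where "alpha2 = (0, 0, 1, 0)"
definition delta :: weight where "delta = (0, 0, 0, 1)"

text \<open>
  \<open>(\<alpha>\<^sub>1|\<alpha>\<^sub>1) = 0\<close>, \<open>(\<alpha>\<^sub>1|\<alpha>\<^sub>2) = 1/2\<close>, \<open>(\<alpha>\<^sub>2|\<alpha>\<^sub>2) = -1/2\<close>, \<open>(\<Lambda>\<^sub>0|\<delta>) = 1\<close>; all other products of basis
  vectors vanish.
\<close>

fun wform :: "weight \<Rightarrow> weight \<Rightarrow> real" where
  "wform (a, b, c, d) (a', b', c', d') =
     a * d' + d * a' + (b * c' + c * b') / 2 - c * c' / 2"

definition rho_hat :: weight where
  "rho_hat = (1/2) *\<^sub>R Lambda0 - (1/2) *\<^sub>R alpha1"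

definition translation :: "weight \<Rightarrow> weight \<Rightarrow> weight" where
  "translation \<beta> \<Lambda> =
     \<Lambda> + wform \<Lambda> delta *\<^sub>R \<beta> - (wform \<Lambda> \<beta> + (1/2) * wform \<Lambda> delta * wform \<beta> \<beta>) *\<^sub>R delta"

definition refl :: "weight \<Rightarrow> weight \<Rightarrow> weight" where
  "refl \<alpha> \<Lambda> = \<Lambda> - (2 * wform \<Lambda> \<alpha> / wform \<alpha> \<alpha>) *\<^sub>R \<alpha>"

definition mod_delta :: "weight \<Rightarrow> weight" where
  "mod_delta = (\<lambda>(a, b, c, d). (a, b, c, 0))"

definition Lambda_m :: "real \<Rightarrow> nat \<Rightarrow> weight" where
  "Lambda_m m m2 = m *\<^sub>R Lambda0 - (real m2 / 2) *\<^sub>R alpha1"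

definition Lambda_dot_m :: "real \<Rightarrow> nat \<Rightarrow> weight" where
  "Lambda_dot_m m m2 =
     m *\<^sub>R Lambda0 + (1 + m) *\<^sub>R alpha1 - (m + real m2 / 2) *\<^sub>R (alpha1 + 2 *\<^sub>R alpha2)"

datatype series = Ser_I | Ser_I' | Ser_III | Ser_III'

text \<open>
  A label \<open>(dotted, m\<^sub>2, J, k\<^sub>1, k\<^sub>2)\<close> stands for the admissible weight with these parameters, built
  from \<open>Lambda_dot_m\<close> if \<open>dotted\<close> holds and from \<open>Lambda_m\<close> otherwise.
\<close>

type_synonym label = "bool \<times> nat \<times> series \<times> int \<times> int"

fun adm_beta :: "series \<Rightarrow> int \<Rightarrow> int \<Rightarrow> weight" where
  "adm_beta J k1 k2 =
     (if J \<in> {Ser_I, Ser_I'}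
      then - of_int k1 *\<^sub>R (alpha1 + 2 *\<^sub>R alpha2) - of_int (k1 + 2 * k2) *\<^sub>R alpha1
      else - of_int (k1 + 2 * k2) *\<^sub>R (alpha1 + 2 *\<^sub>R alpha2) - of_int k1 *\<^sub>R alpha1)"

fun adm_y :: "series \<Rightarrow> weight \<Rightarrow> weight" where
  "adm_y J = (if J \<in> {Ser_I, Ser_I'} then id else refl alpha2)"

definition level_K :: "nat \<Rightarrow> real \<Rightarrow> real" where
  "level_K M m = (m + 1/2) / real M - 1/2"

fun adm_weight :: "nat \<Rightarrow> real \<Rightarrow> label \<Rightarrow> weight" where
  "adm_weight M m (dotted, m2, J, k1, k2) =
     mod_delta
       (translation (adm_beta J k1 k2)
          (adm_y J ((if dotted then Lambda_dot_m m m2 else Lambda_m m m2)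
                     - ((real M - 1) * (level_K M m + 1/2)) *\<^sub>R Lambda0 + rho_hat))
        - rho_hat)"

fun in_range :: "nat \<Rightarrow> series \<Rightarrow> int \<Rightarrow> int \<Rightarrow> bool" where
  "in_range M Ser_I k1 k2 \<longleftrightarrow> k1 \<ge> 0 \<and> k2 \<ge> 0 \<and> 2 * (k1 + k2) \<le> int M - 1"
| "in_range M Ser_III k1 k2 \<longleftrightarrow> k1 \<ge> 0 \<and> k2 \<ge> 1 \<and> 2 * (k1 + k2) \<le> int M - 1"
| "in_range M Ser_I' k1 k2 \<longleftrightarrow> k1 \<le> 0 \<and> k1 + k2 \<ge> 0 \<and> k1 + 2 * k2 \<le> int M - 1"
| "in_range M Ser_III' k1 k2 \<longleftrightarrow> k1 \<le> -1 \<and> k1 + k2 \<ge> 0 \<and> k1 + 2 * k2 \<le> int M"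

definition principal_labels :: "nat \<Rightarrow> label set" where
  "principal_labels M =
     {(dotted, m2, J, k1, k2). m2 \<in> {0, 1} \<and> J \<in> {Ser_I, Ser_III} \<and> in_range M J k1 k2}"

definition nonprincipal_labels :: "nat \<Rightarrow> label set" where
  "nonprincipal_labels M =
     {(dotted, m2, J, k1, k2).
        \<not> dotted \<and> m2 \<in> {0, 1} \<and> J \<in> {Ser_I', Ser_III'} \<and> in_range M J k1 k2}"


section \<open>Modified characters of the \<open>N = 3\<close> superconformal algebras\<close>

definition eta :: "complex \<Rightarrow> complex" where
  "eta \<tau> = qpow \<tau> (1/24) * (\<Prod>k. 1 - qpow \<tau> (real (Suc k)))"

definition vtheta00 :: "complex \<Rightarrow> complex \<Rightarrow> complex" where
  "vtheta00 \<tau> z = theta 2 2 \<tau> z + theta 0 2 \<tau> z"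
definition vtheta01 :: "complex \<Rightarrow> complex \<Rightarrow> complex" where
  "vtheta01 \<tau> z = - theta 2 2 \<tau> z + theta 0 2 \<tau> z"
definition vtheta10 :: "complex \<Rightarrow> complex \<Rightarrow> complex" where
  "vtheta10 \<tau> z = theta 1 2 \<tau> z + theta (-1) 2 \<tau> z"
definition vtheta11 :: "complex \<Rightarrow> complex \<Rightarrow> complex" where
  "vtheta11 \<tau> z = \<i> * theta 1 2 \<tau> z - \<i> * theta (-1) 2 \<tau> z"

text \<open>The zeros of these denominators lie outside \<open>fdom\<close>.\<close>

definition R_plus :: "complex \<Rightarrow> complex \<Rightarrow> complex" where
  "R_plus \<tau> z = eta (\<tau> / 2) * eta (2 * \<tau>) * vtheta11 \<tau> z / vtheta00 \<tau> z"
definition R_minus :: "complex \<Rightarrow> complex \<Rightarrow> complex" where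
  "R_minus \<tau> z = eta \<tau> ^ 3 * vtheta11 \<tau> z / (eta (\<tau> / 2) * vtheta01 \<tau> z)"
definition R_tw :: "complex \<Rightarrow> complex \<Rightarrow> complex" where
  "R_tw \<tau> z = eta \<tau> ^ 3 * vtheta11 \<tau> z / (eta (2 * \<tau>) * vtheta10 \<tau> z)"

text \<open>The only dotted labels used are those of the series \<open>I\<close> and \<open>III\<close>.\<close>

fun label_j :: "nat \<Rightarrow> label \<Rightarrow> real" where
  "label_j M (dotted, m2, J, k1, k2) =
     (if J \<in> {Ser_I, Ser_I'}
      then (if dotted then (of_int k1 + real M) / 2 else of_int k1 / 2)
      else (if dotted then (of_int (k1 + 2 * k2) - real M) / 2 else of_int (k1 + 2 * k2) / 2))"

fun label_k :: "nat \<Rightarrow> label \<Rightarrow> real" where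
  "label_k M (dotted, m2, J, k1, k2) =
     (if J \<in> {Ser_I, Ser_I'}
      then (if dotted then - (of_int (k1 + 2 * k2) - real M) / 2 else - of_int (k1 + 2 * k2) / 2)
      else (if dotted then - (of_int k1 + real M) / 2 else - of_int k1 / 2))"

fun label_m2 :: "label \<Rightarrow> nat" where
  "label_m2 (dotted, m2, J, k1, k2) = m2"

text \<open>
  The modified numerator attached to a label, up to a non-zero scalar: \<open>(\<sigma>, \<sigma>') = (1/2, 1/2)\<close> for
  Neveu--Schwarz characters, \<open>(0, 1/2)\<close> for Neveu--Schwarz supercharacters and \<open>(1/2, 0)\<close> for Ramond
  characters.
\<close>

definition mod_numerator ::
  "nat \<Rightarrow> nat \<Rightarrow> real \<Rightarrow> real \<Rightarrow> label \<Rightarrow> complex \<Rightarrow> complex \<Rightarrow> complex" where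
  "mod_numerator M n \<sigma> \<sigma>' l \<tau> z =
     f_fun M n 0 \<sigma> \<sigma>' (label_j M l) (label_k M l) \<tau> z
     - (-1) ^ label_m2 l * f_fun M n (1/2) \<sigma> \<sigma>' (label_j M l) (label_k M l) \<tau> z"

text \<open>
  The modified (super)characters of the module obtained from \<open>L(\<Lambda>)\<close>, one for each presentation of
  \<open>\<Lambda>\<close> by a label and each normalizing scalar \<open>a \<noteq> 0\<close>. For special \<open>m\<close> several labels may present the
  same weight; the modification belongs to the presentation.
\<close>

definition mod_characters ::
  "(complex \<Rightarrow> complex \<Rightarrow> complex) \<Rightarrow> real \<Rightarrow> real \<Rightarrow> nat \<Rightarrow> nat \<Rightarrow> real \<Rightarrow> weight
   \<Rightarrow> (complex \<Rightarrow> complex \<Rightarrow> complex) set" where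
  "mod_characters R \<sigma> \<sigma>' M n m \<Lambda> =
     {on_dom (\<lambda>\<tau> z. a * mod_numerator M n \<sigma> \<sigma>' l \<tau> z / R \<tau> z) | a l.
        a \<noteq> 0 \<and> l \<in> principal_labels M \<union> nonprincipal_labels M \<and> adm_weight M m l = \<Lambda>}"

definition NS_characters :: "nat \<Rightarrow> nat \<Rightarrow> real \<Rightarrow> weight \<Rightarrow> (complex \<Rightarrow> complex \<Rightarrow> complex) set" where
  "NS_characters = mod_characters R_plus (1/2) (1/2)"
definition NS_supercharacters :: "nat \<Rightarrow> nat \<Rightarrow> real \<Rightarrow> weight \<Rightarrow> (complex \<Rightarrow> complex \<Rightarrow> complex) set" where
  "NS_supercharacters = mod_characters R_minus 0 (1/2)"
definition Ramond_characters :: "nat \<Rightarrow> nat \<Rightarrow> real \<Rightarrow> weight \<Rightarrow> (complex \<Rightarrow> complex \<Rightarrow> complex) set" where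
  "Ramond_characters = mod_characters R_tw (1/2) 0"

text \<open>
  The functions \<open>f\<close> are modified numerators, and the three kinds of (super)characters have different
  denominators, while \<open>slash\<close> is the weight one action under which the numerators transform. So the
  modified (super)characters enter the span multiplied by their denominators.
\<close>

definition times_den ::
  "(complex \<Rightarrow> complex \<Rightarrow> complex) \<Rightarrow> (complex \<Rightarrow> complex \<Rightarrow> complex) \<Rightarrow> complex \<Rightarrow> complex \<Rightarrow> complex" where
  "times_den R F = (\<lambda>\<tau> z. R \<tau> z * F \<tau> z)"

definition gens_NS :: "nat \<Rightarrow> nat \<Rightarrow> real \<Rightarrow> weight \<Rightarrow> (complex \<Rightarrow> complex \<Rightarrow> complex) set" where
  "gens_NS M n m \<Lambda> =
     times_den R_plus ` NS_characters M n m \<Lambda> \<union> times_den R_minus ` NS_supercharacters M n m \<Lambda>"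

definition gens_Ramond :: "nat \<Rightarrow> nat \<Rightarrow> real \<Rightarrow> weight \<Rightarrow> (complex \<Rightarrow> complex \<Rightarrow> complex) set" where
  "gens_Ramond M n m \<Lambda> = times_den R_tw ` Ramond_characters M n m \<Lambda>"

definition V :: "nat \<Rightarrow> nat \<Rightarrow> real \<Rightarrow> (complex \<Rightarrow> complex \<Rightarrow> complex) set" where
  "V M n m = cspan
     ((\<Union>\<Lambda>\<in>adm_weight M m ` principal_labels M. gens_NS M n m \<Lambda>)
      \<union> (\<Union>\<Lambda>\<in>adm_weight M m ` nonprincipal_labels M. gens_NS M n m \<Lambda>)
      \<union> (\<Union>\<Lambda>\<in>adm_weight M m ` (principal_labels M \<union> nonprincipal_labels M). gens_Ramond M n m \<Lambda>))"

end

theory Submission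
  imports Defs "HOL-Probability.Characteristic_Functions" "HOL-Real_Asymp.Real_Asymp"
begin

text \<open>
  Poisson summation along the rows \<open>\<mu> + \<int>\<close> identifies \<open>-2\<pi>i\<close> times the modification of
  \<open>\<Phi>(\<tau>, z\<^sub>1, z\<^sub>2)\<close> with the sum of two absolutely convergent series over \<open>\<mu> \<in> \<int>\<tau> + \<int>\<close>, whose terms
  are a Gaussian divided by \<open>z\<^sub>1 + \<mu>\<close> and by \<open>z\<^sub>2 + \<mu>\<close> respectively; the error functions of the
  modification are exactly what the row sums contribute. Consequently every \<open>f\<close> is a constant multiple of
  \<open>\<Sum>p c(p) h\<^sub>p(\<tau>, z)\<close> with \<open>p = P\<tau> + Q\<close>, \<open>P, Q \<in> \<int>/4\<close>, bounded coefficients \<open>c\<close>, and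
  \<open>h\<^sub>p(\<tau>, z) = exp(-\<pi>\<kappa>/Im \<tau> (p p\<^sup>* + p\<^sup>* z + z\<^sup>2/4)) / (z/2 + p)\<close>, \<open>\<kappa> = n/M\<close>, and the action of
  \<open>SL\<^sub>2(\<int>)\<close> merely permutes the kernels \<open>h\<^sub>p\<close> linearly in \<open>(P, Q)\<close>. As \<open>n\<close> and \<open>M\<close> are coprime, a finite
  Fourier transform in the index \<open>k\<close> turns the coefficients into functions built from the symplectic form on
  \<open>(P, Q)\<close>-space, which are permuted by \<open>SL\<^sub>2(\<int>)\<close>; this gives the invariance.

  For the comparison of the two spans, quasi-periodicity in \<open>(j, k)\<close> modulo \<open>M\<close> and the symmetry
  exchanging \<open>j\<close> and \<open>k\<close> reduce all indices to those of the admissible weights, the choices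
  \<open>m\<^sub>2 = 0, 1\<close> separate \<open>\<epsilon> = 0\<close> from \<open>\<epsilon> = 1/2\<close>, and the denominators do not vanish on the
  domain by the Jacobi triple product.
\<close>

text \<open>The obstacle is that the coefficients of a single f are not permuted: \<Phi> is taken at
  M\<tau>, so their support is M-sparse in P but full in Q, a shape that SL2(Z) destroys. One half
  of the coefficients depends on k through a character of Q, the other half through the support of P
  modulo M. Summing over k against a character therefore thins out Q in the first half and fills up
  P in the second; the supports become cosets of M Z^2 and of Z^2, and the phases become symplectic
  products. The exclusion of (\<sigma>, \<sigma>') = (0, 0) turns into the condition that s =
  (\<sigma>'/2, \<sigma>/2) lies outside (Z/2)^2, which SL2(Z) respects, while the three remaining
  pairs, that is the three kinds of (super)characters, are mixed. Oddness of M lets a reflection of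
  j - k carry the residues above (M - 1)/2 to those below. The row identity that produces the error
  functions comes from differentiating in an auxiliary drift t, which cancels the pole, so that no
  contour integral occurs.\<close>

section \<open>Dominated convergence and termwise differentiation of unordered sums\<close>

lemma infsum_dominated_convergence:
  fixes f :: "nat \<Rightarrow> 'a \<Rightarrow> complex"
  assumes lim: "\<And>x. x \<in> A \<Longrightarrow> (\<lambda>n. f n x) \<longlonglongrightarrow> F x"
    and bound: "\<And>n x. x \<in> A \<Longrightarrow> norm (f n x) \<le> g x"
    and g: "g summable_on A"
  shows "(\<lambda>n. infsum (f n) A) \<longlonglongrightarrow> infsum F A"
proof -
  have g0: "g x \<ge> 0" if "x \<in> A" for x
    using bound[OF that, of 0] norm_ge_zero order_trans by blast
  have gabs: "(\<lambda>x. norm (g x)) summable_on A"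
    using g by (rule summable_on_cong[THEN iffD1, rotated]) (auto simp: g0)
  have gi: "integrable (count_space A) g"
    using gabs abs_summable_equivalent[of g A] by (simp add: Infinite_Set_Sum.abs_summable_on_def)
  have Fb: "norm (F x) \<le> g x" if "x \<in> A" for x
    by (rule LIMSEQ_le_const2[OF tendsto_norm[OF lim[OF that]]]) (use bound[OF that] in auto)
  have fabs: "(\<lambda>x. norm (f n x)) summable_on A" for n
    by (rule summable_on_comparison_test[OF g]) (use bound in auto)
  have Fabs: "(\<lambda>x. norm (F x)) summable_on A"
    by (rule summable_on_comparison_test[OF g]) (use Fb in auto)
  have "(\<lambda>n. integral\<^sup>L (count_space A) (f n)) \<longlonglongrightarrow> integral\<^sup>L (count_space A) F"
    by (rule integral_dominated_convergence[where w=g]) (use lim bound gi in \<open>auto simp: AE_count_space\<close>)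
  moreover have "infsum (f n) A = integral\<^sup>L (count_space A) (f n)" for n
    using infsetsum_infsum[OF abs_summable_equivalent[THEN iffD1, OF fabs], of n] by (simp add: infsetsum_def)
  moreover have "infsum F A = integral\<^sup>L (count_space A) F"
    using infsetsum_infsum[OF abs_summable_equivalent[THEN iffD1, OF Fabs]] by (simp add: infsetsum_def)
  ultimately show ?thesis by simp
qed

lemma summable_on_diff:
  fixes f g :: "'a \<Rightarrow> 'b :: topological_ab_group_add"
  shows "f summable_on A \<Longrightarrow> g summable_on A \<Longrightarrow> (\<lambda>x. f x - g x) summable_on A"
  using summable_on_add[of f A "\<lambda>x. - g x"] by (simp add: summable_on_uminus)

lemma infsum_diff:
  fixes f g :: "'a \<Rightarrow> 'b :: {topological_ab_group_add, t2_space}"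
  shows "f summable_on A \<Longrightarrow> g summable_on A \<Longrightarrow> infsum (\<lambda>x. f x - g x) A = infsum f A - infsum g A"
  using infsum_add[of f A "\<lambda>x. - g x"] by (simp add: summable_on_uminus infsum_uminus)

lemma has_vector_derivative_complex_iff_quotient:
  fixes f :: "real \<Rightarrow> complex"
  shows "(f has_vector_derivative D) (at t) \<longleftrightarrow> ((\<lambda>u. (f u - f t) /\<^sub>R (u - t)) \<longlongrightarrow> D) (at t)"
  by (simp add: has_vector_derivative_complex_iff has_field_derivative_iff tendsto_complex_iff
      divide_inverse mult.commute)

text \<open>By the mean value inequality \<open>g\<close> bounds the difference quotients as well as
  the derivatives, so dominated convergence applies along every sequence tending to
  \<open>t0\<close>, once it has entered the unit ball.\<close>

lemma infsum_has_vector_derivative: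
  fixes f :: "'a \<Rightarrow> real \<Rightarrow> complex"
  assumes der: "\<And>x t. x \<in> A \<Longrightarrow> t \<in> ball t0 1 \<Longrightarrow> (f x has_vector_derivative f' x t) (at t)"
    and bound: "\<And>x t. x \<in> A \<Longrightarrow> t \<in> ball t0 1 \<Longrightarrow> norm (f' x t) \<le> g x"
    and g: "g summable_on A"
    and f: "\<And>t. t \<in> ball t0 1 \<Longrightarrow> (\<lambda>x. f x t) summable_on A"
  shows "((\<lambda>t. infsum (\<lambda>x. f x t) A) has_vector_derivative infsum (\<lambda>x. f' x t0) A) (at t0)"
proof -
  define F where "F t = infsum (\<lambda>x. f x t) A" for t
  have lip: "norm (f x t - f x t0) \<le> g x * norm (t - t0)" if "x \<in> A" "t \<in> ball t0 1" for x t
  proof (rule differentiable_bound[of "ball t0 1" "f x" "\<lambda>t h. h *\<^sub>R f' x t"])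
    show "\<And>u. u \<in> ball t0 1 \<Longrightarrow> (f x has_derivative (\<lambda>h. h *\<^sub>R f' x u)) (at u within ball t0 1)"
      using der[OF that(1)] by (auto simp: has_vector_derivative_def intro: has_derivative_at_withinI)
    show "onorm (\<lambda>h. h *\<^sub>R f' x u) \<le> g x" if u: "u \<in> ball t0 1" for u
      by (rule onorm_bound) (use bound[OF \<open>x \<in> A\<close> u] norm_ge_zero[of "f' x u"] in
          \<open>auto intro!: mult_left_mono simp: mult.commute[of "g x"] simp del: norm_ge_zero\<close>)
  qed (use that in auto)
  have "((\<lambda>t. (F t - F t0) /\<^sub>R (t - t0)) \<longlongrightarrow> infsum (\<lambda>x. f' x t0) A) (at t0)"
    unfolding tendsto_at_iff_sequentially comp_def
  proof (intro allI impI)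
    fix X :: "nat \<Rightarrow> real" assume X: "\<forall>i. X i \<in> UNIV - {t0}" "X \<longlonglongrightarrow> t0"
    obtain N where N: "\<And>n. n \<ge> N \<Longrightarrow> X n \<in> ball t0 1"
      using X(2) unfolding lim_sequentially by (metis dist_commute mem_ball zero_less_one)
    have "(\<lambda>n. infsum (\<lambda>x. (f x (X (n+N)) - f x t0) /\<^sub>R (X (n+N) - t0)) A) \<longlonglongrightarrow> infsum (\<lambda>x. f' x t0) A"
    proof (rule infsum_dominated_convergence[OF _ _ g])
      fix x assume x: "x \<in> A"
      have "(f x has_vector_derivative f' x t0) (at t0)" using der[OF x] by simp
      hence "((\<lambda>t. (f x t - f x t0) /\<^sub>R (t - t0)) \<longlongrightarrow> f' x t0) (at t0)"
        by (simp add: has_vector_derivative_complex_iff_quotient)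
      moreover have "(\<lambda>n. X (n+N)) \<longlonglongrightarrow> t0" using X(2) by (rule LIMSEQ_ignore_initial_segment)
      ultimately show "(\<lambda>n. (f x (X (n+N)) - f x t0) /\<^sub>R (X (n+N) - t0)) \<longlonglongrightarrow> f' x t0"
        unfolding tendsto_at_iff_sequentially comp_def using X(1) by auto
    next
      fix n x assume x: "x \<in> A"
      have "X (n+N) - t0 \<noteq> 0" using X(1) by auto
      thus "norm ((f x (X (n+N)) - f x t0) /\<^sub>R (X (n+N) - t0)) \<le> g x"
        using lip[OF x N[of "n+N"]] by (simp add: divide_simps mult.commute)
    qed
    moreover have "infsum (\<lambda>x. (f x (X (n+N)) - f x t0) /\<^sub>R (X (n+N) - t0)) A = (F (X (n+N)) - F t0) /\<^sub>R (X (n+N) - t0)" for n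
    proof -
      have s: "(\<lambda>x. f x (X (n+N))) summable_on A" "(\<lambda>x. f x t0) summable_on A"
        using f[OF N[of "n+N"]] f[of t0] by auto
      have "(\<lambda>x. f x (X (n+N)) - f x t0) summable_on A" using s by (intro summable_on_diff)
      thus ?thesis unfolding F_def
        using s by (simp add: infsum_scaleR_right infsum_diff)
    qed
    ultimately have "(\<lambda>n. (F (X (n+N)) - F t0) /\<^sub>R (X (n+N) - t0)) \<longlonglongrightarrow> infsum (\<lambda>x. f' x t0) A" by simp
    thus "(\<lambda>n. (F (X n) - F t0) /\<^sub>R (X n - t0)) \<longlonglongrightarrow> infsum (\<lambda>x. f' x t0) A"
      by (rule LIMSEQ_offset)
  qed
  thus ?thesis
    unfolding F_def[symmetric]
    by (simp add: has_vector_derivative_complex_iff_quotient)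
qed

section \<open>Gaussian sums\<close>

lemma summable_on_UNIV_int:
  fixes f :: "int \<Rightarrow> real"
  assumes "(\<lambda>n. f (int n)) summable_on UNIV" "(\<lambda>n. f (- int n)) summable_on UNIV"
  shows "f summable_on UNIV"
proof -
  have "f summable_on range int" using assms(1) by (subst summable_on_reindex) (auto simp: o_def inj_on_def)
  moreover have "f summable_on range (\<lambda>n. - int n)" using assms(2) by (subst summable_on_reindex) (auto simp: o_def inj_on_def)
  ultimately have "f summable_on (range int \<union> range (\<lambda>n. - int n))" by (rule summable_on_union)
  moreover have "range int \<union> range (\<lambda>n. - int n) = UNIV"
    by (auto simp: image_iff) (metis int_cases2)
  ultimately show ?thesis by simp
qed

lemma gauss_summable_int:
  fixes c :: real assumes "c > 0"
  shows "(\<lambda>b::int. exp (- c * (of_int b)\<^sup>2)) summable_on UNIV"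
proof -
  have g: "(\<lambda>n::nat. exp (- c * (of_nat n)\<^sup>2)) summable_on UNIV"
  proof (rule summable_on_comparison_test)
    have "summable (\<lambda>n. exp (-c) ^ n)" using assms by (intro summable_geometric) auto
    thus "(\<lambda>n. exp (-c) ^ n) summable_on UNIV" by (subst summable_on_UNIV_nonneg_real_iff) auto
    show "exp (- c * (real n)\<^sup>2) \<le> exp (-c) ^ n" for n
    proof -
      have "real n \<le> (real n)\<^sup>2" by (cases "n = 0") (auto simp: power2_eq_square mult_le_cancel_right1)
      thus ?thesis using assms by (simp add: exp_of_nat_mult[symmetric] mult.commute[of "real n"])
    qed
  qed auto
  show ?thesis by (rule summable_on_UNIV_int) (use g in auto)
qed

lemma gauss_summable_int2:
  fixes c :: real assumes "c > 0"
  shows "(\<lambda>(a::int,b::int). exp (- c * ((of_int a)\<^sup>2 + (of_int b)\<^sup>2))) summable_on UNIV"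
proof -
  have "(\<lambda>(a::int,b::int). exp (- c * (of_int a)\<^sup>2) * exp (- c * (of_int b)\<^sup>2)) summable_on UNIV \<times> UNIV"
  proof (rule summable_on_SigmaI)
    show "((\<lambda>b. case (a, b) of (a, b) \<Rightarrow> exp (- c * (of_int a)\<^sup>2) * exp (- c * (of_int b)\<^sup>2))
        has_sum exp (- c * (of_int a)\<^sup>2) * (\<Sum>\<^sub>\<infinity>b::int. exp (- c * (of_int b)\<^sup>2))) UNIV" for a :: int
      unfolding prod.case by (intro has_sum_cmult_right has_sum_infsum gauss_summable_int assms)
    show "(\<lambda>a::int. exp (- c * (of_int a)\<^sup>2) * (\<Sum>\<^sub>\<infinity>b::int. exp (- c * (of_int b)\<^sup>2))) summable_on UNIV"
      by (intro summable_on_cmult_left gauss_summable_int assms)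
  qed auto
  thus ?thesis by (simp add: case_prod_beta' exp_add[symmetric] ring_distribs)
qed

text \<open>Completing the square: half of the Gaussian decay absorbs any linear growth, at the cost
  of a constant. Every convergence proof with a shifted Gaussian below rests on this.\<close>

lemma quadratic_linear_bound:
  fixes c :: real assumes "c > 0"
  shows "- c * x\<^sup>2 + C * x \<le> - (c/2) * x\<^sup>2 + C\<^sup>2 / (2*c)"
proof -
  have "0 \<le> (c * x - C)\<^sup>2 / (2*c)" using assms by simp
  also have "\<dots> = c/2 * x\<^sup>2 - C * x + C\<^sup>2/(2*c)" using assms by (simp add: field_simps power2_eq_square)
  finally show ?thesis by simp
qed

lemma gauss_linear_summable_int:
  fixes c C :: real assumes "c > 0"
  shows "(\<lambda>b::int. exp (- c * (of_int b)\<^sup>2 + C * of_int b)) summable_on UNIV"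
proof (rule summable_on_comparison_test)
  show "(\<lambda>b::int. exp (C\<^sup>2/(2*c)) * exp (- (c/2) * (of_int b)\<^sup>2)) summable_on UNIV"
    using assms by (intro summable_on_cmult_right gauss_summable_int) auto
  show "exp (- c * (of_int b)\<^sup>2 + C * of_int b) \<le> exp (C\<^sup>2/(2*c)) * exp (- (c/2) * (of_int b)\<^sup>2)" for b :: int
    using quadratic_linear_bound[OF assms, of "of_int b" C] by (simp add: exp_add[symmetric] add.commute)
qed auto

lemma gauss_linear_summable_int2:
  fixes c C :: real assumes "c > 0"
  shows "(\<lambda>(a::int,b::int). exp (- c * ((of_int a)\<^sup>2 + (of_int b)\<^sup>2) + C * (\<bar>of_int a\<bar> + \<bar>of_int b\<bar>))) summable_on UNIV"
proof (rule summable_on_comparison_test)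
  show "(\<lambda>x. exp (2*(C\<^sup>2/(2*c))) * (\<lambda>(a::int,b::int). exp (- (c/2) * ((of_int a)\<^sup>2 + (of_int b)\<^sup>2))) x) summable_on UNIV"
    using assms by (intro summable_on_cmult_right gauss_summable_int2) auto
  show "(case x of (a, b) \<Rightarrow> exp (- c * ((of_int a)\<^sup>2 + (of_int b)\<^sup>2) + C * (\<bar>of_int a\<bar> + \<bar>of_int b\<bar>)))
         \<le> exp (2*(C\<^sup>2/(2*c))) * (\<lambda>(a::int,b::int). exp (- (c/2) * ((of_int a)\<^sup>2 + (of_int b)\<^sup>2))) x" for x :: "int \<times> int"
    using quadratic_linear_bound[OF assms, of "\<bar>of_int (fst x)\<bar>" C] quadratic_linear_bound[OF assms, of "\<bar>of_int (snd x)\<bar>" C]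
    by (auto simp: exp_add[symmetric] case_prod_beta ring_distribs)
qed (auto simp: case_prod_beta)

section \<open>The error function\<close>

lemma gaussE_has_real_derivative:
  "(gaussE has_real_derivative 2 * exp (- pi * x\<^sup>2)) (at x)"
proof -
  \<comment> \<open>A window that contains the base point 0 and has \<open>x\<close> in its
    interior, whatever the sign of \<open>x\<close>.\<close>
  let ?a = "- \<bar>x\<bar> - 1" and ?b = "\<bar>x\<bar> + 1"
  have "((\<lambda>u. LBINT y=0..ereal u. exp (- pi * y\<^sup>2)) has_vector_derivative exp (- pi * x\<^sup>2)) (at x within {?a..?b})"
    using interval_integral_FTC2[of ?a 0 ?b "\<lambda>u. exp (- pi * u\<^sup>2)" x]
    by (simp add: zero_ereal_def continuous_intros)
  moreover have "at x within {?a..?b} = at x" by (rule at_within_interior) (auto simp: interior_atLeastAtMost_real)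
  ultimately have "((\<lambda>u. LBINT y=0..ereal u. exp (- pi * y\<^sup>2)) has_real_derivative exp (- pi * x\<^sup>2)) (at x)"
    by (simp add: has_real_derivative_iff_has_vector_derivative)
  from DERIV_cmult[OF this, of 2] show ?thesis unfolding gaussE_def .
qed

lemma gaussE_0 [simp]: "gaussE 0 = 0"
  by (simp add: gaussE_def zero_ereal_def[symmetric])

lemma gaussE_minus: "gaussE (- x) = - gaussE x"
proof -
  have "((\<lambda>x. gaussE x + gaussE (- x)) has_real_derivative 0) (at x)" for x
    by (rule derivative_eq_intros gaussE_has_real_derivative DERIV_chain2[OF gaussE_has_real_derivative] refl | simp)+
  hence "gaussE x + gaussE (- x) = gaussE 0 + gaussE (- 0)" for x
    by (intro DERIV_isconst_all) auto
  thus ?thesis by (simp add: add_eq_0_iff)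
qed

text \<open>The Gaussian integral over the half line, rescaled by \<open>sqrt pi\<close>, equals
  1/2; for \<open>y \<ge> 0\<close> its truncation at \<open>y\<close> is half of
  \<open>gaussE y\<close>.\<close>

lemma gaussE_at_top: "(gaussE \<longlongrightarrow> 1) at_top"
proof -
  define f where "f = (\<lambda>x::real. indicator {0..} x *\<^sub>R exp (- x\<^sup>2))"
  have i: "integrable lborel f" "integral\<^sup>L lborel f = sqrt pi / 2"
    using gaussian_moment_0 by (auto simp: has_bochner_integral_iff f_def)
  have pi_nonpos: "\<not> pi \<le> 0" using pi_gt_zero by linarith
  have "(\<integral>x. f x \<partial>lborel) = \<bar>sqrt pi\<bar> *\<^sub>R (\<integral>x. f (0 + sqrt pi * x) \<partial>lborel)"
    by (rule lborel_integral_real_affine) simp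
  hence v: "(\<integral>x. f (sqrt pi * x) \<partial>lborel) = 1/2" using i by simp
  have ii: "integrable lborel (\<lambda>x. f (sqrt pi * x))"
    using lborel_integrable_real_affine[OF i(1), of "sqrt pi" 0] by simp
  have "((\<lambda>y. \<integral>x. indicator {..y} x *\<^sub>R f (sqrt pi * x) \<partial>lborel) \<longlongrightarrow> 1/2) at_top"
    using tendsto_integral_at_top[OF _ ii] v by simp
  hence "((\<lambda>y. 2 * (\<integral>x. indicator {..y} x *\<^sub>R f (sqrt pi * x) \<partial>lborel)) \<longlongrightarrow> 2 * (1/2)) at_top"
    by (intro tendsto_intros)
  moreover have "eventually (\<lambda>y. 2 * (\<integral>x. indicator {..y} x *\<^sub>R f (sqrt pi * x) \<partial>lborel) = gaussE y) at_top"
    using eventually_ge_at_top[of 0]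
  proof eventually_elim
    case (elim y)
    have "gaussE y = 2 * (LBINT x:{0..y}. exp (- pi * x\<^sup>2))"
      unfolding gaussE_def using elim by (simp add: interval_integral_Icc zero_ereal_def)
    also have "(LBINT x:{0..y}. exp (- pi * x\<^sup>2)) = (\<integral>x. indicator {..y} x *\<^sub>R f (sqrt pi * x) \<partial>lborel)"
      unfolding set_lebesgue_integral_def f_def
      by (intro Bochner_Integration.integral_cong) (auto simp: indicator_def power_mult_distrib zero_le_mult_iff pi_nonpos)
    finally show ?case by simp
  qed
  ultimately show ?thesis by (simp add: tendsto_cong)
qed

lemma gaussE_strict_mono: "x < y \<Longrightarrow> gaussE x < gaussE y"
  by (rule DERIV_pos_imp_increasing[where f=gaussE]) (auto intro: gaussE_has_real_derivative exI[of _ "2 * exp (- pi * x\<^sup>2)" for x])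

lemma gaussE_le_1: "gaussE x \<le> 1"
  by (rule tendsto_lowerbound[OF gaussE_at_top])
     (auto intro!: eventually_mono[OF eventually_gt_at_top[of x]] less_imp_le gaussE_strict_mono)

text \<open>The difference \<open>h\<close> of the two sides has derivative
  \<open>2 * exp (- pi * x\<^sup>2) * (1 - pi * x)\<close>. It vanishes at 0, grows up to 1/pi, and
  then decreases towards its limit 0, so it is nonnegative on both pieces.\<close>

lemma gaussE_complement_le:
  assumes "x \<ge> 0" shows "1 - gaussE x \<le> exp (- pi * x\<^sup>2)"
proof -
  define h where "h x = exp (- pi * x\<^sup>2) - 1 + gaussE x" for x
  have h': "(h has_real_derivative 2 * exp (- pi * x\<^sup>2) * (1 - pi * x)) (at x)" for x
    unfolding h_def
    by (rule derivative_eq_intros gaussE_has_real_derivative refl | simp add: algebra_simps)+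
  have "h x \<ge> 0"
  proof (cases "x \<le> 1/pi")
    case True
    have "h 0 \<le> h x"
    proof (rule DERIV_nonneg_imp_nondecreasing[OF assms])
      fix u assume "0 \<le> u" "u \<le> x"
      hence "pi * u \<le> pi * (1/pi)" using True pi_gt_zero by (intro mult_left_mono) linarith+
      hence "1 - pi * u \<ge> 0" by simp
      thus "\<exists>y. DERIV h u :> y \<and> 0 \<le> y" using h'[of u] by (intro exI[of _ "2 * exp (- pi * u\<^sup>2) * (1 - pi * u)"]) auto
    qed
    thus ?thesis by (simp add: h_def)
  next
    case False
    have mono: "h y \<le> h x" if "x \<le> y" for y
    proof (rule DERIV_nonpos_imp_nonincreasing[OF that])
      fix u assume "x \<le> u" "u \<le> y"
      hence "pi * (1/pi) \<le> pi * u" using False pi_gt_zero by (intro mult_left_mono) linarith+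
      hence "1 - pi * u \<le> 0" by simp
      thus "\<exists>y. DERIV h u :> y \<and> y \<le> 0" using h'[of u] by (intro exI[of _ "2 * exp (- pi * u\<^sup>2) * (1 - pi * u)"]) (auto intro: mult_nonneg_nonpos mult_nonpos_nonneg)
    qed
    have "((\<lambda>x. exp (- pi * x\<^sup>2)) \<longlongrightarrow> 0) at_top" by real_asymp
    hence "(h \<longlongrightarrow> 0 - 1 + 1) at_top" unfolding h_def by (intro tendsto_intros gaussE_at_top)
    hence "(h \<longlongrightarrow> 0) at_top" by simp
    thus ?thesis
      by (rule tendsto_upperbound) (auto intro!: eventually_mono[OF eventually_ge_at_top[of x]] mono)
  qed
  thus ?thesis by (simp add: h_def)
qed

lemma abs_sgn_minus_gaussE_le:
  assumes "\<bar>s\<bar> \<le> 1" "s = sgn x \<or> x = 0"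
  shows "\<bar>s - gaussE x\<bar> \<le> exp (- pi * x\<^sup>2)"
proof -
  have *: "\<bar>1 - gaussE x\<bar> \<le> exp (- pi * x\<^sup>2)" if "x \<ge> 0" for x
    using gaussE_complement_le[OF that] gaussE_le_1[of x] by simp
  consider "x = 0" | "x > 0" | "x < 0" by linarith
  thus ?thesis
  proof cases
    case 3
    have "\<bar>s - gaussE x\<bar> = \<bar>1 - gaussE (-x)\<bar>" using assms 3 by (auto simp: gaussE_minus)
    thus ?thesis using *[of "-x"] 3 by simp
  qed (use assms * in auto)
qed

section \<open>Poisson summation for Gaussians\<close>

text \<open>The characteristic function of the standard normal distribution, after the substitution
  \<open>x -> sqrt (2 * \<alpha>) * x\<close>.\<close>

lemma gauss_fourier:
  fixes \<alpha> t :: real assumes "\<alpha> > 0"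
  shows "has_bochner_integral lborel (\<lambda>x. exp (of_real (- \<alpha> * x\<^sup>2) + \<i> * of_real (t * x)))
           (complex_of_real (sqrt (pi / \<alpha>) * exp (- t\<^sup>2 / (4 * \<alpha>))))"
proof -
  define s where "s = t / sqrt (2 * \<alpha>)"
  define f where "f x = std_normal_density x *\<^sub>R iexp (s * x)" for x
  have i: "integrable lborel f"
    unfolding f_def by (rule Bochner_Integration.integrable_bound[OF integrable_normal_density[of 1 0]]) auto
  have "(\<integral>x. f x \<partial>lborel) = char std_normal_distribution s"
    unfolding char_def f_def by (subst integral_density) auto
  also have "\<dots> = exp (- s\<^sup>2 / 2)" by (simp add: char_std_normal_distribution)
  finally have "has_bochner_integral lborel f (complex_of_real (exp (- s\<^sup>2 / 2)))"
    using i by (simp add: has_bochner_integral_iff)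
  hence "has_bochner_integral lborel (\<lambda>x. f (0 + sqrt (2*\<alpha>) * x)) (complex_of_real (exp (- s\<^sup>2 / 2)) /\<^sub>R \<bar>sqrt (2*\<alpha>)\<bar>)"
    using assms by (intro lborel_has_bochner_integral_real_affine_iff[THEN iffD1]) auto
  from has_bochner_integral_mult_right[OF this, of "of_real (sqrt (2*pi))"]
  have "has_bochner_integral lborel (\<lambda>x. of_real (sqrt (2*pi)) * f (sqrt (2*\<alpha>) * x)) (of_real (sqrt (2*pi)) * (complex_of_real (exp (- s\<^sup>2 / 2)) /\<^sub>R \<bar>sqrt (2*\<alpha>)\<bar>))"
    by simp
  moreover have "of_real (sqrt (2*pi)) * f (sqrt (2*\<alpha>) * x) = exp (of_real (- \<alpha> * x\<^sup>2) + \<i> * of_real (t * x))" for x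
  proof -
    have 1: "s * (sqrt (2*\<alpha>) * x) = t * x" using assms by (simp add: s_def)
    have "(sqrt (2*\<alpha>) * x)\<^sup>2 / 2 = \<alpha> * x\<^sup>2" using assms by (simp add: power_mult_distrib)
    hence 2: "std_normal_density (sqrt (2*\<alpha>) * x) = 1 / sqrt (2*pi) * exp (- \<alpha> * x\<^sup>2)"
      by (simp add: std_normal_density_def)
    show ?thesis unfolding f_def scaleR_conv_of_real 1 2
      using assms by (simp flip: exp_add exp_of_real)
  qed
  moreover have "of_real (sqrt (2*pi)) * (complex_of_real (exp (- s\<^sup>2 / 2)) /\<^sub>R \<bar>sqrt (2*\<alpha>)\<bar>) = complex_of_real (sqrt (pi / \<alpha>) * exp (- t\<^sup>2 / (4 * \<alpha>)))"
  proof -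
    have "s\<^sup>2 / 2 = t\<^sup>2 / (4*\<alpha>)" using assms by (simp add: s_def power_divide)
    moreover have "sqrt (2*pi) / sqrt (2*\<alpha>) = sqrt (pi/\<alpha>)" by (simp add: real_sqrt_divide[symmetric])
    moreover have "of_real (sqrt (2*pi)) * (complex_of_real (exp (- s\<^sup>2 / 2)) /\<^sub>R \<bar>sqrt (2*\<alpha>)\<bar>)
       = complex_of_real ((sqrt (2*pi) / sqrt (2*\<alpha>)) * exp (- (s\<^sup>2 / 2)))" using assms
      by (simp add: scaleR_conv_of_real field_simps)
    ultimately show ?thesis by simp
  qed
  ultimately show ?thesis by simp
qed

text \<open>A complex centre needs no contour shift: the real part of \<open>w\<close> translates
  the variable, and the imaginary part only changes the frequency to
  \<open>t = 2 * pi * \<xi> - 2 * \<alpha> * v\<close> and contributes a constant factor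
  \<open>c\<close>.\<close>

lemma gauss_fourier_shift:
  fixes \<alpha> \<xi> :: real and w :: complex assumes "\<alpha> > 0"
  shows "has_bochner_integral lborel (\<lambda>x. exp (- of_real \<alpha> * (w + of_real x)\<^sup>2) * exp (2 * of_real pi * \<i> * of_real (\<xi> * x)))
           (of_real (sqrt (pi / \<alpha>)) * exp (- of_real (pi\<^sup>2 * \<xi>\<^sup>2 / \<alpha>) - 2 * of_real pi * \<i> * of_real \<xi> * w))"
proof -
  define u v where "u = Re w" and "v = Im w"
  define t where "t = 2 * pi * \<xi> - 2 * \<alpha> * v"
  define c where "c = exp (of_real (\<alpha> * v\<^sup>2) - 2 * of_real pi * \<i> * of_real (\<xi> * u))"
  have w: "w = of_real u + \<i> * of_real v" by (simp add: u_def v_def complex_eq)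
  have "has_bochner_integral lborel (\<lambda>x. exp (of_real (- \<alpha> * (u + 1 * x)\<^sup>2) + \<i> * of_real (t * (u + 1 * x))))
           (complex_of_real (sqrt (pi / \<alpha>) * exp (- t\<^sup>2 / (4 * \<alpha>))) /\<^sub>R \<bar>1\<bar>)"
    by (rule lborel_has_bochner_integral_real_affine_iff[THEN iffD1, OF _ gauss_fourier[OF assms]]) simp
  from has_bochner_integral_mult_right[OF this, of c]
  have "has_bochner_integral lborel (\<lambda>x. c * exp (of_real (- \<alpha> * (u + x)\<^sup>2) + \<i> * of_real (t * (u + x))))
     (c * complex_of_real (sqrt (pi / \<alpha>) * exp (- t\<^sup>2 / (4 * \<alpha>))))" by simp
  moreover have "c * exp (of_real (- \<alpha> * (u + x)\<^sup>2) + \<i> * of_real (t * (u + x))) =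
     exp (- of_real \<alpha> * (w + of_real x)\<^sup>2) * exp (2 * of_real pi * \<i> * of_real (\<xi> * x))" for x
    unfolding c_def t_def w exp_add[symmetric] by (simp add: algebra_simps power2_eq_square)
  moreover have "c * complex_of_real (sqrt (pi / \<alpha>) * exp (- t\<^sup>2 / (4 * \<alpha>))) =
     of_real (sqrt (pi / \<alpha>)) * exp (- of_real (pi\<^sup>2 * \<xi>\<^sup>2 / \<alpha>) - 2 * of_real pi * \<i> * of_real \<xi> * w)"
  proof -
    have t2: "- t\<^sup>2 / (4 * \<alpha>) = - (pi\<^sup>2 * \<xi>\<^sup>2 / \<alpha>) + 2 * pi * \<xi> * v - \<alpha> * v\<^sup>2"
      using assms by (simp add: t_def field_simps power2_eq_square)
    show ?thesis unfolding t2 c_def w of_real_mult exp_of_real[symmetric]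
      by (simp add: exp_add[symmetric] mult.left_commute algebra_simps)
  qed
  ultimately show ?thesis by (simp only:)
qed

text \<open>Poisson summation is obtained at a single point by testing the Gaussian against the
  Fejer kernel: integrated cell by cell the limit is the sum over the integers, expanded
  into exponentials it is the Cesaro limit of the dual sum.\<close>

definition fejer :: "nat \<Rightarrow> real \<Rightarrow> real" where
  "fejer N x = (cmod (\<Sum>j<N. cis (2 * pi * real j * x)))\<^sup>2 / real N"

lemma fejer_nonneg: "fejer N x \<ge> 0" by (simp add: fejer_def)

lemma continuous_fejer [continuous_intros]: "continuous_on A (fejer N)"
  unfolding fejer_def divide_inverse by (intro continuous_intros)

lemma fejer_expand:
  "complex_of_real (fejer N x) = (\<Sum>j<N. \<Sum>l<N. exp (2 * of_real pi * \<i> * of_real ((real j - real l) * x))) / of_nat N"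
  unfolding fejer_def of_real_divide complex_norm_square cnj_sum sum_product
  by (simp add: cis_cnj cis_mult cis_conv_exp[symmetric] algebra_simps)
     (simp add: cis_conv_exp algebra_simps)

lemma fejer_periodic: "fejer N (of_int b + x) = fejer N x"
proof -
  have "cis (2 * pi * real j * (of_int b + x)) = cis (2 * pi * real j * x)" for j
    using cis_multiple_2pi[of "real j * of_int b"]
    by (simp add: ring_distribs cis_mult[symmetric] mult.assoc)
  thus ?thesis by (simp add: fejer_def)
qed

text \<open>\<open>2 - 2 * cos (2 * pi * x)\<close> is |e(x) - 1|^2 for e(x) = exp(2 pi i x).
  Multiplied into the kernel it telescopes the geometric sum to e(N x) - 1, of modulus at most 2.
  The product form stays valid at integers, where the quotient would not make sense.\<close>

lemma fejer_concentrates: "N > 0 \<Longrightarrow> (2 - 2 * cos (2 * pi * x)) * fejer N x \<le> 4 / real N"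
proof -
  assume N: "N > 0"
  have "cis (2 * pi * real j * x) = cis (2 * pi * x) ^ j" for j
  proof -
    have "2 * pi * real j * x = real j * (2 * pi * x)" by simp
    thus ?thesis by (simp only: Complex.DeMoivre)
  qed
  hence "(cis (2*pi*x) - 1) * (\<Sum>j<N. cis (2 * pi * real j * x)) = cis (2 * pi * x) ^ N - 1"
    by (simp add: power_diff_1_eq)
  hence "cmod (cis (2*pi*x) - 1) * cmod (\<Sum>j<N. cis (2 * pi * real j * x)) = cmod (cis (2 * pi * x) ^ N - 1)"
    by (metis norm_mult)
  also have "\<dots> \<le> 2" using norm_triangle_ineq4[of "cis (2 * pi * x) ^ N" 1] by (simp add: norm_power)
  finally have "(cmod (cis (2*pi*x) - 1) * cmod (\<Sum>j<N. cis (2 * pi * real j * x)))\<^sup>2 \<le> 2\<^sup>2"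
    by (intro power_mono) auto
  moreover have "(cmod (cis (2*pi*x) - 1))\<^sup>2 = 2 - 2 * cos (2 * pi * x)"
    using sin_cos_squared_add[of "2*pi*x"] unfolding cmod_power2 by (simp add: power2_eq_square algebra_simps)
  ultimately show ?thesis using N by (simp add: fejer_def power_mult_distrib divide_right_mono)
qed

lemma integral_exp_period:
  "(LINT x:{-1/2..<1/2}|lborel. exp (2 * of_real pi * \<i> * of_real (of_int k * x))) = (if k = 0 then 1 else 0)"
proof -
  \<comment> \<open>Half-open cells tile the line, but the fundamental theorem of calculus is
    applied on the closed cell, which differs by a null set.\<close>
  have ic: "(LINT x:{-1/2..<1/2}|lborel. exp (2 * of_real pi * \<i> * of_real (of_int k * x))) =
        (LINT x:{-1/2..1/2}|lborel. exp (2 * of_real pi * \<i> * of_real (of_int k * x)))"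
  proof (rule set_integral_cong_set)
    show "AE x in lborel. (x \<in> {-1/2..1/2::real}) = (x \<in> {-1/2..<1/2})"
      by (auto intro!: eventually_mono[OF AE_lborel_singleton[of "1/2"]])
    have "(\<lambda>x::real. exp (2 * of_real pi * \<i> * of_real (of_int k * x))) \<in> borel_measurable borel"
      by (intro borel_measurable_continuous_onI continuous_intros)
    thus "set_borel_measurable lborel {-1/2..1/2} (\<lambda>x. exp (2 * of_real pi * \<i> * of_real (of_int k * x)))"
         "set_borel_measurable lborel {-1/2..<1/2} (\<lambda>x. exp (2 * of_real pi * \<i> * of_real (of_int k * x)))"
      unfolding set_borel_measurable_def by measurable
  qed
  show ?thesis
  proof (cases "k = 0")
    case True thus ?thesis unfolding ic by (simp add: set_integral_const)
  next
    case False
    define c where "c = 2 * of_real pi * \<i> * of_int k"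
    have c0: "c \<noteq> 0" using False by (simp add: c_def)
    have "(LBINT x:{-1/2..1/2}. exp (c * of_real x)) = exp (c * of_real (1/2)) / c - exp (c * of_real (-1/2)) / c"
      unfolding set_lebesgue_integral_def
    proof (rule integral_FTC_Icc[where F = "\<lambda>x. exp (c * of_real x) / c"])
      fix x :: real
      have "((\<lambda>z. exp (c * z) / c) has_field_derivative exp (c * of_real x)) (at (of_real x))"
        using c0 by (auto intro!: derivative_eq_intros)
      thus "((\<lambda>x. exp (c * of_real x) / c) has_vector_derivative exp (c * of_real x)) (at x within {-1/2..1/2})"
        by (rule has_vector_derivative_at_within[OF has_vector_derivative_real_field])
    qed (auto intro!: continuous_intros)
    also have "exp (c * of_real (1/2)) = exp (c * of_real (-1/2))"
    proof -
      have "c * of_real (1/2) = c * of_real (-1/2) + (2 * of_int k * of_real pi) * \<i>"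
        by (simp add: c_def field_simps)
      moreover have "exp ((2 * of_int k * of_real pi) * \<i>) = 1"
        using exp_2pi_1_int[of k] by (simp add: mult_ac)
      ultimately show ?thesis by (simp only: exp_add mult_1_right)
    qed
    finally have "(LBINT x:{-1/2..1/2}. exp (c * of_real x)) = 0" by simp
    moreover have "c * of_real x = 2 * of_real pi * \<i> * of_real (of_int k * x)" for x by (simp add: c_def)
    ultimately show ?thesis using False unfolding ic by (simp only: if_False)
  qed
qed


lemma set_integrable_continuous_Ico:
  fixes f :: "real \<Rightarrow> 'b::euclidean_space"
  assumes "continuous_on UNIV f"
  shows "set_integrable lborel {a..<b} f"
  by (rule set_integrable_subset[OF borel_integrable_atLeastAtMost', of a b])
     (auto intro: continuous_on_subset[OF assms])

lemma set_integrable_sum: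
  fixes f :: "'i \<Rightarrow> 'a \<Rightarrow> 'b::{banach, second_countable_topology}"
  shows "(\<And>i. i \<in> I \<Longrightarrow> set_integrable M A (f i)) \<Longrightarrow> set_integrable M A (\<lambda>x. \<Sum>i\<in>I. f i x)"
  by (simp add: set_integrable_def scaleR_sum_right)

lemma set_integral_sum:
  fixes f :: "'i \<Rightarrow> 'a \<Rightarrow> 'b::{banach, second_countable_topology}"
  shows "(\<And>i. i \<in> I \<Longrightarrow> set_integrable M A (f i)) \<Longrightarrow>
    (LINT x:A|M. (\<Sum>i\<in>I. f i x)) = (\<Sum>i\<in>I. LINT x:A|M. f i x)"
  by (simp add: set_integrable_def set_lebesgue_integral_def scaleR_sum_right)

lemma fejer_integral: "N > 0 \<Longrightarrow> (LINT x:{-1/2..<1/2}|lborel. fejer N x) = 1"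
proof -
  assume N: "N > 0"
  have si: "set_integrable lborel {-1/2..<1/2} (\<lambda>x. exp (2 * of_real pi * \<i> * of_real ((real j - real l) * x)))" for j l
    by (intro set_integrable_continuous_Ico continuous_intros)
  have "complex_of_real (LINT x:{-1/2..<1/2}|lborel. fejer N x) = (LINT x:{-1/2..<1/2}|lborel. complex_of_real (fejer N x))"
    unfolding set_lebesgue_integral_def by (simp add: scaleR_conv_of_real flip: integral_complex_of_real)
  also have "\<dots> = (\<Sum>j<N. \<Sum>l<N. (LINT x:{-1/2..<1/2}|lborel. exp (2 * of_real pi * \<i> * of_real ((real j - real l) * x)))) / of_nat N"
  proof -
    have "(LINT x:{-1/2..<1/2}|lborel. \<Sum>j<N. \<Sum>l<N. exp (2 * of_real pi * \<i> * of_real ((real j - real l) * x)))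
      = (\<Sum>j<N. LINT x:{-1/2..<1/2}|lborel. \<Sum>l<N. exp (2 * of_real pi * \<i> * of_real ((real j - real l) * x)))"
      by (rule set_integral_sum, rule set_integrable_sum, rule si)
    also have "\<dots> = (\<Sum>j<N. \<Sum>l<N. (LINT x:{-1/2..<1/2}|lborel. exp (2 * of_real pi * \<i> * of_real ((real j - real l) * x))))"
      by (rule sum.cong[OF refl], rule set_integral_sum, rule si)
    finally show ?thesis unfolding fejer_expand set_integral_divide_zero by (simp only:)
  qed
  also have "\<dots> = (\<Sum>j<N. \<Sum>l<N. if j = l then 1 else 0) / of_nat N"
  proof -
    have "(LINT x:{-1/2..<1/2}|lborel. exp (2 * of_real pi * \<i> * of_real ((real j - real l) * x))) = (if j = l then 1 else 0)" for j l
      using integral_exp_period[of "int j - int l"] by simp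
    thus ?thesis by (simp only:)
  qed
  also have "\<dots> = 1" using N by simp
  finally have "complex_of_real (LINT x:{-1/2..<1/2}|lborel. fejer N x) = of_real 1" by (simp only: of_real_1)
  thus ?thesis by (rule of_real_eq_iff[THEN iffD1])
qed

text \<open>A Korovkin argument: |f(x) - f(0)| is at most e/2 plus a multiple of 2 - 2 cos(2 pi x),
  and against the kernel the second term costs at most 4 K / N by \<open>fejer_concentrates\<close>.
  The integral is never split into a near and a far part.\<close>

lemma fejer_approximate_identity:
  fixes f :: "real \<Rightarrow> complex"
  assumes cont: "continuous_on UNIV f" and bd: "\<And>x. x \<in> {-1/2..<1/2} \<Longrightarrow> norm (f x) \<le> B"
  shows "(\<lambda>N. LINT x:{-1/2..<1/2}|lborel. f x * of_real (fejer N x)) \<longlonglongrightarrow> f 0"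
proof (rule LIMSEQ_I)
  fix e :: real assume e: "e > 0"
  have "\<exists>d>0. \<forall>x\<in>UNIV. dist x 0 < d \<longrightarrow> dist (f x) (f 0) < e / 2"
    using cont[unfolded continuous_on_iff, rule_format, of 0 "e/2"] e by simp
  then obtain d0 where d0: "d0 > 0" "\<And>x. dist x 0 < d0 \<Longrightarrow> dist (f x) (f 0) < e / 2" by blast
  define d where "d = min d0 (1/2)"
  have d: "0 < d" "d \<le> 1/2" using d0(1) by (auto simp: d_def)
  have d3: "norm (f x - f 0) \<le> e/2" if "\<bar>x\<bar> < d" for x
    using d0(2)[of x] that by (simp add: d_def dist_norm)
  define m where "m = 2 - 2 * cos (2 * pi * d)"
  have "cos (2 * pi * d) < cos 0" using d pi_gt_zero by (intro cos_monotone_0_pi) (auto simp: field_simps)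
  hence m: "m > 0" by (simp add: m_def)
  have B0: "B \<ge> 0" by (rule order_trans[OF norm_ge_zero bd[of 0]]) simp
  \<comment> \<open>\<open>m\<close> is the least value of 2 - 2 cos(2 pi x) on the part of the cell
    with |x| at least \<open>d\<close>, so there \<open>K\<close> times that function exceeds the
    trivial bound \<open>2 * B\<close> for |f(x) - f(0)|.\<close>
  define K where "K = 2 * B / m"
  have K0: "K \<ge> 0" using B0 m by (simp add: K_def)
  have key: "norm (f x - f 0) \<le> e/2 + K * (2 - 2 * cos (2 * pi * x))" if x: "x \<in> {-1/2..<1/2}" for x
  proof (cases "\<bar>x\<bar> < d")
    case True
    have "K * (2 - 2 * cos (2 * pi * x)) \<ge> 0" using K0 by simp
    thus ?thesis using d3[OF True] by linarith
  next
    case False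
    have "cos (2 * pi * \<bar>x\<bar>) \<le> cos (2 * pi * d)"
    proof (rule cos_monotone_0_pi_le)
      have "\<bar>x\<bar> \<le> 1/2" using x by auto
      thus "2 * pi * \<bar>x\<bar> \<le> pi" using mult_left_mono[of "\<bar>x\<bar>" "1/2" "2*pi"] pi_gt_zero by simp
    qed (use False d in auto)
    moreover have "cos (2 * pi * \<bar>x\<bar>) = cos (2 * pi * x)" by (simp add: abs_if)
    ultimately have "m \<le> 2 - 2 * cos (2 * pi * x)" by (simp add: m_def)
    hence "K * m \<le> K * (2 - 2 * cos (2 * pi * x))" using K0 by (rule mult_left_mono)
    moreover have "K * m = 2 * B" using m by (simp add: K_def)
    moreover have "norm (f x - f 0) \<le> 2 * B" using bd[OF x] bd[of 0] norm_triangle_ineq4[of "f x" "f 0"] by simp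
    ultimately show ?thesis using e by linarith
  qed
  obtain n0 :: nat where n0: "real n0 > 8 * K / e" using reals_Archimedean2 by blast
  show "\<exists>no. \<forall>N\<ge>no. norm ((LINT x:{-1/2..<1/2}|lborel. f x * of_real (fejer N x)) - f 0) < e"
  proof (intro exI allI impI)
    fix N assume "N \<ge> Suc n0"
    hence N: "N > 0" "real N > 8 * K / e" using n0 by auto
    let ?I = "{-1/2..<1/2::real}"
    have s1: "set_integrable lborel ?I (\<lambda>x. f x * of_real (fejer N x))"
             "set_integrable lborel ?I (\<lambda>x. f 0 * of_real (fejer N x))"
             "set_integrable lborel ?I (\<lambda>x. (f x - f 0) * of_real (fejer N x))"
      by (intro set_integrable_continuous_Ico continuous_intros cont)+
    have s2: "set_integrable lborel ?I (\<lambda>x. (e/2) * fejer N x + K * (4 / real N))"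
             "set_integrable lborel ?I (\<lambda>x. (e/2) * fejer N x)"
             "set_integrable lborel ?I (\<lambda>x. K * (4 / real N))"
      by (intro set_integrable_continuous_Ico continuous_intros)+
    have "(LINT x:?I|lborel. f 0 * of_real (fejer N x)) = f 0 * (LINT x:?I|lborel. complex_of_real (fejer N x))"
      by (rule set_integral_mult_right)
    also have "(LINT x:?I|lborel. complex_of_real (fejer N x)) = of_real (LINT x:?I|lborel. fejer N x)"
      unfolding set_lebesgue_integral_def by (simp add: scaleR_conv_of_real flip: integral_complex_of_real)
    finally have "(LINT x:?I|lborel. f x * of_real (fejer N x)) - f 0 = (LINT x:?I|lborel. (f x - f 0) * of_real (fejer N x))"
      using s1 fejer_integral[OF N(1)] by (simp add: left_diff_distrib set_integral_diff)
    also have "norm \<dots> \<le> (LINT x:?I|lborel. norm ((f x - f 0) * of_real (fejer N x)))"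
      by (rule set_integral_norm_bound[OF s1(3)])
    also have "\<dots> \<le> (LINT x:?I|lborel. (e/2) * fejer N x + K * (4 / real N))"
    proof (rule set_integral_mono)
      show "set_integrable lborel ?I (\<lambda>x. norm ((f x - f 0) * of_real (fejer N x)))"
        using s1(3) by (rule set_integrable_norm)
      fix x assume x: "x \<in> ?I"
      have "norm ((f x - f 0) * of_real (fejer N x)) = norm (f x - f 0) * fejer N x"
        by (simp add: norm_mult fejer_nonneg)
      also have "\<dots> \<le> (e/2 + K * (2 - 2 * cos (2 * pi * x))) * fejer N x"
        by (rule mult_right_mono[OF key[OF x] fejer_nonneg])
      also have "\<dots> = (e/2) * fejer N x + K * ((2 - 2 * cos (2 * pi * x)) * fejer N x)" by (simp add: algebra_simps)
      also have "\<dots> \<le> (e/2) * fejer N x + K * (4 / real N)"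
        by (intro add_left_mono mult_left_mono fejer_concentrates N K0)
      finally show "norm ((f x - f 0) * of_real (fejer N x)) \<le> (e/2) * fejer N x + K * (4 / real N)" .
    qed (rule s2(1))
    also have "\<dots> = (LINT x:?I|lborel. (e/2) * fejer N x) + (LINT x:?I|lborel. K * (4 / real N))"
      by (rule set_integral_add[OF s2(2,3)])
    also have "\<dots> = e/2 + K * (4 / real N)"
      using fejer_integral[OF N(1)] by (simp add: set_integral_const)
    also have "K * (4 / real N) < e/2" using N e by (simp add: field_simps)
    finally show "norm ((LINT x:?I|lborel. f x * of_real (fejer N x)) - f 0) < e" by simp
  qed
qed


text \<open>Countable additivity gives an ordinary series in the enumeration
  \<open>int_decode\<close> of the integers; the summable bound \<open>g\<close> on the cell
  integrals turns it into an unordered sum.\<close>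

lemma integral_split_cells:
  fixes h :: "real \<Rightarrow> complex"
  assumes i: "integrable lborel h"
    and bd: "\<And>b. norm (LINT x:{-1/2..<1/2}|lborel. h (of_int b + x)) \<le> g b" and g: "g summable_on (UNIV :: int set)"
  shows "(\<integral>x. h x \<partial>lborel) = (\<Sum>\<^sub>\<infinity>b\<in>UNIV. LINT x:{-1/2..<1/2}|lborel. h (of_int b + x))"
proof -
  define A where "A b = {of_int b - 1/2..<of_int b + 1/2 :: real}" for b :: int
  define J where "J b = (LINT x:{-1/2..<1/2}|lborel. h (of_int b + x))" for b :: int
  have J: "(LINT x:A b|lborel. h x) = J b" for b
  proof -
    have "(LINT x:A b|lborel. h x) = (\<integral>x. indicator (A b) (of_int b + 1 * x) *\<^sub>R h (of_int b + 1 * x) \<partial>lborel)"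
      unfolding set_lebesgue_integral_def by (subst lborel_integral_real_affine[where c=1 and t="of_int b"]) auto
    also have "\<dots> = J b" unfolding J_def set_lebesgue_integral_def A_def
      by (intro Bochner_Integration.integral_cong) (auto simp: indicator_def)
    finally show ?thesis .
  qed
  have un: "(\<Union>n. A (int_decode n)) = UNIV"
  proof -
    have "\<exists>n. x \<in> A (int_decode n)" for x
    proof -
      have "x \<in> A \<lfloor>x + 1/2\<rfloor>" unfolding A_def by (simp add: ) linarith
      hence "x \<in> A (int_decode (int_encode \<lfloor>x + 1/2\<rfloor>))" by simp
      thus ?thesis by blast
    qed
    thus ?thesis by auto
  qed
  have disj: "A (int_decode m) \<inter> A (int_decode n) = {}" if "m \<noteq> n" for m n
  proof -
    have "int_decode m \<noteq> int_decode n" using that by (simp add: int_decode_eq)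
    thus ?thesis unfolding A_def by auto
  qed
  have "(\<integral>x. h x \<partial>lborel) = (LINT x:(\<Union>n. A (int_decode n))|lborel. h x)" by (simp add: un set_lebesgue_integral_def)
  also have "\<dots> = (\<Sum>n. LINT x:A (int_decode n)|lborel. h x)"
  proof (rule lebesgue_integral_countable_add[OF _ disj])
    show "set_integrable lborel (\<Union>n. A (int_decode n)) h" unfolding un set_integrable_def using i by simp
  qed (auto simp: A_def)
  also have "\<dots> = (\<Sum>n. J (int_decode n))" by (simp add: J)
  also have "\<dots> = (\<Sum>\<^sub>\<infinity>n\<in>UNIV. J (int_decode n))"
  proof -
    have "J summable_on UNIV"
      by (rule abs_summable_summable, rule summable_on_comparison_test[OF g]) (use bd in \<open>auto simp: J_def\<close>)
    hence "(\<lambda>n. J (int_decode n)) summable_on UNIV"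
      using summable_on_reindex_bij_betw[OF bij_int_decode, of J] by simp
    from sums_unique[OF has_sum_imp_sums[OF has_sum_infsum[OF this]]] show ?thesis by simp
  qed
  also have "\<dots> = infsum J UNIV" by (rule infsum_reindex_bij_betw[OF bij_int_decode])
  also have "\<dots> = (\<Sum>\<^sub>\<infinity>b\<in>UNIV. LINT x:{-1/2..<1/2}|lborel. h (of_int b + x))"
    by (rule infsum_cong, rule J_def)
  finally show ?thesis .
qed

text \<open>The value \<open>f k\<close> occurs \<open>c N k\<close> times in the double sum, and N
  - |k| \<le> \<open>c N k\<close> \<le> N. So its weight \<open>c N k / N\<close> is at most 1 and
  tends to 1, and dominated convergence applies.\<close>

lemma cesaro_infsum:
  fixes f :: "int \<Rightarrow> complex"
  assumes "(\<lambda>k. norm (f k)) summable_on UNIV"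
  shows "(\<lambda>N. (\<Sum>j<N. \<Sum>l<N. f (int j - int l)) / of_nat N) \<longlonglongrightarrow> infsum f UNIV"
proof -
  define c where "c N k = card {(j,l). j < N \<and> l < N \<and> int j - int l = k}" for N k
  have fin: "finite {(j,l). j < N \<and> l < N \<and> int j - int l = k}" for N k
    by (rule finite_subset[of _ "{..<N} \<times> {..<N}"]) auto
  have c_le: "c N k \<le> N" for N k
  proof -
    have "c N k = card (fst ` {(j,l). j < N \<and> l < N \<and> int j - int l = k})"
      unfolding c_def by (subst card_image) (auto simp: inj_on_def)
    also have "\<dots> \<le> card {..<N}" by (intro card_mono) auto
    finally show ?thesis by simp
  qed
  have c_ge: "int N - \<bar>k\<bar> \<le> int (c N k)" for N k
  proof (cases "k \<ge> 0")
    case True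
    have "card ((\<lambda>l. (l + nat k, l)) ` {..<N - nat k}) \<le> c N k"
      unfolding c_def using True by (intro card_mono fin) auto
    moreover have "card ((\<lambda>l. (l + nat k, l)) ` {..<N - nat k}) = N - nat k"
      by (subst card_image) (auto simp: inj_on_def)
    ultimately show ?thesis using True by linarith
  next
    case False
    have "card ((\<lambda>l. (l, l + nat (-k))) ` {..<N - nat (-k)}) \<le> c N k"
      unfolding c_def using False by (intro card_mono fin) auto
    moreover have "card ((\<lambda>l. (l, l + nat (-k))) ` {..<N - nat (-k)}) = N - nat (-k)"
      by (subst card_image) (auto simp: inj_on_def)
    ultimately show ?thesis using False by linarith
  qed
  have eq: "(\<Sum>j<N. \<Sum>l<N. f (int j - int l)) / of_nat N = (\<Sum>\<^sub>\<infinity>k. of_real (real (c N k) / real N) * f k)" for N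
  proof -
    define S where "S = (\<lambda>(j,l). int j - int l) ` ({..<N} \<times> {..<N})"
    have "(\<Sum>j<N. \<Sum>l<N. f (int j - int l)) = (\<Sum>x\<in>{..<N} \<times> {..<N}. f (case x of (j,l) \<Rightarrow> int j - int l))"
      by (simp add: sum.cartesian_product case_prod_beta)
    also have "\<dots> = (\<Sum>k\<in>S. \<Sum>x\<in>{x\<in>{..<N} \<times> {..<N}. (case x of (j,l) \<Rightarrow> int j - int l) = k}. f (case x of (j,l) \<Rightarrow> int j - int l))"
      by (rule sum.group[symmetric]) (auto simp: S_def)
    also have "\<dots> = (\<Sum>k\<in>S. of_nat (c N k) * f k)"
    proof (rule sum.cong[OF refl])
      fix k
      have "{x\<in>{..<N} \<times> {..<N}. (case x of (j,l) \<Rightarrow> int j - int l) = k} = {(j,l). j < N \<and> l < N \<and> int j - int l = k}" by auto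
      thus "(\<Sum>x\<in>{x\<in>{..<N} \<times> {..<N}. (case x of (j,l) \<Rightarrow> int j - int l) = k}. f (case x of (j,l) \<Rightarrow> int j - int l)) = of_nat (c N k) * f k"
        by (subst sum.cong[OF refl, where h = "\<lambda>_. f k"]) (auto simp: c_def)
    qed
    finally have "(\<Sum>j<N. \<Sum>l<N. f (int j - int l)) / of_nat N = (\<Sum>k\<in>S. of_real (real (c N k) / real N) * f k)"
      by (simp add: sum_divide_distrib)
    also have "\<dots> = (\<Sum>\<^sub>\<infinity>k\<in>S. of_real (real (c N k) / real N) * f k)" by (rule infsum_finite[symmetric]) (simp add: S_def)
    also have "\<dots> = (\<Sum>\<^sub>\<infinity>k. of_real (real (c N k) / real N) * f k)"
    proof (rule infsum_cong_neutral)
      fix k assume "k \<in> UNIV - S"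
      hence "{(j,l). j < N \<and> l < N \<and> int j - int l = k} = {}" unfolding S_def by auto
      hence "c N k = 0" by (simp only: c_def card.empty)
      thus "of_real (real (c N k) / real N) * f k = 0" by simp
    qed auto
    finally show ?thesis .
  qed
  show ?thesis unfolding eq
  proof (rule infsum_dominated_convergence[OF _ _ assms])
    fix N k
    have "real (c N k) / real N \<le> 1" using c_le[of N k] by (cases "N = 0") auto
    hence "norm (complex_of_real (real (c N k) / real N)) \<le> 1" by (simp add: norm_divide)
    thus "norm (of_real (real (c N k) / real N) * f k) \<le> norm (f k)"
      using mult_right_mono[of "norm (complex_of_real (real (c N k) / real N))" 1 "norm (f k)"] unfolding norm_mult by simp
  next
    fix k :: int
    have "(\<lambda>N. real (c N k) / real N) \<longlonglongrightarrow> 1"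
    proof (rule tendsto_sandwich)
      show "(\<lambda>N. 1 - real_of_int \<bar>k\<bar> / real N) \<longlonglongrightarrow> 1" by real_asymp
      show "\<forall>\<^sub>F N in sequentially. 1 - real_of_int \<bar>k\<bar> / real N \<le> real (c N k) / real N"
        using eventually_gt_at_top[of 0]
      proof eventually_elim
        case (elim N)
        have "real N - real_of_int \<bar>k\<bar> \<le> real (c N k)" using c_ge[of N k] by linarith
        from divide_right_mono[OF this, of "real N"] show ?case using elim by (simp add: diff_divide_distrib)
      qed
      show "\<forall>\<^sub>F N in sequentially. real (c N k) / real N \<le> 1"
        using eventually_gt_at_top[of 0] by eventually_elim (use c_le in \<open>simp add: field_simps\<close>)
    qed auto
    hence "(\<lambda>N. of_real (real (c N k) / real N) * f k) \<longlonglongrightarrow> of_real 1 * f k" by (intro tendsto_intros)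
    thus "(\<lambda>N. of_real (real (c N k) / real N) * f k) \<longlonglongrightarrow> f k" by simp
  qed
qed

lemma norm_exp_gauss_le:
  fixes w :: complex assumes "\<alpha> > 0" "\<bar>x\<bar> \<le> 1/2"
  shows "norm (exp (- of_real \<alpha> * (w + of_real (of_int b + x))\<^sup>2))
     \<le> exp (\<alpha> * (Im w)\<^sup>2 + \<alpha> * (\<bar>Re w\<bar> + 1/2)\<^sup>2) * exp (- (\<alpha>/2) * (of_int b)\<^sup>2)"
proof -
  define r where "r = Re w + x"
  have "Re (- of_real \<alpha> * (w + of_real (of_int b + x))\<^sup>2) = \<alpha> * (Im w)\<^sup>2 - \<alpha> * (of_int b + r)\<^sup>2"
    by (simp add: r_def power2_eq_square algebra_simps)
  moreover have "(of_int b)\<^sup>2 \<le> 2 * (of_int b + r)\<^sup>2 + 2 * r\<^sup>2"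
    using zero_le_power2[of "of_int b + 2 * r"] by (simp add: power2_eq_square algebra_simps)
  moreover have "r\<^sup>2 \<le> (\<bar>Re w\<bar> + 1/2)\<^sup>2"
    using assms(2) by (intro power2_le_iff_abs_le[THEN iffD2]) (auto simp: r_def)
  ultimately have "Re (- of_real \<alpha> * (w + of_real (of_int b + x))\<^sup>2) \<le> \<alpha> * (Im w)\<^sup>2 + \<alpha> * (\<bar>Re w\<bar> + 1/2)\<^sup>2 - (\<alpha>/2) * (of_int b)\<^sup>2"
  proof -
    assume 1: "(of_int b)\<^sup>2 \<le> 2 * (of_int b + r)\<^sup>2 + 2 * r\<^sup>2" and 2: "r\<^sup>2 \<le> (\<bar>Re w\<bar> + 1/2)\<^sup>2"
    and 3: "Re (- of_real \<alpha> * (w + of_real (of_int b + x))\<^sup>2) = \<alpha> * (Im w)\<^sup>2 - \<alpha> * (of_int b + r)\<^sup>2"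
    have "(\<alpha>/2) * (of_int b)\<^sup>2 \<le> (\<alpha>/2) * (2 * (of_int b + r)\<^sup>2 + 2 * (\<bar>Re w\<bar> + 1/2)\<^sup>2)"
      using 1 2 assms by (intro mult_left_mono) auto
    thus ?thesis unfolding 3 by (simp add: algebra_simps)
  qed
  thus ?thesis by (simp add: exp_add[symmetric])
qed

theorem gauss_poisson:
  fixes w :: complex assumes \<alpha>: "\<alpha> > 0"
  shows "(\<Sum>\<^sub>\<infinity>b::int. exp (- of_real \<alpha> * (w + of_int b)\<^sup>2)) =
     of_real (sqrt (pi / \<alpha>)) * (\<Sum>\<^sub>\<infinity>r::int. exp (- of_real (pi\<^sup>2 * (of_int r)\<^sup>2 / \<alpha>) + 2 * of_real pi * \<i> * of_int r * w))"
proof -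
  define G where "G x = exp (- of_real \<alpha> * (w + of_real x)\<^sup>2)" for x :: real
  define H where "H k = of_real (sqrt (pi / \<alpha>)) * exp (- of_real (pi\<^sup>2 * (of_int k)\<^sup>2 / \<alpha>) - 2 * of_real pi * \<i> * of_int k * w)" for k :: int
  define C where "C = exp (\<alpha> * (Im w)\<^sup>2 + \<alpha> * (\<bar>Re w\<bar> + 1/2)\<^sup>2)"
  define g where "g b = C * exp (- (\<alpha>/2) * (of_int b)\<^sup>2)" for b :: int
  have gs: "g summable_on UNIV" unfolding g_def using \<alpha> by (intro summable_on_cmult_right gauss_summable_int) auto
  have Gb: "norm (G (of_int b + x)) \<le> g b" if "\<bar>x\<bar> \<le> 1/2" for b x
    unfolding G_def g_def C_def using norm_exp_gauss_le[OF \<alpha> that] by simp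
  have Gc: "continuous_on A G" for A unfolding G_def by (intro continuous_intros)
  have Hs: "(\<lambda>k. norm (H k)) summable_on UNIV"
  proof (rule summable_on_cong[THEN iffD1])
    show "(\<lambda>k::int. sqrt (pi/\<alpha>) * exp (- (pi\<^sup>2 / \<alpha>) * (of_int k)\<^sup>2 + 2 * pi * Im w * of_int k)) summable_on UNIV"
      using \<alpha> by (intro summable_on_cmult_right gauss_linear_summable_int) auto
    show "sqrt (pi/\<alpha>) * exp (- (pi\<^sup>2 / \<alpha>) * (of_int k)\<^sup>2 + 2 * pi * Im w * of_int k) = norm (H k)" for k
      using \<alpha> by (simp add: H_def norm_mult algebra_simps)
  qed
  have FT: "has_bochner_integral lborel (\<lambda>x. G x * exp (2 * of_real pi * \<i> * of_real ((real j - real l) * x))) (H (int j - int l))" for j l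
    using gauss_fourier_shift[OF \<alpha>, of w "real j - real l"] by (simp add: G_def H_def)
  define I where "I N = (\<integral>x. G x * of_real (fejer N x) \<partial>lborel)" for N
  have hbi: "has_bochner_integral lborel (\<lambda>x. G x * of_real (fejer N x)) ((\<Sum>j<N. \<Sum>l<N. H (int j - int l)) / of_nat N)" for N
  proof -
    have "has_bochner_integral lborel (\<lambda>x. (\<Sum>j<N. \<Sum>l<N. G x * exp (2 * of_real pi * \<i> * of_real ((real j - real l) * x))) / of_nat N) ((\<Sum>j<N. \<Sum>l<N. H (int j - int l)) / of_nat N)"
      by (intro has_bochner_integral_divide_zero has_bochner_integral_sum FT)
    thus ?thesis by (simp add: fejer_expand sum_distrib_left)
  qed
  have "(\<lambda>N. (\<Sum>j<N. \<Sum>l<N. H (int j - int l)) / of_nat N) \<longlonglongrightarrow> infsum H UNIV" by (rule cesaro_infsum[OF Hs])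
  moreover have "(\<Sum>j<N. \<Sum>l<N. H (int j - int l)) / of_nat N = I N" for N
    using has_bochner_integral_integral_eq[OF hbi] by (simp add: I_def)
  ultimately have lim1: "I \<longlonglongrightarrow> infsum H UNIV" by simp
  define J where "J N b = (LINT x:{-1/2..<1/2}|lborel. G (of_int b + x) * of_real (fejer N x))" for N b
  have Jb: "norm (J N b) \<le> g b" if N: "N > 0" for N b
  proof -
    have si: "set_integrable lborel {-1/2..<1/2} (\<lambda>x. G (of_int b + x) * of_real (fejer N x))"
      unfolding G_def by (intro set_integrable_continuous_Ico continuous_intros)
    have "norm (J N b) \<le> (LINT x:{-1/2..<1/2}|lborel. norm (G (of_int b + x) * of_real (fejer N x)))"
      unfolding J_def by (rule set_integral_norm_bound[OF si])
    also have "\<dots> \<le> (LINT x:{-1/2..<1/2}|lborel. g b * fejer N x)"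
    proof (rule set_integral_mono)
      show "set_integrable lborel {-1/2..<1/2} (\<lambda>x. g b * fejer N x)"
        by (intro set_integrable_continuous_Ico continuous_intros)
      fix x :: real assume "x \<in> {-1/2..<1/2}"
      hence "\<bar>x\<bar> \<le> 1/2" by auto
      thus "norm (G (of_int b + x) * of_real (fejer N x)) \<le> g b * fejer N x"
        using mult_right_mono[OF Gb[of x b] fejer_nonneg[of N x]] by (simp add: norm_mult fejer_nonneg)
    qed (rule set_integrable_norm[OF si])
    also have "\<dots> = g b" unfolding set_integral_mult_right fejer_integral[OF N] by simp
    finally show ?thesis .
  qed
  have IJ: "I N = (\<Sum>\<^sub>\<infinity>b. J N b)" if N: "N > 0" for N
  proof -
    have "I N = (\<Sum>\<^sub>\<infinity>b\<in>UNIV. LINT x:{-1/2..<1/2}|lborel. G (of_int b + x) * of_real (fejer N (of_int b + x)))"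
      unfolding I_def
      by (rule integral_split_cells[OF _ _ gs]) (use hbi[of N] Jb[OF N] in \<open>auto simp: has_bochner_integral_iff J_def fejer_periodic\<close>)
    thus ?thesis by (simp add: J_def fejer_periodic)
  qed
  \<comment> \<open>The shift to \<open>Suc N\<close> skips the kernel of order 0, which is
    identically zero and does not have unit mass.\<close>
  have "(\<lambda>N. \<Sum>\<^sub>\<infinity>b. J (Suc N) b) \<longlonglongrightarrow> (\<Sum>\<^sub>\<infinity>b. G (of_int b))"
  proof (rule infsum_dominated_convergence[OF _ _ gs])
    fix b :: int
    have "(\<lambda>N. J N b) \<longlonglongrightarrow> G (of_int b + 0)" unfolding J_def
      by (rule fejer_approximate_identity[where B = "g b"]) (use Gb in \<open>auto simp: G_def intro!: continuous_intros\<close>)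
    from LIMSEQ_Suc[OF this] show "(\<lambda>N. J (Suc N) b) \<longlonglongrightarrow> G (of_int b)" by simp
  qed (use Jb in auto)
  moreover have "(\<lambda>N. \<Sum>\<^sub>\<infinity>b. J (Suc N) b) \<longlonglongrightarrow> infsum H UNIV"
    using LIMSEQ_Suc[OF lim1] by (simp add: IJ)
  ultimately have "(\<Sum>\<^sub>\<infinity>b. G (of_int b)) = infsum H UNIV" by (rule LIMSEQ_unique)
  also have "\<dots> = (\<Sum>\<^sub>\<infinity>k. H (- k))"
    by (rule infsum_reindex_bij_betw[symmetric]) (rule bij_uminus)
  finally show ?thesis by (simp add: G_def H_def infsum_cmult_right')
qed

section \<open>A Lipschitz-type summation formula with error functions\<close>

text \<open>Completing the square absorbs the linear term into a move of \<open>w\<close> by -i pi t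
  / \<alpha>. On the dual side this recentres the Gaussian from 0 to \<open>t\<close>.\<close>

lemma gauss_poisson_shift:
  fixes w :: complex and t :: real assumes \<alpha>: "\<alpha> > 0"
  shows "(\<Sum>\<^sub>\<infinity>b::int. exp (- of_real \<alpha> * (w + of_int b)\<^sup>2 + 2 * of_real pi * \<i> * of_real t * (w + of_int b))) =
     of_real (sqrt (pi / \<alpha>)) * (\<Sum>\<^sub>\<infinity>r::int. of_real (exp (- pi * ((of_int r - t) * sqrt (pi / \<alpha>))\<^sup>2)) * exp (2 * of_real pi * \<i> * of_int r * w))"
proof -
  define w' where "w' = w - of_real (pi * t / \<alpha>) * \<i>"
  define C where "C = exp (- complex_of_real (pi\<^sup>2 * t\<^sup>2 / \<alpha>))"
  have a0: "complex_of_real \<alpha> \<noteq> 0" using \<alpha> by simp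
  have 1: "exp (- of_real \<alpha> * (w + of_int b)\<^sup>2 + 2 * of_real pi * \<i> * of_real t * (w + of_int b))
      = C * exp (- of_real \<alpha> * (w' + of_int b)\<^sup>2)" for b :: int
  proof -
    have "- of_real \<alpha> * (w + of_int b)\<^sup>2 + 2 * of_real pi * \<i> * of_real t * (w + of_int b)
      = - complex_of_real (pi\<^sup>2 * t\<^sup>2 / \<alpha>) + - of_real \<alpha> * (w' + of_int b)\<^sup>2"
      using a0 by (simp add: w'_def power2_eq_square field_simps)
    thus ?thesis by (simp only: exp_add C_def)
  qed
  have 2: "of_real (exp (- pi * ((of_int r - t) * sqrt (pi / \<alpha>))\<^sup>2)) * exp (2 * of_real pi * \<i> * of_int r * w)
     = C * exp (- of_real (pi\<^sup>2 * (of_int r)\<^sup>2 / \<alpha>) + 2 * of_real pi * \<i> * of_int r * w')" for r :: int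
  proof -
    have s: "(sqrt (pi / \<alpha>))\<^sup>2 = pi / \<alpha>" using \<alpha> by simp
    have "complex_of_real (- pi * ((of_int r - t) * sqrt (pi / \<alpha>))\<^sup>2) + 2 * of_real pi * \<i> * of_int r * w =
      - complex_of_real (pi\<^sup>2 * t\<^sup>2 / \<alpha>) + (- of_real (pi\<^sup>2 * (of_int r)\<^sup>2 / \<alpha>) + 2 * of_real pi * \<i> * of_int r * w')"
      unfolding power_mult_distrib s using a0 by (simp add: w'_def power2_eq_square field_simps)
    hence "exp (complex_of_real (- pi * ((of_int r - t) * sqrt (pi / \<alpha>))\<^sup>2) + 2 * of_real pi * \<i> * of_int r * w) =
      exp (- complex_of_real (pi\<^sup>2 * t\<^sup>2 / \<alpha>) + (- of_real (pi\<^sup>2 * (of_int r)\<^sup>2 / \<alpha>) + 2 * of_real pi * \<i> * of_int r * w'))"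
      by (simp only:)
    thus ?thesis unfolding C_def exp_of_real[symmetric] exp_add .
  qed
  show ?thesis unfolding 1 2 infsum_cmult_right' gauss_poisson[OF \<alpha>] by simp
qed

lemma dist_Ints_pos:
  fixes w :: complex assumes "w \<notin> \<int>"
  obtains d where "d > 0" "\<And>b::int. d \<le> norm (w + of_int b)"
proof -
  have "- w \<notin> \<int>" using assms by simp
  then obtain d where d: "d > 0" "\<forall>x\<in>\<int>. d \<le> dist (- w) x"
    using separate_point_closed[OF closed_Ints] by blast
  have "d \<le> norm (w + of_int b)" for b :: int
    using d(2)[rule_format, of "of_int b"] norm_minus_cancel[of "w + of_int b"] by (simp add: dist_norm)
  thus ?thesis using that d(1) by blast
qed

lemma abs_gaussE_le_1: "\<bar>gaussE x\<bar> \<le> 1"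
  using gaussE_le_1[of x] gaussE_le_1[of "-x"] by (simp add: gaussE_minus)

text \<open>Where the sign of r + 1/2 disagrees with that of r - t, the integer r lies between 0 and
  t, so |r - t| \<le> |t|. The factor \<open>exp (pi * c\<^sup>2 * t\<^sup>2)\<close> then lifts the
  right side to at least 2, which is the trivial bound for the left side.\<close>

lemma sgn_minus_gaussE_bound:
  fixes r :: int and t c :: real assumes "c \<ge> 0"
  shows "\<bar>sgn (of_int r + 1/2) - gaussE ((of_int r - t) * c)\<bar> \<le> 2 * exp (pi * c\<^sup>2 * t\<^sup>2) * exp (- pi * ((of_int r - t) * c)\<^sup>2)"
proof -
  let ?x = "(of_int r - t) * c" and ?s = "sgn (of_int r + 1/2) :: real"
  have s: "?s = (if r \<ge> 0 then 1 else -1)"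
  proof (cases "r \<ge> 0")
    case True thus ?thesis by simp
  next
    case False
    hence "real_of_int r \<le> -1" by linarith
    thus ?thesis using False by simp
  qed
  have e1: "1 \<le> exp (pi * c\<^sup>2 * t\<^sup>2)" by simp
  show ?thesis
  proof (cases "?s = sgn ?x \<or> ?x = 0")
    case True
    have "\<bar>?s - gaussE ?x\<bar> \<le> 1 * exp (- pi * ?x\<^sup>2)"
      using abs_sgn_minus_gaussE_le[OF _ True] s by auto
    also have "\<dots> \<le> 2 * exp (pi * c\<^sup>2 * t\<^sup>2) * exp (- pi * ?x\<^sup>2)"
    proof (rule mult_right_mono)
      show "1 \<le> 2 * exp (pi * c\<^sup>2 * t\<^sup>2)" using e1 by linarith
    qed simp
    finally show ?thesis .
  next
    case False
    hence c: "c > 0" using assms by (cases "c = 0") auto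
    have "\<bar>of_int r - t\<bar> \<le> \<bar>t\<bar>"
      using False c unfolding s by (auto simp: sgn_if zero_less_mult_iff split: if_splits)
    hence "(of_int r - t)\<^sup>2 \<le> t\<^sup>2" by (simp add: abs_le_square_iff)
    hence "pi * (of_int r - t)\<^sup>2 * c\<^sup>2 \<le> pi * t\<^sup>2 * c\<^sup>2" by (intro mult_right_mono mult_left_mono) auto
    hence "1 \<le> exp (pi * c\<^sup>2 * t\<^sup>2 + - pi * ?x\<^sup>2)" by (simp add: power_mult_distrib mult_ac)
    moreover have "\<bar>?s - gaussE ?x\<bar> \<le> 2" using abs_gaussE_le_1[of ?x] s by (auto split: if_splits)
    ultimately show ?thesis unfolding exp_add by simp
  qed
qed

text \<open>A single row \<open>w + \<int>\<close> of the lattice sum. The drift \<open>t\<close> is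
  a free variable so that the row can be differentiated in it, which removes the
  denominator.\<close>

definition row_lhs :: "real \<Rightarrow> real \<Rightarrow> complex \<Rightarrow> complex" where
  "row_lhs \<alpha> t w = (\<Sum>\<^sub>\<infinity>b::int. exp (- of_real \<alpha> * (w + of_int b)\<^sup>2 + 2 * of_real pi * \<i> * of_real t * (w + of_int b)) / (w + of_int b))"

text \<open>The series of error functions that defines \<open>Rfun\<close>, with all residue classes
  merged into one sum; \<open>sgn_residue\<close> explains the sign
  \<open>sgn (r + 1/2)\<close>.\<close>

definition row_err :: "real \<Rightarrow> real \<Rightarrow> complex \<Rightarrow> complex" where
  "row_err \<alpha> t w = (\<Sum>\<^sub>\<infinity>r::int. of_real (sgn (of_int r + 1/2) - gaussE ((of_int r - t) * sqrt (pi / \<alpha>))) * exp (2 * of_real pi * \<i> * of_int r * w))"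

lemma row_lhs_term_bound:
  fixes w :: complex assumes "\<alpha> > 0"
  shows "norm (exp (- of_real \<alpha> * (w + of_int b)\<^sup>2 + 2 * of_real pi * \<i> * of_real t * (w + of_int b)))
     \<le> exp (2 * pi * \<bar>t\<bar> * \<bar>Im w\<bar>) * exp (\<alpha> * (Im w)\<^sup>2 + \<alpha> * (\<bar>Re w\<bar> + 1/2)\<^sup>2) * exp (- (\<alpha>/2) * (of_int b)\<^sup>2)"
proof -
  have "norm (exp (2 * of_real pi * \<i> * of_real t * (w + of_int b))) \<le> exp (2 * pi * \<bar>t\<bar> * \<bar>Im w\<bar>)"
  proof -
    have "- (t * Im w) \<le> \<bar>t\<bar> * \<bar>Im w\<bar>" by (metis abs_ge_minus_self abs_mult)
    from mult_left_mono[OF this, of "2 * pi"] show ?thesis by (simp add: mult.assoc)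
  qed
  moreover have "norm (exp (- of_real \<alpha> * (w + of_int b)\<^sup>2)) \<le> exp (\<alpha> * (Im w)\<^sup>2 + \<alpha> * (\<bar>Re w\<bar> + 1/2)\<^sup>2) * exp (- (\<alpha>/2) * (of_int b)\<^sup>2)"
    using norm_exp_gauss_le[OF assms, of 0 w b] by simp
  ultimately have "norm (exp (2 * of_real pi * \<i> * of_real t * (w + of_int b))) * norm (exp (- of_real \<alpha> * (w + of_int b)\<^sup>2)) \<le>
     exp (2 * pi * \<bar>t\<bar> * \<bar>Im w\<bar>) * (exp (\<alpha> * (Im w)\<^sup>2 + \<alpha> * (\<bar>Re w\<bar> + 1/2)\<^sup>2) * exp (- (\<alpha>/2) * (of_int b)\<^sup>2))"
    by (intro mult_mono) auto
  thus ?thesis unfolding exp_add norm_mult by (simp only: mult_ac)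
qed

lemma row_err_coeff_bound:
  fixes r :: int assumes "\<alpha> > 0"
  shows "\<bar>sgn (of_int r + 1/2) - gaussE ((of_int r - t) * sqrt (pi / \<alpha>))\<bar>
      \<le> 2 * exp (- (pi\<^sup>2/\<alpha>) * (of_int r)\<^sup>2 + (2 * pi\<^sup>2 * t / \<alpha>) * of_int r)"
proof -
  have s: "(sqrt (pi / \<alpha>))\<^sup>2 = pi / \<alpha>" using assms by simp
  have "2 * exp (pi * (sqrt (pi / \<alpha>))\<^sup>2 * t\<^sup>2) * exp (- pi * ((of_int r - t) * sqrt (pi / \<alpha>))\<^sup>2) =
      2 * exp (- (pi\<^sup>2/\<alpha>) * (of_int r)\<^sup>2 + (2 * pi\<^sup>2 * t / \<alpha>) * of_int r)"
    unfolding power_mult_distrib s mult.assoc exp_add[symmetric] using assms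
    by (simp add: power2_eq_square field_simps)
  thus ?thesis using sgn_minus_gaussE_bound[of "sqrt (pi / \<alpha>)" r t] assms by simp
qed

lemma norm_cexp_int: "norm (exp (2 * of_real pi * \<i> * of_int r * w)) = exp (- 2 * pi * Im w * of_int r)"
  by (simp add: algebra_simps)

lemma row_lhs_summable:
  assumes "\<alpha> > 0" "w \<notin> \<int>"
  shows "(\<lambda>b::int. exp (- of_real \<alpha> * (w + of_int b)\<^sup>2 + 2 * of_real pi * \<i> * of_real t * (w + of_int b)) / (w + of_int b)) summable_on UNIV"
proof -
  obtain d where d: "d > 0" "\<And>b::int. d \<le> norm (w + of_int b)" using dist_Ints_pos[OF assms(2)] by blast
  let ?C = "exp (2 * pi * \<bar>t\<bar> * \<bar>Im w\<bar>) * exp (\<alpha> * (Im w)\<^sup>2 + \<alpha> * (\<bar>Re w\<bar> + 1/2)\<^sup>2)"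
  show ?thesis
  proof (rule abs_summable_summable, rule summable_on_comparison_test)
    show "(\<lambda>b::int. (1 / d) * (?C * exp (- (\<alpha>/2) * (of_int b)\<^sup>2))) summable_on UNIV"
      using assms by (intro summable_on_cmult_right gauss_summable_int) auto
    show "norm (exp (- of_real \<alpha> * (w + of_int b)\<^sup>2 + 2 * of_real pi * \<i> * of_real t * (w + of_int b)) / (w + of_int b))
         \<le> (1 / d) * (?C * exp (- (\<alpha>/2) * (of_int b)\<^sup>2))" for b :: int
      unfolding norm_divide using frac_le[OF _ row_lhs_term_bound[OF assms(1)] d(1) d(2)[of b]] by simp
  qed auto
qed

lemma row_err_summable:
  assumes "\<alpha> > 0"
  shows "(\<lambda>r::int. of_real (sgn (of_int r + 1/2) - gaussE ((of_int r - t) * sqrt (pi / \<alpha>))) * exp (2 * of_real pi * \<i> * of_int r * w)) summable_on UNIV"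
proof (rule abs_summable_summable, rule summable_on_comparison_test)
  show "(\<lambda>r::int. 2 * exp (- (pi\<^sup>2/\<alpha>) * (of_int r)\<^sup>2 + (2 * pi\<^sup>2 * t / \<alpha> - 2 * pi * Im w) * of_int r)) summable_on UNIV"
    using assms by (intro summable_on_cmult_right gauss_linear_summable_int) auto
  fix r :: int
  have "norm (of_real (sgn (of_int r + 1/2) - gaussE ((of_int r - t) * sqrt (pi / \<alpha>))) * exp (2 * of_real pi * \<i> * of_int r * w))
     \<le> 2 * exp (- (pi\<^sup>2/\<alpha>) * (of_int r)\<^sup>2 + (2 * pi\<^sup>2 * t / \<alpha>) * of_int r) * exp (- 2 * pi * Im w * of_int r)"
    unfolding norm_mult norm_cexp_int norm_of_real by (intro mult_right_mono row_err_coeff_bound assms) auto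
  thus "norm (of_real (sgn (of_int r + 1/2) - gaussE ((of_int r - t) * sqrt (pi / \<alpha>))) * exp (2 * of_real pi * \<i> * of_int r * w))
     \<le> 2 * exp (- (pi\<^sup>2/\<alpha>) * (of_int r)\<^sup>2 + (2 * pi\<^sup>2 * t / \<alpha> - 2 * pi * Im w) * of_int r)"
    unfolding mult.assoc exp_add[symmetric] by (simp add: algebra_simps)
qed auto

text \<open>By Poisson summation both sides of the identity have the same derivative in \<open>t\<close>; the
  constant is then found, for \<open>w\<close> in the upper half plane, by letting \<open>t\<close> tend to infinity.\<close>

lemma row_identity_constant:
  assumes \<alpha>: "\<alpha> > 0" and w: "w \<notin> \<int>"
  shows "row_lhs \<alpha> t w - of_real pi * \<i> * row_err \<alpha> t w = row_lhs \<alpha> 0 w - of_real pi * \<i> * row_err \<alpha> 0 w"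
proof -
  obtain d where d: "d > 0" "\<And>b::int. d \<le> norm (w + of_int b)" using dist_Ints_pos[OF w] by blast
  have wb: "w + of_int b \<noteq> 0" for b :: int using d(1) d(2)[of b] by auto
  define c where "c = sqrt (pi / \<alpha>)"
  have c0: "c \<ge> 0" and c2: "c\<^sup>2 = pi / \<alpha>" using \<alpha> by (auto simp: c_def)
  have der: "((\<lambda>t. row_lhs \<alpha> t w - of_real pi * \<i> * row_err \<alpha> t w) has_vector_derivative 0) (at t0)" for t0
  proof -
    define E where "E b t = exp (- of_real \<alpha> * (w + of_int b)\<^sup>2 + 2 * of_real pi * \<i> * of_real t * (w + of_int b))" for b :: int and t :: real
    define T where "T = \<bar>t0\<bar> + 1"
    define K where "K = exp (2 * pi * T * \<bar>Im w\<bar>) * exp (\<alpha> * (Im w)\<^sup>2 + \<alpha> * (\<bar>Re w\<bar> + 1/2)\<^sup>2)"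
    have L: "((\<lambda>t. \<Sum>\<^sub>\<infinity>b::int. E b t / (w + of_int b)) has_vector_derivative (\<Sum>\<^sub>\<infinity>b::int. 2 * of_real pi * \<i> * E b t0)) (at t0)"
    proof (rule infsum_has_vector_derivative)
      fix b :: int and t :: real
      have "((\<lambda>z. exp (- of_real \<alpha> * (w + of_int b)\<^sup>2 + 2 * of_real pi * \<i> * z * (w + of_int b))) has_field_derivative E b t * (2 * of_real pi * \<i> * (w + of_int b))) (at (of_real t))"
        unfolding E_def by (auto intro!: derivative_eq_intros)
      from DERIV_cdivide[OF this, of "w + of_int b"]
      have "((\<lambda>z. exp (- of_real \<alpha> * (w + of_int b)\<^sup>2 + 2 * of_real pi * \<i> * z * (w + of_int b)) / (w + of_int b)) has_field_derivative 2 * of_real pi * \<i> * E b t) (at (of_real t))"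
        using wb[of b] by (simp add: mult.assoc mult.commute[of "E b t"])
      from has_vector_derivative_real_field[OF this]
      show "((\<lambda>t. E b t / (w + of_int b)) has_vector_derivative 2 * of_real pi * \<i> * E b t) (at t)" by (simp add: E_def)
      assume "t \<in> ball t0 1"
      hence "\<bar>t\<bar> \<le> T" by (auto simp: T_def dist_real_def)
      hence "exp (2 * pi * \<bar>t\<bar> * \<bar>Im w\<bar>) \<le> exp (2 * pi * T * \<bar>Im w\<bar>)" by (simp add: mult_right_mono)
      from mult_right_mono[OF mult_right_mono[OF this]]
      have "norm (E b t) \<le> K * exp (- (\<alpha>/2) * (of_int b)\<^sup>2)"
        using row_lhs_term_bound[OF \<alpha>, of w b t] unfolding E_def K_def by (meson exp_ge_zero order_trans)
      thus "norm (2 * of_real pi * \<i> * E b t) \<le> 2 * pi * (K * exp (- (\<alpha>/2) * (of_int b)\<^sup>2))"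
        by (simp add: norm_mult)
    next
      show "(\<lambda>b::int. 2 * pi * (K * exp (- (\<alpha>/2) * (of_int b)\<^sup>2))) summable_on UNIV"
        using \<alpha> by (intro summable_on_cmult_right gauss_summable_int) auto
      show "(\<lambda>b. E b t / (w + of_int b)) summable_on UNIV" for t
        unfolding E_def by (rule row_lhs_summable[OF \<alpha> w])
    qed
    define F where "F r t = 2 * c * exp (- pi * ((of_int r - t) * c)\<^sup>2)" for r :: int and t :: real
    have R: "((\<lambda>t. row_err \<alpha> t w) has_vector_derivative (\<Sum>\<^sub>\<infinity>r::int. of_real (F r t0) * exp (2 * of_real pi * \<i> * of_int r * w))) (at t0)"
      unfolding row_err_def c_def[symmetric]
    proof (rule infsum_has_vector_derivative)
      fix r :: int and t :: real
      have "((\<lambda>t. sgn (of_int r + 1/2) - gaussE ((of_int r - t) * c)) has_real_derivative F r t) (at t)"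
        unfolding F_def
        by (rule derivative_eq_intros DERIV_chain2[OF gaussE_has_real_derivative] refl | simp)+
      hence "((\<lambda>t. of_real (sgn (of_int r + 1/2) - gaussE ((of_int r - t) * c))) has_vector_derivative complex_of_real (F r t)) (at t)"
        by (rule has_vector_derivative_of_real)
      from has_vector_derivative_mult_left[OF this]
      show "((\<lambda>t. of_real (sgn (of_int r + 1/2) - gaussE ((of_int r - t) * c)) * exp (2 * of_real pi * \<i> * of_int r * w)) has_vector_derivative of_real (F r t) * exp (2 * of_real pi * \<i> * of_int r * w)) (at t)" .
      assume "t \<in> ball t0 1"
      hence T: "t\<^sup>2 \<le> T\<^sup>2" by (auto simp: T_def dist_real_def intro!: abs_le_square_iff[THEN iffD1])
      have "(of_int r)\<^sup>2 \<le> 2 * (of_int r - t)\<^sup>2 + 2 * t\<^sup>2"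
        using zero_le_power2[of "of_int r - 2 * t"] by (simp add: power2_eq_square algebra_simps)
      hence "(pi * c\<^sup>2) * ((of_int r)\<^sup>2 / 2 - T\<^sup>2) \<le> (pi * c\<^sup>2) * (of_int r - t)\<^sup>2"
        using T by (intro mult_left_mono) auto
      hence "exp (- pi * ((of_int r - t) * c)\<^sup>2) \<le> exp (pi * c\<^sup>2 * T\<^sup>2) * exp (- (pi * c\<^sup>2 / 2) * (of_int r)\<^sup>2)"
        unfolding exp_add[symmetric] power_mult_distrib by (simp add: algebra_simps)
      note le = mult_left_mono[OF this, of "2 * c"]
      have nF: "norm (complex_of_real (F r t)) = F r t" unfolding norm_of_real F_def using c0 by simp
      have "norm (complex_of_real (F r t)) \<le> 2 * c * (exp (pi * c\<^sup>2 * T\<^sup>2) * exp (- (pi * c\<^sup>2 / 2) * (of_int r)\<^sup>2))"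
        unfolding nF using le c0 by (simp add: F_def)
      from mult_right_mono[OF this, of "exp (- 2 * pi * Im w * of_int r)"]
      show "norm (of_real (F r t) * exp (2 * of_real pi * \<i> * of_int r * w)) \<le>
          (2 * c * exp (pi * c\<^sup>2 * T\<^sup>2)) * exp (- (pi * c\<^sup>2 / 2) * (of_int r)\<^sup>2 + (- 2 * pi * Im w) * of_int r)"
        unfolding norm_mult norm_cexp_int exp_add by (simp add: mult_ac)
    next
      show "(\<lambda>r::int. (2 * c * exp (pi * c\<^sup>2 * T\<^sup>2)) * exp (- (pi * c\<^sup>2 / 2) * (of_int r)\<^sup>2 + (- 2 * pi * Im w) * of_int r)) summable_on UNIV"
        using \<alpha> c2 by (intro summable_on_cmult_right gauss_linear_summable_int) auto
      show "(\<lambda>r::int. of_real (sgn (of_int r + 1/2) - gaussE ((of_int r - t) * c)) * exp (2 * of_real pi * \<i> * of_int r * w)) summable_on UNIV" for t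
        unfolding c_def by (rule row_err_summable[OF \<alpha>])
    qed
    \<comment> \<open>Differentiation has cancelled the factor \<open>w + b\<close> on the left and
      turned each error function into a Gaussian centred at \<open>t0\<close> on the right. The two
      series are the sides of Poisson summation.\<close>
    have eq: "(\<Sum>\<^sub>\<infinity>b::int. 2 * of_real pi * \<i> * E b t0) - of_real pi * \<i> * (\<Sum>\<^sub>\<infinity>r::int. of_real (F r t0) * exp (2 * of_real pi * \<i> * of_int r * w)) = 0"
    proof -
      have "(\<Sum>\<^sub>\<infinity>r::int. of_real (F r t0) * exp (2 * of_real pi * \<i> * of_int r * w)) = 2 * (of_real c * (\<Sum>\<^sub>\<infinity>r::int. of_real (exp (- pi * ((of_int r - t0) * c)\<^sup>2)) * exp (2 * of_real pi * \<i> * of_int r * w)))"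
        unfolding F_def of_real_mult mult.assoc infsum_cmult_right' by simp
      thus ?thesis unfolding infsum_cmult_right' E_def gauss_poisson_shift[OF \<alpha>] c_def by simp
    qed
    have "((\<lambda>t. row_lhs \<alpha> t w - of_real pi * \<i> * row_err \<alpha> t w) has_vector_derivative
       (\<Sum>\<^sub>\<infinity>b::int. 2 * of_real pi * \<i> * E b t0) - of_real pi * \<i> * (\<Sum>\<^sub>\<infinity>r::int. of_real (F r t0) * exp (2 * of_real pi * \<i> * of_int r * w))) (at t0)"
      unfolding row_lhs_def E_def[symmetric]
      by (intro has_vector_derivative_diff L has_vector_derivative_mult_right R)
    thus ?thesis unfolding eq .
  qed
  obtain k where "\<And>t. row_lhs \<alpha> t w - of_real pi * \<i> * row_err \<alpha> t w = k"
    using has_vector_derivative_zero_constant[of UNIV "\<lambda>t. row_lhs \<alpha> t w - of_real pi * \<i> * row_err \<alpha> t w"] der by auto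
  thus ?thesis by simp
qed


lemma exp_int_eq_power: "exp (2 * of_real pi * \<i> * of_int (int n) * w) = exp (2 * of_real pi * \<i> * w) ^ n"
  unfolding exp_of_nat_mult[symmetric] by (simp add: mult_ac)

text \<open>As the drift grows, each \<open>gaussE\<close> tends to -1, so the coefficient tends to
  2 for r \<ge> 0 and to 0 for r < 0. What is left is a geometric series, convergent because
  \<open>w\<close> lies in the upper half plane.\<close>

lemma row_err_limit:
  assumes \<alpha>: "\<alpha> > 0" and w: "Im w > 0"
  shows "(\<lambda>n. row_err \<alpha> (real n) w) \<longlonglongrightarrow> 2 / (1 - exp (2 * of_real pi * \<i> * w))"
proof -
  define c where "c = sqrt (pi / \<alpha>)"
  have c0: "c > 0" and c2: "c\<^sup>2 = pi / \<alpha>" using \<alpha> by (auto simp: c_def)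
  \<comment> \<open>The majorant must not depend on the drift n. For r \<ge> 0 the geometric decay
    of the exponentials suffices; for r < 0 the Gaussian bound is uniform, since |r - n| \<ge>
    |r|.\<close>
  define g where "g r = (if r \<ge> 0 then 2 * exp (- 2 * pi * Im w * of_int r) else exp (- (pi * c\<^sup>2) * (of_int r)\<^sup>2 + (- 2 * pi * Im w) * of_int r))" for r :: int
  define F where "F r = (if r \<ge> 0 then 2 * exp (2 * of_real pi * \<i> * of_int r * w) else 0)" for r :: int
  have q: "norm (exp (2 * of_real pi * \<i> * w)) < 1" using w by simp
  have qr: "exp (- 2 * pi * Im w * of_int (int n)) = (exp (- 2 * pi * Im w)) ^ n" for n
    unfolding exp_of_nat_mult[symmetric] by (simp add: mult_ac)
  have gs: "g summable_on UNIV"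
  proof -
    have "summable (\<lambda>n. 2 * (exp (- 2 * pi * Im w)) ^ n)" using w by (intro summable_mult summable_geometric) auto
    hence "(\<lambda>n. g (int n)) summable_on UNIV"
      unfolding g_def qr by (subst summable_on_UNIV_nonneg_real_iff) auto
    hence 1: "g summable_on (range int)" by (subst summable_on_reindex) (auto simp: o_def)
    have "(\<lambda>r::int. exp (- (pi * c\<^sup>2) * (of_int r)\<^sup>2 + (- 2 * pi * Im w) * of_int r)) summable_on {..<0}"
      using c0 by (intro summable_on_subset[OF gauss_linear_summable_int]) auto
    hence 2: "g summable_on {..<0}" by (rule summable_on_cong[THEN iffD1, rotated]) (auto simp: g_def)
    have "UNIV = range int \<union> {..<0}" by (auto simp: image_iff) (metis not_le zero_le_imp_eq_int)
    thus ?thesis using summable_on_union[OF 1 2] by simp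
  qed
  have "(\<lambda>n. row_err \<alpha> (real n) w) \<longlonglongrightarrow> infsum F UNIV"
    unfolding row_err_def c_def[symmetric]
  proof (rule infsum_dominated_convergence[OF _ _ gs])
    fix r :: int
    have "filterlim (\<lambda>n. (real n - of_int r) * c) at_top sequentially" using c0 by real_asymp
    from filterlim_compose[OF gaussE_at_top this]
    have "(\<lambda>n. gaussE (- ((of_int r - real n) * c))) \<longlonglongrightarrow> 1" by (simp add: algebra_simps)
    hence "(\<lambda>n. of_real (sgn (of_int r + 1/2) + gaussE (- ((of_int r - real n) * c))) * exp (2 * of_real pi * \<i> * of_int r * w)) \<longlonglongrightarrow> of_real (sgn (of_int r + 1/2) + 1) * exp (2 * of_real pi * \<i> * of_int r * w)"
      by (intro tendsto_intros)
    moreover have "of_real (sgn (of_int r + 1/2) + 1) * exp (2 * of_real pi * \<i> * of_int r * w) = F r"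
    proof (cases "r \<ge> 0")
      case False
      hence "real_of_int r \<le> -1" by linarith
      thus ?thesis using False by (simp add: F_def)
    qed (simp add: F_def)
    ultimately show "(\<lambda>n. of_real (sgn (of_int r + 1/2) - gaussE ((of_int r - real n) * c)) * exp (2 * of_real pi * \<i> * of_int r * w)) \<longlonglongrightarrow> F r"
      by (simp only: gaussE_minus add_uminus_conv_diff)
  next
    fix n :: nat and r :: int
    have "\<bar>sgn (of_int r + 1/2) - gaussE ((of_int r - real n) * c)\<bar> \<le> (if r \<ge> 0 then 2 else exp (- (pi * c\<^sup>2) * (of_int r)\<^sup>2))"
    proof (cases "r \<ge> 0")
      case True
      thus ?thesis using abs_gaussE_le_1[of "(of_int r - real n) * c"] by simp
    next
      case False
      hence r: "real_of_int r \<le> -1" by linarith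
      let ?x = "(of_int r - real n) * c"
      have x0: "?x < 0" using r c0 by (intro mult_neg_pos) auto
      have "sgn (of_int r + 1/2) = sgn ?x" using r x0 by simp
      hence "\<bar>sgn (of_int r + 1/2) - gaussE ?x\<bar> \<le> exp (- pi * ?x\<^sup>2)"
        by (intro abs_sgn_minus_gaussE_le) (auto simp: abs_sgn_eq)
      also have "(of_int r)\<^sup>2 \<le> (of_int r - real n)\<^sup>2" using r by (intro abs_le_square_iff[THEN iffD1]) auto
      hence "pi * c\<^sup>2 * (of_int r)\<^sup>2 \<le> pi * c\<^sup>2 * (of_int r - real n)\<^sup>2" by (intro mult_left_mono) auto
      hence "exp (- pi * ?x\<^sup>2) \<le> exp (- (pi * c\<^sup>2) * (of_int r)\<^sup>2)" by (simp add: power_mult_distrib mult_ac)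
      finally show ?thesis using False by simp
    qed
    from mult_right_mono[OF this, of "exp (- 2 * pi * Im w * of_int r)"]
    show "norm (of_real (sgn (of_int r + 1/2) - gaussE ((of_int r - real n) * c)) * exp (2 * of_real pi * \<i> * of_int r * w)) \<le> g r"
      unfolding norm_mult norm_cexp_int norm_of_real g_def exp_add by (simp split: if_splits)
  qed
  also have "infsum F UNIV = infsum F (range int)"
    by (rule infsum_cong_neutral) (auto simp: F_def image_iff, metis zero_le_imp_eq_int)
  also have "\<dots> = (\<Sum>\<^sub>\<infinity>n. F (int n))" by (subst infsum_reindex) (auto simp: o_def)
  also have "\<dots> = (\<Sum>\<^sub>\<infinity>n. 2 * exp (2 * of_real pi * \<i> * w) ^ n)" by (simp add: F_def exp_int_eq_power[symmetric])
  also have "\<dots> = 2 * (1 / (1 - exp (2 * of_real pi * \<i> * w)))"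
  proof -
    have "(\<lambda>n. exp (2 * of_real pi * \<i> * w) ^ n) sums (1 / (1 - exp (2 * of_real pi * \<i> * w)))"
      using q by (rule geometric_sums)
    moreover have "summable (\<lambda>n. norm (exp (2 * of_real pi * \<i> * w) ^ n))"
      unfolding norm_power using q by (intro summable_geometric) simp
    ultimately have "((\<lambda>n. exp (2 * of_real pi * \<i> * w) ^ n) has_sum (1 / (1 - exp (2 * of_real pi * \<i> * w)))) UNIV"
      by (intro norm_summable_imp_has_sum)
    from has_sum_cmult_right[OF this, of 2] show ?thesis by (rule infsumI)
  qed
  finally show ?thesis by simp
qed

text \<open>In the upper half plane the drift multiplies the modulus of every term by
  \<open>exp (- 2 * pi * Im w) ^ n\<close>, the same factor along the whole row.\<close>

lemma row_lhs_limit: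
  assumes \<alpha>: "\<alpha> > 0" and w: "Im w > 0"
  shows "(\<lambda>n. row_lhs \<alpha> (real n) w) \<longlonglongrightarrow> 0"
proof -
  let ?G = "\<lambda>b::int. exp (- of_real \<alpha> * (w + of_int b)\<^sup>2)"
  let ?K = "exp (\<alpha> * (Im w)\<^sup>2 + \<alpha> * (\<bar>Re w\<bar> + 1/2)\<^sup>2)"
  have e: "norm (exp (- of_real \<alpha> * (w + of_int b)\<^sup>2 + 2 * of_real pi * \<i> * of_real (real n) * (w + of_int b)) / (w + of_int b))
      = (norm (?G b) / norm (w + of_int b)) * exp (- 2 * pi * Im w) ^ n" for b :: int and n
    unfolding exp_add norm_divide norm_mult exp_of_nat_mult[symmetric] by (simp add: mult_ac)
  have im: "Im w \<le> norm (w + of_int b)" for b :: int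
    using abs_Im_le_cmod[of "w + of_int b"] by simp
  have "(\<lambda>n. row_lhs \<alpha> (real n) w) \<longlonglongrightarrow> (\<Sum>\<^sub>\<infinity>b::int. 0)"
    unfolding row_lhs_def
  proof (rule infsum_dominated_convergence)
    show "(\<lambda>b::int. (1 / Im w) * (?K * exp (- (\<alpha>/2) * (of_int b)\<^sup>2))) summable_on UNIV"
      using \<alpha> by (intro summable_on_cmult_right gauss_summable_int) auto
    fix b :: int
    have lt: "exp (- 2 * pi * Im w) < 1" using w by simp
    have "(\<lambda>n. (norm (?G b) / norm (w + of_int b)) * exp (- 2 * pi * Im w) ^ n) \<longlonglongrightarrow> (norm (?G b) / norm (w + of_int b)) * 0"
      by (intro tendsto_intros LIMSEQ_power_zero) (use lt in simp)
    thus "(\<lambda>n. exp (- of_real \<alpha> * (w + of_int b)\<^sup>2 + 2 * of_real pi * \<i> * of_real (real n) * (w + of_int b)) / (w + of_int b)) \<longlonglongrightarrow> 0"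
      unfolding e[symmetric] by (simp add: tendsto_norm_zero_iff)
    fix n
    have "norm (?G b) \<le> ?K * exp (- (\<alpha>/2) * (of_int b)\<^sup>2)"
      using norm_exp_gauss_le[OF \<alpha>, of 0 w b] by simp
    hence "norm (?G b) / norm (w + of_int b) \<le> ?K * exp (- (\<alpha>/2) * (of_int b)\<^sup>2) / Im w"
      using im[of b] w by (intro frac_le) auto
    moreover have "exp (- 2 * pi * Im w) ^ n \<le> 1" using lt by (intro power_le_one) auto
    ultimately have "(norm (?G b) / norm (w + of_int b)) * exp (- 2 * pi * Im w) ^ n \<le> (?K * exp (- (\<alpha>/2) * (of_int b)\<^sup>2) / Im w) * 1"
      using w by (intro mult_mono) auto
    thus "norm (exp (- of_real \<alpha> * (w + of_int b)\<^sup>2 + 2 * of_real pi * \<i> * of_real (real n) * (w + of_int b)) / (w + of_int b))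
        \<le> (1 / Im w) * (?K * exp (- (\<alpha>/2) * (of_int b)\<^sup>2))"
      unfolding e by simp
  qed
  thus ?thesis by simp
qed

lemma row_identity_upper:
  assumes \<alpha>: "\<alpha> > 0" and w: "Im w > 0"
  shows "row_lhs \<alpha> t w = of_real pi * \<i> * row_err \<alpha> t w - 2 * of_real pi * \<i> / (1 - exp (2 * of_real pi * \<i> * w))"
proof -
  have wZ: "w \<notin> \<int>" using w by (auto elim!: Ints_cases)
  define k where "k = row_lhs \<alpha> 0 w - of_real pi * \<i> * row_err \<alpha> 0 w"
  have k: "row_lhs \<alpha> t w - of_real pi * \<i> * row_err \<alpha> t w = k" for t
    unfolding k_def by (rule row_identity_constant[OF \<alpha> wZ])
  have "(\<lambda>n. row_lhs \<alpha> (real n) w - of_real pi * \<i> * row_err \<alpha> (real n) w) \<longlonglongrightarrow> 0 - of_real pi * \<i> * (2 / (1 - exp (2 * of_real pi * \<i> * w)))"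
    by (intro tendsto_intros row_lhs_limit row_err_limit assms)
  hence "k = 0 - of_real pi * \<i> * (2 / (1 - exp (2 * of_real pi * \<i> * w)))"
    unfolding k by (simp add: LIMSEQ_const_iff)
  thus ?thesis using k[of t] by (simp add: algebra_simps)
qed

lemma row_lhs_minus: "row_lhs \<alpha> (- t) (- w) = - row_lhs \<alpha> t w"
proof -
  have "row_lhs \<alpha> (- t) (- w) = (\<Sum>\<^sub>\<infinity>b::int. (\<lambda>b. exp (- of_real \<alpha> * (- w + of_int b)\<^sup>2 + 2 * of_real pi * \<i> * of_real (- t) * (- w + of_int b)) / (- w + of_int b)) (- b))"
    unfolding row_lhs_def by (rule infsum_reindex_bij_betw[symmetric]) (rule bij_uminus)
  also have "\<dots> = (\<Sum>\<^sub>\<infinity>b::int. - (exp (- of_real \<alpha> * (w + of_int b)\<^sup>2 + 2 * of_real pi * \<i> * of_real t * (w + of_int b)) / (w + of_int b)))"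
  proof (rule infsum_cong)
    fix b :: int
    define v where "v = w + of_int b"
    have m: "- w + of_int (- b) = - v" by (simp add: v_def)
    show "(\<lambda>b. exp (- of_real \<alpha> * (- w + of_int b)\<^sup>2 + 2 * of_real pi * \<i> * of_real (- t) * (- w + of_int b)) / (- w + of_int b)) (- b) = - (exp (- of_real \<alpha> * (w + of_int b)\<^sup>2 + 2 * of_real pi * \<i> * of_real t * (w + of_int b)) / (w + of_int b))"
      by (simp only: m v_def[symmetric]) simp
  qed
  finally show ?thesis by (simp add: row_lhs_def infsum_uminus)
qed

text \<open>The sign of r + 1/2 is odd in r except at r = 0, where it is 1 on both sides. This one
  term is the source of the 2.\<close>

lemma row_err_minus:
  assumes "\<alpha> > 0" shows "row_err \<alpha> (- t) (- w) = 2 - row_err \<alpha> t w"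
proof -
  let ?h = "\<lambda>t r w. of_real (sgn (of_int r + 1/2) - gaussE ((of_int r - t) * sqrt (pi / \<alpha>))) * exp (2 * of_real pi * \<i> * of_int r * w)"
  have "row_err \<alpha> (- t) (- w) = (\<Sum>\<^sub>\<infinity>r::int. ?h (-t) (- r) (-w))"
    unfolding row_err_def by (rule infsum_reindex_bij_betw[symmetric]) (rule bij_uminus)
  also have "\<dots> = (\<Sum>\<^sub>\<infinity>r::int. (if r = 0 then 2 else 0) - ?h t r w)"
  proof (rule infsum_cong)
    fix r :: int
    have g: "gaussE ((of_int (- r) - - t) * sqrt (pi / \<alpha>)) = - gaussE ((of_int r - t) * sqrt (pi / \<alpha>))"
      unfolding gaussE_minus[symmetric] by (simp add: algebra_simps)
    have s: "sgn (of_int (- r) + 1/2 :: real) = (if r = 0 then 2 else 0) - sgn (of_int r + 1/2)"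
    proof -
      consider "r = 0" | "r > 0" | "r < 0" by linarith
      thus ?thesis
      proof cases
        case 2 hence "real_of_int r \<ge> 1" by linarith
        thus ?thesis using 2 by simp
      next
        case 3 hence "real_of_int r \<le> -1" by linarith
        thus ?thesis using 3 by simp
      qed simp
    qed
    show "?h (-t) (- r) (-w) = (if r = 0 then 2 else 0) - ?h t r w"
      unfolding g s by (simp add: algebra_simps)
  qed
  also have "\<dots> = (\<Sum>\<^sub>\<infinity>r::int. (if r = 0 then 2 else 0)) - row_err \<alpha> t w"
    unfolding row_err_def
  proof (rule infsum_diff[OF _ row_err_summable[OF assms]])
    show "(\<lambda>r::int. if r = 0 then 2 else 0 :: complex) summable_on UNIV"
      by (rule finite_nonzero_values_imp_summable_on) simp
  qed
  also have "(\<Sum>\<^sub>\<infinity>r::int. (if r = 0 then 2 else 0 :: complex)) = (\<Sum>\<^sub>\<infinity>r\<in>{0::int}. 2)"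
    by (rule infsum_cong_neutral) auto
  finally show ?thesis by simp
qed

lemma exp_2pi_eq_1_iff: "exp (2 * of_real pi * \<i> * w) = 1 \<longleftrightarrow> w \<in> \<int>"
proof
  assume "exp (2 * of_real pi * \<i> * w) = 1"
  then obtain n :: int where n: "Re (2 * of_real pi * \<i> * w) = 0" "Im (2 * of_real pi * \<i> * w) = of_int (2 * n) * pi"
    unfolding exp_eq_1 by auto
  hence "w = of_int n" by (auto simp: complex_eq_iff)
  thus "w \<in> \<int>" by simp
next
  assume "w \<in> \<int>"
  then obtain k where "w = of_int k" by (auto elim: Ints_cases)
  thus "exp (2 * of_real pi * \<i> * w) = 1" using exp_2pi_1_int[of k] by (simp add: mult_ac)
qed

text \<open>The symmetry \<open>w -> - w\<close>, \<open>t -> - t\<close> carries the identity down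
  from the upper half plane; the 2 of \<open>row_err_minus\<close> is just what turns the pole term
  in 1/e back into one in e.\<close>

lemma row_identity_lower:
  assumes \<alpha>: "\<alpha> > 0" and w: "Im w < 0"
  shows "row_lhs \<alpha> t w = of_real pi * \<i> * row_err \<alpha> t w - 2 * of_real pi * \<i> / (1 - exp (2 * of_real pi * \<i> * w))"
proof -
  define e where "e = exp (2 * of_real pi * \<i> * w)"
  have "w \<notin> \<int>" using w by (auto elim!: Ints_cases)
  hence e1: "e \<noteq> 1" "e \<noteq> 0" using exp_2pi_eq_1_iff by (auto simp: e_def)
  have em: "exp (2 * of_real pi * \<i> * - w) = 1 / e" by (simp add: e_def exp_minus field_simps)
  have "row_lhs \<alpha> t w = - row_lhs \<alpha> (- t) (- w)" by (simp add: row_lhs_minus)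
  also have "\<dots> = - (of_real pi * \<i> * (2 - row_err \<alpha> t w) - 2 * of_real pi * \<i> / (1 - 1 / e))"
    using row_identity_upper[OF \<alpha>, of "- w" "- t"] w unfolding row_err_minus[OF \<alpha>] em by simp
  also have "1 - 1 / e = (e - 1) / e" using e1 by (simp add: field_simps)
  finally show ?thesis unfolding e_def[symmetric] using e1 by (simp add: divide_simps) (simp add: algebra_simps)
qed

text \<open>A real non-integer is approached from above, and both series pass to the limit by
  domination.\<close>

lemma row_identity_real:
  assumes \<alpha>: "\<alpha> > 0" and wZ: "w \<notin> \<int>" and w: "Im w = 0"
  shows "row_lhs \<alpha> t w = of_real pi * \<i> * row_err \<alpha> t w - 2 * of_real pi * \<i> / (1 - exp (2 * of_real pi * \<i> * w))"
proof -
  define W where "W n = w + \<i> * of_real (1 / real (Suc n))" for n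
  have W: "Re (W n) = Re w" "Im (W n) = 1 / real (Suc n)" "0 < Im (W n)" "\<bar>Im (W n)\<bar> \<le> 1" "(Im (W n))\<^sup>2 \<le> 1" for n
    using w by (auto simp: W_def power_le_one)
  have lim: "W \<longlonglongrightarrow> w"
  proof -
    have "(\<lambda>n. 1 / real (Suc n)) \<longlonglongrightarrow> 0" by (rule LIMSEQ_Suc[OF lim_1_over_n])
    hence "W \<longlonglongrightarrow> w + \<i> * of_real 0" unfolding W_def by (intro tendsto_intros)
    thus ?thesis by simp
  qed
  obtain d where d: "d > 0" "\<And>b::int. d \<le> norm (w + of_int b)" using dist_Ints_pos[OF wZ] by blast
  \<comment> \<open>The approximating points keep the real part of \<open>w\<close>, so their
    distance to the integers is at least that of \<open>w\<close>.\<close>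
  have dW: "d \<le> norm (W n + of_int b)" for n and b :: int
  proof -
    have "norm (w + of_int b) = \<bar>Re w + of_int b\<bar>" using w by (simp add: cmod_def)
    also have "\<dots> \<le> norm (W n + of_int b)" using abs_Re_le_cmod[of "W n + of_int b"] W by simp
    finally show ?thesis using d(2)[of b] by simp
  qed
  have "(\<lambda>n. row_lhs \<alpha> t (W n)) \<longlonglongrightarrow> row_lhs \<alpha> t w"
    unfolding row_lhs_def
  proof (rule infsum_dominated_convergence)
    let ?K = "exp (2 * pi * \<bar>t\<bar>) * exp (\<alpha> + \<alpha> * (\<bar>Re w\<bar> + 1/2)\<^sup>2)"
    show "(\<lambda>b::int. ?K * exp (- (\<alpha>/2) * (of_int b)\<^sup>2) / d) summable_on UNIV"
      unfolding divide_inverse using \<alpha> by (intro summable_on_cmult_left summable_on_cmult_right gauss_summable_int) auto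
    fix b :: int
    show "(\<lambda>n. exp (- of_real \<alpha> * (W n + of_int b)\<^sup>2 + 2 * of_real pi * \<i> * of_real t * (W n + of_int b)) / (W n + of_int b))
       \<longlonglongrightarrow> exp (- of_real \<alpha> * (w + of_int b)\<^sup>2 + 2 * of_real pi * \<i> * of_real t * (w + of_int b)) / (w + of_int b)"
      using d(2)[of b] d(1) by (intro tendsto_intros lim) auto
    fix n
    have "exp (2 * pi * \<bar>t\<bar> * \<bar>Im (W n)\<bar>) * exp (\<alpha> * (Im (W n))\<^sup>2 + \<alpha> * (\<bar>Re (W n)\<bar> + 1/2)\<^sup>2) \<le> ?K"
      unfolding W(1)
    proof (rule mult_mono)
      show "exp (2 * pi * \<bar>t\<bar> * \<bar>Im (W n)\<bar>) \<le> exp (2 * pi * \<bar>t\<bar>)"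
        using mult_left_mono[OF W(4)[of n], of "2 * pi * \<bar>t\<bar>"] by simp
      show "exp (\<alpha> * (Im (W n))\<^sup>2 + \<alpha> * (\<bar>Re w\<bar> + 1/2)\<^sup>2) \<le> exp (\<alpha> + \<alpha> * (\<bar>Re w\<bar> + 1/2)\<^sup>2)"
        using mult_left_mono[OF W(5)[of n], of \<alpha>] \<alpha> by simp
    qed auto
    from mult_right_mono[OF this exp_ge_zero[of "- (\<alpha>/2) * (of_int b)\<^sup>2"]]
    have "norm (exp (- of_real \<alpha> * (W n + of_int b)\<^sup>2 + 2 * of_real pi * \<i> * of_real t * (W n + of_int b)))
       \<le> ?K * exp (- (\<alpha>/2) * (of_int b)\<^sup>2)"
      using row_lhs_term_bound[OF \<alpha>, of "W n" b t] by linarith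
    from frac_le[OF _ this d(1) dW]
    show "norm (exp (- of_real \<alpha> * (W n + of_int b)\<^sup>2 + 2 * of_real pi * \<i> * of_real t * (W n + of_int b)) / (W n + of_int b))
       \<le> ?K * exp (- (\<alpha>/2) * (of_int b)\<^sup>2) / d"
      unfolding norm_divide by simp
  qed
  moreover have "(\<lambda>n. row_err \<alpha> t (W n)) \<longlonglongrightarrow> row_err \<alpha> t w"
    unfolding row_err_def
  proof (rule infsum_dominated_convergence)
    define g where "g r = 2 * exp (- (pi\<^sup>2/\<alpha>) * (of_int r)\<^sup>2 + (2 * pi\<^sup>2 * t / \<alpha>) * of_int r)" for r :: int
    define h where "h r = 2 * exp (- (pi\<^sup>2/\<alpha>) * (of_int r)\<^sup>2 + (2 * pi\<^sup>2 * t / \<alpha> + 2 * pi) * of_int r)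
         + 2 * exp (- (pi\<^sup>2/\<alpha>) * (of_int r)\<^sup>2 + (2 * pi\<^sup>2 * t / \<alpha> - 2 * pi) * of_int r)" for r :: int
    show "h summable_on UNIV" unfolding h_def
      using \<alpha> by (intro summable_on_add summable_on_cmult_right gauss_linear_summable_int) auto
    fix r :: int
    show "(\<lambda>n. of_real (sgn (of_int r + 1/2) - gaussE ((of_int r - t) * sqrt (pi / \<alpha>))) * exp (2 * of_real pi * \<i> * of_int r * W n))
      \<longlonglongrightarrow> of_real (sgn (of_int r + 1/2) - gaussE ((of_int r - t) * sqrt (pi / \<alpha>))) * exp (2 * of_real pi * \<i> * of_int r * w)"
      by (intro tendsto_intros lim)
    fix n
    have "exp (- 2 * pi * Im (W n) * of_int r) \<le> exp (2 * pi * of_int r) + exp (- 2 * pi * of_int r)"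
    proof -
      have "\<bar>Im (W n) * of_int r\<bar> \<le> 1 * \<bar>of_int r\<bar>" unfolding abs_mult using W(4) by (intro mult_right_mono) auto
      hence "- 2 * pi * Im (W n) * of_int r \<le> 2 * pi * \<bar>of_int r\<bar>"
        using mult_left_mono[of "- (Im (W n) * of_int r)" "\<bar>of_int r\<bar>" "2 * pi"] by (simp add: mult_ac)
      hence "exp (- 2 * pi * Im (W n) * of_int r) \<le> exp (2 * pi * \<bar>of_int r\<bar>)" by simp
      also have "\<dots> \<le> exp (2 * pi * of_int r) + exp (- 2 * pi * of_int r)" by (simp add: abs_if)
      finally show ?thesis .
    qed
    hence "norm (of_real (sgn (of_int r + 1/2) - gaussE ((of_int r - t) * sqrt (pi / \<alpha>))) * exp (2 * of_real pi * \<i> * of_int r * W n))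
       \<le> g r * (exp (2 * pi * of_int r) + exp (- 2 * pi * of_int r))"
      unfolding norm_mult norm_cexp_int norm_of_real g_def by (intro mult_mono row_err_coeff_bound \<alpha>) auto
    also have "\<dots> = h r" unfolding g_def h_def by (simp add: ring_distribs exp_add mult_ac exp_diff divide_inverse exp_minus)
    finally show "norm (of_real (sgn (of_int r + 1/2) - gaussE ((of_int r - t) * sqrt (pi / \<alpha>))) * exp (2 * of_real pi * \<i> * of_int r * W n)) \<le> h r" .
  qed
  moreover have "1 - exp (2 * of_real pi * \<i> * w) \<noteq> 0" using exp_2pi_eq_1_iff[of w] wZ by simp
  ultimately have "(\<lambda>n. of_real pi * \<i> * row_err \<alpha> t (W n) - 2 * of_real pi * \<i> / (1 - exp (2 * of_real pi * \<i> * W n))) \<longlonglongrightarrow>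
     of_real pi * \<i> * row_err \<alpha> t w - 2 * of_real pi * \<i> / (1 - exp (2 * of_real pi * \<i> * w))"
    by (intro tendsto_intros lim)
  moreover have "(\<lambda>n. of_real pi * \<i> * row_err \<alpha> t (W n) - 2 * of_real pi * \<i> / (1 - exp (2 * of_real pi * \<i> * W n))) = (\<lambda>n. row_lhs \<alpha> t (W n))"
    using row_identity_upper[OF \<alpha> W(3)] by auto
  ultimately show ?thesis using \<open>(\<lambda>n. row_lhs \<alpha> t (W n)) \<longlonglongrightarrow> row_lhs \<alpha> t w\<close> LIMSEQ_unique by metis
qed

theorem row_identity:
  assumes "\<alpha> > 0" and "w \<notin> \<int>"
  shows "row_lhs \<alpha> t w = of_real pi * \<i> * row_err \<alpha> t w - 2 * of_real pi * \<i> / (1 - exp (2 * of_real pi * \<i> * w))"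
  using row_identity_upper[OF assms(1), of w t] row_identity_lower[OF assms(1), of w t] row_identity_real[OF assms, of t]
  by linarith

section \<open>The modified function as a lattice sum\<close>

lemma lattice_norm_lower:
  fixes \<tau> :: complex assumes "Im \<tau> > 0"
  obtains D where "D > 0" "\<And>a b :: real. a\<^sup>2 + b\<^sup>2 \<le> D * (norm (of_real a * \<tau> + of_real b))\<^sup>2"
proof -
  define X Y where "X = Re \<tau>" and "Y = Im \<tau>"
  have Y: "Y > 0" using assms by (simp add: Y_def)
  \<comment> \<open>Chosen so that \<open>K * (a * Y)\<^sup>2\<close> equals
    \<open>2 * (a * X)\<^sup>2 + a\<^sup>2\<close>: the second term pays for
    \<open>a\<^sup>2\<close>, the first for what remains of \<open>b\<^sup>2\<close> after b has
    been split as (a X + b) - a X.\<close>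
  define K where "K = (2 * X\<^sup>2 + 1) / Y\<^sup>2"
  define D where "D = 2 + K"
  have K: "K \<ge> 0" by (simp add: K_def)
  hence D: "D > 0" by (simp add: D_def)
  have "a\<^sup>2 + b\<^sup>2 \<le> D * (norm (of_real a * \<tau> + of_real b))\<^sup>2" for a b :: real
  proof -
    have n: "(norm (of_real a * \<tau> + of_real b))\<^sup>2 = (a * X + b)\<^sup>2 + (a * Y)\<^sup>2"
      by (simp add: cmod_power2 X_def Y_def)
    have "b\<^sup>2 \<le> 2 * (a * X + b)\<^sup>2 + 2 * (a * X)\<^sup>2"
      using zero_le_power2[of "b + 2 * (a * X)"] by (simp add: power2_eq_square algebra_simps)
    moreover have "K * (a * Y)\<^sup>2 = 2 * (a * X)\<^sup>2 + a\<^sup>2"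
      using Y by (simp add: K_def power_mult_distrib field_simps)
    moreover have "0 \<le> K * (a * X + b)\<^sup>2" "0 \<le> 2 * (a * Y)\<^sup>2" using K by simp_all
    ultimately show ?thesis unfolding n D_def distrib_left distrib_right by linarith
  qed
  thus ?thesis using that D by blast
qed

text \<open>The Gaussian dominates a Gaussian in the coordinates, so only the denominators could do
  harm, and they stay away from 0. The mesh \<open>s\<close> is 1 for the sums of Appell type and
  1/4 for the common index lattice introduced later.\<close>

lemma lattice_gauss_summable:
  fixes \<tau> w :: complex assumes \<tau>: "Im \<tau> > 0" and c: "c > 0" and s: "s > 0"
    and nz: "\<And>a b :: int. w + of_real (s * of_int a) * \<tau> + of_real (s * of_int b) \<noteq> 0"
  shows "(\<lambda>(a::int, b::int). exp (- c * (norm (w + of_real (s * of_int a) * \<tau> + of_real (s * of_int b)))\<^sup>2)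
      / norm (w + of_real (s * of_int a) * \<tau> + of_real (s * of_int b))) summable_on UNIV"
proof -
  define W where "W a b = norm (w + of_real (s * of_int a) * \<tau> + of_real (s * of_int b))" for a b :: int
  obtain D0 where D0: "D0 > 0" "\<And>a b :: real. a\<^sup>2 + b\<^sup>2 \<le> D0 * (norm (of_real a * \<tau> + of_real b))\<^sup>2"
    using lattice_norm_lower[OF \<tau>] by blast
  define D where "D = 2 * D0 / s\<^sup>2"
  have D: "D > 0" using D0 s by (simp add: D_def)
  have key: "(of_int a)\<^sup>2 + (of_int b)\<^sup>2 \<le> D * ((W a b)\<^sup>2 + (norm w)\<^sup>2)" for a b :: int
  proof -
    let ?v = "of_real (s * of_int a) * \<tau> + of_real (s * of_int b)"
    have "norm ?v \<le> W a b + norm w" unfolding W_def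
      using norm_triangle_ineq4[of "w + of_real (s * of_int a) * \<tau> + of_real (s * of_int b)" w] by (simp add: add.assoc)
    hence "(norm ?v)\<^sup>2 \<le> (W a b + norm w)\<^sup>2" by (intro power_mono) auto
    also have "\<dots> \<le> 2 * ((W a b)\<^sup>2 + (norm w)\<^sup>2)"
      using zero_le_power2[of "W a b - norm w"] by (simp add: power2_eq_square algebra_simps)
    finally have "D0 * (norm ?v)\<^sup>2 \<le> D0 * (2 * ((W a b)\<^sup>2 + (norm w)\<^sup>2))" using D0 by (intro mult_left_mono) auto
    with D0(2)[of "s * of_int a" "s * of_int b"]
    have "s\<^sup>2 * ((of_int a)\<^sup>2 + (of_int b)\<^sup>2) \<le> D0 * (2 * ((W a b)\<^sup>2 + (norm w)\<^sup>2))"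
      by (simp add: power_mult_distrib algebra_simps)
    thus ?thesis using s by (simp add: D_def field_simps)
  qed
  obtain d where d: "d > 0" "\<And>a b. d \<le> W a b"
  proof -
    \<comment> \<open>Only finitely many lattice points come within distance 1 of -w, so the minimum
      over these and 1 is a positive lower bound for all denominators.\<close>
    define S where "S = {(a, b). W a b < 1}"
    define N where "N = \<lceil>D * (1 + (norm w)\<^sup>2)\<rceil>"
    have "S \<subseteq> {-N..N} \<times> {-N..N}"
    proof
      fix x assume x: "x \<in> S"
      obtain a b where ab: "x = (a, b)" by (cases x)
      have "(W a b)\<^sup>2 \<le> 1" using x ab by (intro power_le_one) (auto simp: S_def W_def)
      hence "(of_int a)\<^sup>2 + (of_int b)\<^sup>2 \<le> D * (1 + (norm w)\<^sup>2)"
        using key[of a b] D by (smt (verit) mult_left_mono)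
      hence "of_int (a\<^sup>2 + b\<^sup>2) \<le> (of_int N :: real)" unfolding N_def by (simp add: ) linarith
      hence ab2: "a\<^sup>2 + b\<^sup>2 \<le> N" by (simp only: of_int_le_iff)
      have "\<bar>k\<bar> \<le> k\<^sup>2" for k :: int
        using mult_left_mono[of 1 "\<bar>k\<bar>" "\<bar>k\<bar>"] by (cases "k = 0") (auto simp: power2_eq_square)
      note this[of a] this[of b]
      with ab2 show "x \<in> {-N..N} \<times> {-N..N}" using ab2 ab zero_le_power2[of a] zero_le_power2[of b] by auto
    qed
    hence fin: "finite S" by (rule finite_subset) auto
    define d where "d = Min (insert 1 ((\<lambda>(a,b). W a b) ` S))"
    have "d > 0" unfolding d_def using fin nz by (subst Min_gr_iff) (auto simp: W_def)
    moreover have "d \<le> W a b" for a b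
    proof (cases "(a, b) \<in> S")
      case True
      hence "W a b \<in> insert 1 ((\<lambda>(a,b). W a b) ` S)" by (auto simp: image_iff)
      thus ?thesis unfolding d_def using fin by (intro Min_le) auto
    next
      case False
      have "d \<le> 1" unfolding d_def using fin by (intro Min_le) auto
      thus ?thesis using False by (simp add: S_def)
    qed
    ultimately show ?thesis using that by blast
  qed
  show ?thesis
  proof (rule summable_on_comparison_test)
    show "(\<lambda>x. (exp (c * (norm w)\<^sup>2) / d) * (\<lambda>(a::int,b::int). exp (- (c/D) * ((of_int a)\<^sup>2 + (of_int b)\<^sup>2))) x) summable_on UNIV"
      using c D by (intro summable_on_cmult_right gauss_summable_int2) auto
    fix x :: "int \<times> int"
    obtain a b where ab: "x = (a, b)" by (cases x)
    have "(c/D) * ((of_int a)\<^sup>2 + (of_int b)\<^sup>2) \<le> (c/D) * (D * ((W a b)\<^sup>2 + (norm w)\<^sup>2))"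
      using key c D by (intro mult_left_mono) auto
    also have "\<dots> = c * (W a b)\<^sup>2 + c * (norm w)\<^sup>2" using D by (simp add: field_simps)
    finally have "exp (- c * (W a b)\<^sup>2) \<le> exp (c * (norm w)\<^sup>2) * exp (- (c/D) * ((of_int a)\<^sup>2 + (of_int b)\<^sup>2))"
      unfolding exp_add[symmetric] by simp
    from frac_le[OF _ this d(1) d(2)[of a b]]
    show "(case x of (a, b) \<Rightarrow> exp (- c * (norm (w + of_real (s * of_int a) * \<tau> + of_real (s * of_int b)))\<^sup>2)
      / norm (w + of_real (s * of_int a) * \<tau> + of_real (s * of_int b))) \<le> (exp (c * (norm w)\<^sup>2) / d) * (\<lambda>(a::int,b::int). exp (- (c/D) * ((of_int a)\<^sup>2 + (of_int b)\<^sup>2))) x"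
      unfolding ab W_def by simp
  qed (auto simp: case_prod_beta)
qed

text \<open>A term of a Kronecker-Eisenstein type series: up to a twist by \<open>w2\<close>, a
  Gaussian in \<open>W = w1 + a * \<tau> + b\<close> over \<open>W\<close>. The exponent is not
  holomorphic; for fixed \<open>a\<close> the conjugate of \<open>W\<close> is \<open>W\<close>
  minus a constant, which makes the row a multiple of \<open>row_lhs\<close>.\<close>

definition appell_term :: "nat \<Rightarrow> complex \<Rightarrow> complex \<Rightarrow> complex \<Rightarrow> int \<Rightarrow> int \<Rightarrow> complex" where
  "appell_term l \<tau> w1 w2 a b =
     exp (2 * of_real pi * \<i> * of_nat l * of_int a * w2
       - of_real (pi * real l / Im \<tau>) * (w1 + of_int a * \<tau> + of_int b) * (cnj (w1 + of_int a * \<tau> + of_int b) + w2 - cnj w2))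
     / (w1 + of_int a * \<tau> + of_int b)"

definition appell_sum :: "nat \<Rightarrow> complex \<Rightarrow> complex \<Rightarrow> complex \<Rightarrow> complex" where
  "appell_sum l \<tau> w1 w2 = (\<Sum>\<^sub>\<infinity>(a::int, b::int). appell_term l \<tau> w1 w2 a b)"

text \<open>The two contributions linear in \<open>a\<close>, from the twist by \<open>w2\<close>
  and from \<open>w2 - cnj w2\<close>, cancel because \<kappa> Im \<tau> = pi l. An isotropic
  Gaussian and a factor independent of the lattice point remain.\<close>

lemma norm_appell_term:
  assumes "Im \<tau> > 0"
  shows "norm (appell_term l \<tau> w1 w2 a b) = exp (2 * pi * real l * Im w1 * Im w2 / Im \<tau>) *
     (exp (- (pi * real l / Im \<tau>) * (norm (w1 + of_int a * \<tau> + of_int b))\<^sup>2) / norm (w1 + of_int a * \<tau> + of_int b))"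
proof -
  define W where "W = w1 + of_int a * \<tau> + of_int b"
  define \<kappa> where "\<kappa> = pi * real l / Im \<tau>"
  have "Im W = Im w1 + of_int a * Im \<tau>" by (simp add: W_def)
  moreover have "\<kappa> * Im \<tau> = pi * real l" using assms by (simp add: \<kappa>_def)
  moreover have "Re (2 * of_real pi * \<i> * of_nat l * of_int a * w2 - of_real \<kappa> * W * (cnj W + w2 - cnj w2))
     = - 2 * pi * real l * of_int a * Im w2 - \<kappa> * ((norm W)\<^sup>2 - 2 * Im w2 * Im W)"
    unfolding cmod_power2 by (simp add: algebra_simps power2_eq_square)
  ultimately have e: "Re (2 * of_real pi * \<i> * of_nat l * of_int a * w2 - of_real \<kappa> * W * (cnj W + w2 - cnj w2))
     = 2 * \<kappa> * Im w1 * Im w2 - \<kappa> * (norm W)\<^sup>2"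
    by (simp add: algebra_simps)
  have "2 * \<kappa> * Im w1 * Im w2 = 2 * pi * real l * Im w1 * Im w2 / Im \<tau>" by (simp add: \<kappa>_def)
  thus ?thesis unfolding appell_term_def W_def[symmetric] norm_divide norm_exp_eq_Re \<kappa>_def[symmetric] e
    by (simp add: exp_diff exp_minus divide_inverse)
qed

lemma appell_term_summable:
  assumes "Im \<tau> > 0" "l > 0" "\<And>a b :: int. w1 + of_int a * \<tau> + of_int b \<noteq> 0"
  shows "(\<lambda>(a, b). appell_term l \<tau> w1 w2 a b) summable_on UNIV"
proof (rule abs_summable_summable)
  have "(\<lambda>x. exp (2 * pi * real l * Im w1 * Im w2 / Im \<tau>) * (case x of (a::int, b::int) \<Rightarrow>
     exp (- (pi * real l / Im \<tau>) * (norm (w1 + of_real (1 * of_int a) * \<tau> + of_real (1 * of_int b)))\<^sup>2)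
       / norm (w1 + of_real (1 * of_int a) * \<tau> + of_real (1 * of_int b)))) summable_on UNIV"
    using assms by (intro summable_on_cmult_right lattice_gauss_summable) auto
  thus "(\<lambda>x. norm (case x of (a, b) \<Rightarrow> appell_term l \<tau> w1 w2 a b)) summable_on UNIV"
    by (simp add: case_prod_beta norm_appell_term[OF assms(1)])
qed

lemma row_lhs_shift:
  "row_lhs \<alpha> (t + of_int k) w = exp (2 * of_real pi * \<i> * of_int k * w) * row_lhs \<alpha> t w"
proof -
  have "exp (- of_real \<alpha> * (w + of_int b)\<^sup>2 + 2 * of_real pi * \<i> * of_real (t + of_int k) * (w + of_int b)) =
     exp (2 * of_real pi * \<i> * of_int k * w) * exp (- of_real \<alpha> * (w + of_int b)\<^sup>2 + 2 * of_real pi * \<i> * of_real t * (w + of_int b))" for b :: int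
  proof -
    have "exp (2 * of_real pi * \<i> * of_int (k * b)) = 1" by (subst exp_2pi_eq_1_iff) simp
    moreover have "- of_real \<alpha> * (w + of_int b)\<^sup>2 + 2 * of_real pi * \<i> * of_real (t + of_int k) * (w + of_int b) =
      2 * of_real pi * \<i> * of_int k * w + (- of_real \<alpha> * (w + of_int b)\<^sup>2 + 2 * of_real pi * \<i> * of_real t * (w + of_int b)) + 2 * of_real pi * \<i> * of_int (k * b)"
      by (simp add: algebra_simps)
    ultimately show ?thesis by (simp only: exp_add mult_1_right)
  qed
  thus ?thesis unfolding row_lhs_def by (simp add: infsum_cmult_right' times_divide_eq_right[symmetric] del: times_divide_eq_right)
qed

text \<open>Along a row the imaginary part of \<open>W\<close> is constant, so the exponent is a
  quadratic polynomial in \<open>W + b\<close>, with drift \<open>t + l * a\<close>. The integral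
  part \<open>l * a\<close> of the drift factors out by \<open>row_lhs_shift\<close>, so the error
  term has the same \<open>t\<close> in every row.\<close>

lemma appell_row:
  fixes \<tau> w1 w2 :: complex
  assumes \<tau>: "Im \<tau> > 0" and l: "l > 0" and nz: "\<And>a b :: int. w1 + of_int a * \<tau> + of_int b \<noteq> 0"
  defines "\<alpha> \<equiv> pi * real l / Im \<tau>" and "t \<equiv> real l * (Im w1 - Im w2) / Im \<tau>"
  shows "(\<Sum>\<^sub>\<infinity>b. appell_term l \<tau> w1 w2 a b) =
     exp (2 * of_real pi * \<i> * of_nat l * of_int a * (w1 + w2)) * qpow \<tau> (of_int (a\<^sup>2 * int l)) *
     (of_real pi * \<i> * row_err \<alpha> t (w1 + of_int a * \<tau>) - 2 * of_real pi * \<i> / (1 - exp (2 * of_real pi * \<i> * w1) * qpow \<tau> (of_int a)))"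
proof -
  define W where "W = w1 + of_int a * \<tau>"
  have \<alpha>: "\<alpha> > 0" using \<tau> l by (simp add: \<alpha>_def)
  have WZ: "W \<notin> \<int>"
  proof
    assume "W \<in> \<int>"
    then obtain k where "W = of_int k" by (auto elim: Ints_cases)
    thus False using nz[of a "-k"] by (simp add: W_def)
  qed
  have "appell_term l \<tau> w1 w2 a b = exp (2 * of_real pi * \<i> * of_nat l * of_int a * w2) *
     (exp (- of_real \<alpha> * (W + of_int b)\<^sup>2 + 2 * of_real pi * \<i> * of_real (t + of_int (int l * a)) * (W + of_int b)) / (W + of_int b))" for b
  proof -
    have c1: "cnj (W + of_int b) = (W + of_int b) - 2 * \<i> * of_real (Im w1 + of_int a * Im \<tau>)"
      by (simp add: complex_eq_iff W_def)
    have c2: "w2 - cnj w2 = 2 * \<i> * of_real (Im w2)" by (simp add: complex_eq_iff)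
    have c3: "cnj (W + of_int b) + w2 - cnj w2 = (W + of_int b) - 2 * \<i> * of_real (Im w1 + of_int a * Im \<tau> - Im w2)"
      unfolding add_diff_eq[symmetric] c1 c2 by (simp add: algebra_simps)
    have "pi * (t + of_int (int l * a)) = \<alpha> * (Im w1 + of_int a * Im \<tau> - Im w2)"
      using \<tau> by (simp add: \<alpha>_def t_def field_simps)
    hence t: "of_real pi * of_real (t + of_int (int l * a)) = of_real \<alpha> * (of_real (Im w1 + of_int a * Im \<tau> - Im w2) :: complex)"
      by (metis of_real_mult)
    have "- of_real \<alpha> * (W + of_int b) * (cnj (W + of_int b) + w2 - cnj w2) =
      - of_real \<alpha> * (W + of_int b)\<^sup>2 + 2 * \<i> * (of_real \<alpha> * of_real (Im w1 + of_int a * Im \<tau> - Im w2)) * (W + of_int b)"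
      unfolding c3 by (simp add: power2_eq_square algebra_simps)
    also have "\<dots> = - of_real \<alpha> * (W + of_int b)\<^sup>2 + 2 * of_real pi * \<i> * of_real (t + of_int (int l * a)) * (W + of_int b)"
      unfolding t[symmetric] by (simp add: mult_ac)
    finally have "2 * of_real pi * \<i> * of_nat l * of_int a * w2 - of_real \<alpha> * (W + of_int b) * (cnj (W + of_int b) + w2 - cnj w2) =
      2 * of_real pi * \<i> * of_nat l * of_int a * w2 + (- of_real \<alpha> * (W + of_int b)\<^sup>2 + 2 * of_real pi * \<i> * of_real (t + of_int (int l * a)) * (W + of_int b))"
      by simp
    thus ?thesis unfolding appell_term_def W_def[symmetric] \<alpha>_def[symmetric] by (simp only: exp_add times_divide_eq_right)
  qed
  hence "(\<Sum>\<^sub>\<infinity>b. appell_term l \<tau> w1 w2 a b) = exp (2 * of_real pi * \<i> * of_nat l * of_int a * w2) * row_lhs \<alpha> (t + of_int (int l * a)) W"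
    by (simp only: infsum_cmult_right' row_lhs_def)
  also have "\<dots> = exp (2 * of_real pi * \<i> * of_nat l * of_int a * w2) * exp (2 * of_real pi * \<i> * of_int (int l * a) * W) *
     (of_real pi * \<i> * row_err \<alpha> t W - 2 * of_real pi * \<i> / (1 - exp (2 * of_real pi * \<i> * W)))"
    unfolding row_lhs_shift row_identity[OF \<alpha> WZ] by (simp only: mult.assoc)
  also have "exp (2 * of_real pi * \<i> * W) = exp (2 * of_real pi * \<i> * w1) * qpow \<tau> (of_int a)"
    unfolding qpow_def exp_add[symmetric] by (simp add: W_def algebra_simps)
  also have "exp (2 * of_real pi * \<i> * of_nat l * of_int a * w2) * exp (2 * of_real pi * \<i> * of_int (int l * a) * W) =
     exp (2 * of_real pi * \<i> * of_nat l * of_int a * (w1 + w2)) * qpow \<tau> (of_int (a\<^sup>2 * int l))"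
    unfolding qpow_def exp_add[symmetric] by (simp add: W_def algebra_simps power2_eq_square)
  finally show ?thesis unfolding W_def .
qed

lemma theta_reindex:
  assumes "l > 0"
  shows "theta j l \<tau> z = (\<Sum>\<^sub>\<infinity>a::int. qpow \<tau> (real l * (of_int a + of_int j / (2 * real l))\<^sup>2) *
      exp (2 * of_real pi * \<i> * of_nat l * of_real (of_int a + of_int j / (2 * real l)) * z))"
  unfolding theta_def
proof (rule infsum_reindex_bij_betw[symmetric, where g = "\<lambda>a::int. of_int a + of_int j / (2 * real l)"])
  show "bij_betw (\<lambda>a::int. of_int a + of_int j / (2 * real l)) UNIV {r. r - of_int j / (2 * real l) \<in> \<int>}"
  proof (rule bij_betwI')
    fix y assume "y \<in> {r. r - of_int j / (2 * real l) \<in> \<int>}"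
    then obtain k where "y - of_int j / (2 * real l) = of_int k" by (auto elim: Ints_cases)
    thus "\<exists>x\<in>UNIV. y = of_int x + of_int j / (2 * real l)" by (intro bexI[of _ k]) auto
  qed auto
qed

lemma theta_cong:
  assumes "[j = k] (mod (2 * int l))" "l > 0"
  shows "theta j l \<tau> z = theta k l \<tau> z"
proof -
  obtain m where m: "j = k + 2 * int l * m" using assms by (metis cong_iff_lin cong_sym)
  have e: "of_int j / (2 * real l) = of_int k / (2 * real l) + of_int m" using assms by (simp add: m field_simps)
  have "r - of_int j / (2 * real l) \<in> \<int> \<longleftrightarrow> r - of_int k / (2 * real l) \<in> \<int>" for r
  proof -
    have "(x + of_int m \<in> \<int>) = (x \<in> \<int>)" for x :: real
      using Ints_add[of x "of_int m"] Ints_diff[of "x + of_int m" "of_int m"] by auto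
    from this[of "r - of_int j / (2 * real l)"] show ?thesis using e by (simp add: algebra_simps)
  qed
  thus ?thesis by (simp add: theta_def)
qed

lemma theta_minus:
  assumes "l > 0" shows "theta j l \<tau> (- z) = theta (- j) l \<tau> z"
proof -
  have "theta j l \<tau> (-z) = (\<Sum>\<^sub>\<infinity>a::int. (\<lambda>a. qpow \<tau> (real l * (of_int a + of_int j / (2 * real l))\<^sup>2) *
      exp (2 * of_real pi * \<i> * of_nat l * of_real (of_int a + of_int j / (2 * real l)) * (-z))) (- a))"
    unfolding theta_reindex[OF assms] by (rule infsum_reindex_bij_betw[symmetric]) (rule bij_uminus)
  also have "\<dots> = theta (-j) l \<tau> z"
    unfolding theta_reindex[OF assms]
  proof (rule infsum_cong)
    fix a :: int
    define x where "x = of_int a + of_int (- j) / (2 * real l)"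
    have x: "of_int (- a) + of_int j / (2 * real l) = - x" by (simp add: x_def)
    show "(\<lambda>a. qpow \<tau> (real l * (of_int a + of_int j / (2 * real l))\<^sup>2) *
      exp (2 * of_real pi * \<i> * of_nat l * of_real (of_int a + of_int j / (2 * real l)) * (-z))) (- a) =
      qpow \<tau> (real l * (of_int a + of_int (- j) / (2 * real l))\<^sup>2) *
      exp (2 * of_real pi * \<i> * of_nat l * of_real (of_int a + of_int (- j) / (2 * real l)) * z)"
      by (simp only: x x_def[symmetric]) simp
  qed
  finally show ?thesis .
qed

text \<open>With r = j + 2 l m and j reduced, both signs are positive exactly when m \<ge> 0. The
  sign in \<open>Rfun\<close> thus does not depend on \<open>j\<close>, and the residue classes can
  be summed together.\<close>

lemma sgn_residue:
  fixes r j :: int assumes "[r = j] (mod (2 * int l))" "j \<in> {0..2 * int l - 1}"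
  shows "sgn (of_int r - 1/2 - of_int j + 2 * real l) = sgn (of_int r + 1/2 :: real)"
proof -
  obtain m where m: "r = j + 2 * int l * m" using assms(1) by (metis cong_iff_lin cong_sym)
  consider "m \<ge> 0" | "m \<le> -1" by linarith
  thus ?thesis
  proof cases
    case 1
    hence "r \<ge> j" using m by simp
    moreover have "2 * real l \<ge> 1" using assms(2) by auto
    ultimately have "of_int r - 1/2 - of_int j + 2 * real l > 0" "of_int r + 1/2 > (0::real)" using assms(2) by auto
    thus ?thesis by simp
  next
    case 2
    hence "2 * int l * m \<le> 2 * int l * (-1)" by (intro mult_left_mono) auto
    hence r: "r \<le> j - 2 * int l" using m by simp
    hence "real_of_int r \<le> of_int (j - 2 * int l)" by (simp only: of_int_le_iff)
    hence "of_int r - 1/2 - of_int j + 2 * real l < 0" by simp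
    moreover have "r \<le> -1" using r assms(2) by simp
    hence "real_of_int r + 1/2 < 0" by linarith
    ultimately show ?thesis by simp
  qed
qed

text \<open>Summed over the rows, the pole terms of \<open>appell_row\<close> give
  \<open>Phi1\<close>, while the error terms form a double series over the row index a and the dual
  index r. With the order exchanged, the sum over a is a theta function that depends on r only
  modulo 2 l, and collecting residue classes yields \<open>Rfun\<close>.\<close>

theorem appell_sum_eq:
  assumes \<tau>: "Im \<tau> > 0" and l: "l > 0" and nz: "\<And>a b :: int. w1 + of_int a * \<tau> + of_int b \<noteq> 0"
  shows "appell_sum l \<tau> w1 w2 = - 2 * of_real pi * \<i> * Phi1 l 0 \<tau> w1 w2
    + of_real pi * \<i> * (\<Sum>j\<in>{0..2 * int l - 1}. Rfun j l \<tau> ((w1 - w2) / 2) * theta j l \<tau> (w1 + w2))"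
proof -
  define \<alpha> where "\<alpha> = pi * real l / Im \<tau>"
  define t where "t = real l * (Im w1 - Im w2) / Im \<tau>"
  define Y where "Y = Im \<tau>"
  have Y: "Y > 0" using \<tau> by (simp add: Y_def)
  have \<alpha>: "\<alpha> > 0" using \<tau> l by (simp add: \<alpha>_def)
  define cf where "cf r = sgn (of_int r + 1/2) - gaussE ((of_int r - t) * sqrt (pi / \<alpha>))" for r :: int
  define pre where "pre a = exp (2 * of_real pi * \<i> * of_nat l * of_int a * (w1 + w2)) * qpow \<tau> (of_int (a\<^sup>2 * int l))" for a :: int
  define X where "X a r = pre a * (of_real (cf r) * exp (2 * of_real pi * \<i> * of_int r * (w1 + of_int a * \<tau>)))" for a r :: int
  define P where "P a = pre a / (1 - exp (2 * of_real pi * \<i> * w1) * qpow \<tau> (of_int a))" for a :: int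
  have Xs: "(\<lambda>(a, r). X a r) summable_on UNIV"
  proof (rule abs_summable_summable, rule summable_on_comparison_test)
    \<comment> \<open>The quadratic part of the exponent of |X a r| is -(pi Y / l) ((l A)^2 + (l A +
      R)^2), and A^2 + R^2 is at most 3 times this sum of squares; hence the 3.\<close>
    define c where "c = pi * Y / (3 * real l)"
    define C where "C = \<bar>2 * pi * real l * (Im w1 + Im w2)\<bar> + \<bar>2 * pi\<^sup>2 * t / \<alpha> - 2 * pi * Im w1\<bar>"
    have c: "c > 0" using Y l by (simp add: c_def)
    show "(\<lambda>x. 2 * (\<lambda>(a::int,b::int). exp (- c * ((of_int a)\<^sup>2 + (of_int b)\<^sup>2) + C * (\<bar>of_int a\<bar> + \<bar>of_int b\<bar>))) x) summable_on UNIV"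
      by (intro summable_on_cmult_right gauss_linear_summable_int2 c)
    fix x :: "int \<times> int"
    obtain a r where x: "x = (a, r)" by (cases x)
    define A R where "A = real_of_int a" and "R = real_of_int r"
    have np: "norm (pre a) = exp (- 2 * pi * real l * A * (Im w1 + Im w2) - 2 * pi * real l * Y * A\<^sup>2)"
      unfolding pre_def norm_mult qpow_def norm_exp_eq_Re exp_add[symmetric]
      by (simp add: A_def Y_def algebra_simps)
    have ne: "norm (exp (2 * of_real pi * \<i> * of_int r * (w1 + of_int a * \<tau>))) = exp (- 2 * pi * R * (Im w1 + A * Y))"
      by (simp add: A_def R_def Y_def algebra_simps)
    have cb: "norm (complex_of_real (cf r)) \<le> 2 * exp (- (pi * Y / real l) * R\<^sup>2 + (2 * pi\<^sup>2 * t / \<alpha>) * R)"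
    proof -
      have "pi\<^sup>2 / \<alpha> = pi * Y / real l" using Y l by (simp add: \<alpha>_def Y_def power2_eq_square)
      thus ?thesis using row_err_coeff_bound[OF \<alpha>, of r t] unfolding norm_of_real cf_def R_def by simp
    qed
    have "norm (X a r) \<le> exp (- 2 * pi * real l * A * (Im w1 + Im w2) - 2 * pi * real l * Y * A\<^sup>2) *
       ((2 * exp (- (pi * Y / real l) * R\<^sup>2 + (2 * pi\<^sup>2 * t / \<alpha>) * R)) * exp (- 2 * pi * R * (Im w1 + A * Y)))"
      unfolding X_def norm_mult np ne by (intro mult_left_mono mult_right_mono cb) auto
    also have "\<dots> = 2 * exp (- (pi * Y / real l) * ((real l * A)\<^sup>2 + (real l * A + R)\<^sup>2)
         + (- (2 * pi * real l * (Im w1 + Im w2)) * A + (2 * pi\<^sup>2 * t / \<alpha> - 2 * pi * Im w1) * R))"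
    proof -
      have "- 2 * pi * real l * A * (Im w1 + Im w2) - 2 * pi * real l * Y * A\<^sup>2 + ((- (pi * Y / real l) * R\<^sup>2 + (2 * pi\<^sup>2 * t / \<alpha>) * R) + (- 2 * pi * R * (Im w1 + A * Y)))
        = - (pi * Y / real l) * ((real l * A)\<^sup>2 + (real l * A + R)\<^sup>2)
         + (- (2 * pi * real l * (Im w1 + Im w2)) * A + (2 * pi\<^sup>2 * t / \<alpha> - 2 * pi * Im w1) * R)"
        using l \<alpha> by (simp add: field_simps power2_eq_square)
      moreover have "exp x * ((2 * exp y) * exp z) = 2 * exp (x + (y + z))" for x y z :: real by (simp add: exp_add)
      ultimately show ?thesis by (simp only:)
    qed
    also have "\<dots> \<le> 2 * exp (- c * (A\<^sup>2 + R\<^sup>2) + C * (\<bar>A\<bar> + \<bar>R\<bar>))"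
    proof -
      have "1 \<le> (real l)\<^sup>2" using l by (simp add: one_le_power)
      from mult_right_mono[OF this, of "A\<^sup>2"] have "A\<^sup>2 \<le> (real l)\<^sup>2 * A\<^sup>2" by simp
      moreover have "R\<^sup>2 \<le> 2 * (real l * A + R)\<^sup>2 + 2 * (real l * A)\<^sup>2"
        using zero_le_power2[of "R + 2 * (real l * A)"] by (simp add: power2_eq_square algebra_simps)
      ultimately have "A\<^sup>2 + R\<^sup>2 \<le> 3 * ((real l * A)\<^sup>2 + (real l * A + R)\<^sup>2)"
      proof -
        define u v where "u = (real l * A)\<^sup>2" and "v = (real l * A + R)\<^sup>2"
        assume "A\<^sup>2 \<le> (real l)\<^sup>2 * A\<^sup>2" "R\<^sup>2 \<le> 2 * (real l * A + R)\<^sup>2 + 2 * (real l * A)\<^sup>2"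
        hence "A\<^sup>2 \<le> u" "R\<^sup>2 \<le> 2 * v + 2 * u" "0 \<le> v" by (simp_all add: u_def v_def power_mult_distrib)
        hence "A\<^sup>2 + R\<^sup>2 \<le> u + (2 * v + 2 * u)" "u + (2 * v + 2 * u) \<le> 3 * (u + v)" by (auto intro: add_mono)
        thus ?thesis unfolding u_def v_def by (rule order_trans)
      qed
      from mult_left_mono[OF this, of c] c
      have 1: "c * (A\<^sup>2 + R\<^sup>2) \<le> (pi * Y / real l) * ((real l * A)\<^sup>2 + (real l * A + R)\<^sup>2)"
      proof -
        have "c * (3 * S) = (pi * Y / real l) * S" for S using l by (simp add: c_def)
        moreover assume "0 \<le> c \<Longrightarrow> c * (A\<^sup>2 + R\<^sup>2) \<le> c * (3 * ((real l * A)\<^sup>2 + (real l * A + R)\<^sup>2))"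
        from this[OF less_imp_le[OF c]] have "c * (A\<^sup>2 + R\<^sup>2) \<le> c * (3 * ((real l * A)\<^sup>2 + (real l * A + R)\<^sup>2))" .
        ultimately show ?thesis by (simp only:)
      qed
      have "u * A \<le> \<bar>u\<bar> * \<bar>A\<bar>" "u * R \<le> \<bar>u\<bar> * \<bar>R\<bar>" for u by (metis abs_ge_self abs_mult)+
      from this(1)[of "- (2 * pi * real l * (Im w1 + Im w2))"] this(2)[of "2 * pi\<^sup>2 * t / \<alpha> - 2 * pi * Im w1"]
      have 2: "- (2 * pi * real l * (Im w1 + Im w2)) * A + (2 * pi\<^sup>2 * t / \<alpha> - 2 * pi * Im w1) * R \<le>
         \<bar>2 * pi * real l * (Im w1 + Im w2)\<bar> * \<bar>A\<bar> + \<bar>2 * pi\<^sup>2 * t / \<alpha> - 2 * pi * Im w1\<bar> * \<bar>R\<bar>" by (simp only: abs_minus_cancel)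
      also have "\<dots> \<le> C * (\<bar>A\<bar> + \<bar>R\<bar>)" unfolding C_def ring_distribs by simp
      finally show ?thesis using 1 by simp
    qed
    finally show "norm (case x of (a, r) \<Rightarrow> X a r) \<le> 2 * (\<lambda>(a::int,b::int). exp (- c * ((of_int a)\<^sup>2 + (of_int b)\<^sup>2) + C * (\<bar>of_int a\<bar> + \<bar>of_int b\<bar>))) x"
      unfolding x A_def R_def by simp
  qed auto
  have row: "(\<Sum>\<^sub>\<infinity>b. appell_term l \<tau> w1 w2 a b) = of_real pi * \<i> * (\<Sum>\<^sub>\<infinity>r. X a r) - 2 * of_real pi * \<i> * P a" for a
  proof -
    have "(\<Sum>\<^sub>\<infinity>r. X a r) = pre a * row_err \<alpha> t (w1 + of_int a * \<tau>)"
      unfolding X_def row_err_def cf_def by (rule infsum_cmult_right')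
    thus ?thesis unfolding appell_row[OF \<tau> l nz] \<alpha>_def[symmetric] t_def[symmetric] pre_def[symmetric] P_def
      by (simp add: algebra_simps)
  qed
  have As: "(\<lambda>(a, b). appell_term l \<tau> w1 w2 a b) summable_on UNIV \<times> UNIV" using appell_term_summable[OF \<tau> l nz] by simp
  have Xs': "(\<lambda>(a, r). X a r) summable_on UNIV \<times> UNIV" using Xs by simp
  have s1: "(\<lambda>a. \<Sum>\<^sub>\<infinity>b. appell_term l \<tau> w1 w2 a b) summable_on UNIV" by (rule summable_on_Sigma_banach[OF As])
  have s2: "(\<lambda>a. \<Sum>\<^sub>\<infinity>r. X a r) summable_on UNIV" by (rule summable_on_Sigma_banach[OF Xs'])
  \<comment> \<open>The convergence of the series of poles needs no estimate of its own: it is a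
    combination of two row series already known to be summable.\<close>
  have s3: "P summable_on UNIV"
  proof -
    have "(\<lambda>a. (of_real pi * \<i> * (\<Sum>\<^sub>\<infinity>r. X a r) - (\<Sum>\<^sub>\<infinity>b. appell_term l \<tau> w1 w2 a b)) * (1 / (2 * of_real pi * \<i>))) summable_on UNIV"
      by (intro summable_on_cmult_left summable_on_diff summable_on_cmult_right s1 s2)
    thus ?thesis unfolding row by simp
  qed
  have "appell_sum l \<tau> w1 w2 = (\<Sum>\<^sub>\<infinity>a. \<Sum>\<^sub>\<infinity>b. appell_term l \<tau> w1 w2 a b)"
    unfolding appell_sum_def using infsum_Sigma'_banach[OF As] by simp
  also have "\<dots> = of_real pi * \<i> * (\<Sum>\<^sub>\<infinity>a. \<Sum>\<^sub>\<infinity>r. X a r) - 2 * of_real pi * \<i> * infsum P UNIV"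
    unfolding row by (simp add: infsum_diff summable_on_cmult_right s2 s3 infsum_cmult_right')
  also have "infsum P UNIV = Phi1 l 0 \<tau> w1 w2" unfolding Phi1_def
    by (rule infsum_cong) (simp add: P_def pre_def)
  also have "(\<Sum>\<^sub>\<infinity>a. \<Sum>\<^sub>\<infinity>r. X a r) = (\<Sum>\<^sub>\<infinity>r. \<Sum>\<^sub>\<infinity>a. X a r)" by (rule infsum_swap_banach[OF Xs'])
  also have "\<dots> = (\<Sum>j\<in>{0..2 * int l - 1}. Rfun j l \<tau> ((w1 - w2) / 2) * theta j l \<tau> (w1 + w2))"
  proof -
    define \<rho> where "\<rho> r = of_real (cf r) * exp (- (of_real pi * \<i> * of_int (r\<^sup>2) / (2 * of_nat l)) * \<tau> + 2 * of_real pi * \<i> * of_int r * ((w1 - w2) / 2))" for r :: int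
    \<comment> \<open>Completing the square, l a^2 + r a = l (a + r / (2 l))^2 - r^2 / (4 l): the
      first part is the exponent of theta, the second the factor exp(-pi i r^2 \<tau> / (2 l)) of
      \<open>Rfun\<close>.\<close>
    have col: "(\<Sum>\<^sub>\<infinity>a. X a r) = \<rho> r * theta r l \<tau> (w1 + w2)" for r
      unfolding theta_reindex[OF l] infsum_cmult_right'[symmetric]
    proof (rule infsum_cong)
      fix a :: int
      have "2 * of_real pi * \<i> * of_nat l * of_int a * (w1 + w2) + 2 * of_real pi * \<i> * of_real (of_int (a\<^sup>2 * int l)) * \<tau> + 2 * of_real pi * \<i> * of_int r * (w1 + of_int a * \<tau>)
        = (- (of_real pi * \<i> * of_int (r\<^sup>2) / (2 * of_nat l)) * \<tau> + 2 * of_real pi * \<i> * of_int r * ((w1 - w2) / 2)) +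
          2 * of_real pi * \<i> * of_real (real l * (of_int a + of_int r / (2 * real l))\<^sup>2) * \<tau> +
          2 * of_real pi * \<i> * of_nat l * of_real (of_int a + of_int r / (2 * real l)) * (w1 + w2)"
        using l by (simp add: field_simps power2_eq_square)
      from arg_cong[OF this, of exp]
      show "X a r = \<rho> r * (qpow \<tau> (real l * (of_int a + of_int r / (2 * real l))\<^sup>2) *
          exp (2 * of_real pi * \<i> * of_nat l * of_real (of_int a + of_int r / (2 * real l)) * (w1 + w2)))"
        unfolding X_def \<rho>_def pre_def qpow_def exp_add by (simp only: mult_ac)
    qed
    define C where "C j = {r::int. [r = j] (mod (2 * int l))}" for j
    have disj: "C j \<inter> C k = {}" if "j \<in> {0..2 * int l - 1}" "k \<in> {0..2 * int l - 1}" "j \<noteq> k" for j k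
    proof -
      have "\<not> [j = k] (mod (2 * int l))" using that by (auto simp: cong_def)
      thus ?thesis unfolding C_def by (auto dest: cong_sym cong_trans)
    qed
    have un: "(\<Union>j\<in>{0..2 * int l - 1}. C j) = UNIV"
    proof -
      have "r \<in> C (r mod (2 * int l))" "r mod (2 * int l) \<in> {0..2 * int l - 1}" for r
        using l by (auto simp: C_def cong_def pos_mod_bound)
      thus ?thesis by blast
    qed
    have s: "(\<lambda>r. \<rho> r * theta r l \<tau> (w1 + w2)) summable_on UNIV"
    proof -
      have "(\<lambda>(r, a). X a r) summable_on UNIV \<times> UNIV"
        using Xs' by (subst (asm) product_swap[symmetric], subst (asm) summable_on_reindex) (simp_all add: o_def case_prod_unfold)
      from summable_on_Sigma_banach[OF this] show ?thesis by (simp add: col)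
    qed
    have "(\<Sum>\<^sub>\<infinity>r. \<Sum>\<^sub>\<infinity>a. X a r) = (\<Sum>\<^sub>\<infinity>r\<in>(\<Union>j\<in>{0..2 * int l - 1}. C j). \<rho> r * theta r l \<tau> (w1 + w2))" by (simp add: un col)
    also have "\<dots> = (\<Sum>j\<in>{0..2 * int l - 1}. \<Sum>\<^sub>\<infinity>r\<in>C j. \<rho> r * theta r l \<tau> (w1 + w2))"
      by (rule sum_infsum[symmetric]) (auto intro: summable_on_subset_banach[OF s] simp: disj)
    also have "\<dots> = (\<Sum>j\<in>{0..2 * int l - 1}. Rfun j l \<tau> ((w1 - w2) / 2) * theta j l \<tau> (w1 + w2))"
    proof (rule sum.cong[OF refl])
      fix j assume j: "j \<in> {0..2 * int l - 1}"
      have "(\<Sum>\<^sub>\<infinity>r\<in>C j. \<rho> r * theta r l \<tau> (w1 + w2)) = (\<Sum>\<^sub>\<infinity>r\<in>C j. \<rho> r * theta j l \<tau> (w1 + w2))"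
        by (rule infsum_cong) (auto simp: C_def theta_cong[OF _ l])
      also have "\<dots> = (\<Sum>\<^sub>\<infinity>r\<in>C j. \<rho> r) * theta j l \<tau> (w1 + w2)" by (rule infsum_cmult_left')
      also have "(\<Sum>\<^sub>\<infinity>r\<in>C j. \<rho> r) = Rfun j l \<tau> ((w1 - w2) / 2)"
        unfolding Rfun_def C_def[symmetric]
      proof (rule infsum_cong)
        fix r assume r: "r \<in> C j"
        have "sgn (of_int r - 1/2 - of_int j + 2 * real l) = sgn (of_int r + 1/2 :: real)"
          by (rule sgn_residue[OF _ j]) (use r in \<open>simp add: C_def\<close>)
        moreover have "pi / \<alpha> = Im \<tau> / real l" using \<tau> l by (simp add: \<alpha>_def)
        moreover have "t = 2 * real l * Im ((w1 - w2) / 2) / Im \<tau>" by (simp add: t_def)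
        ultimately show "\<rho> r = of_real (sgn (of_int r - 1/2 - of_int j + 2 * real l)
                  - gaussE ((of_int r - 2 * real l * Im ((w1 - w2) / 2) / Im \<tau>) * sqrt (Im \<tau> / real l)))
        * exp (- (of_real pi * \<i> * of_int (r\<^sup>2) / (2 * of_nat l)) * \<tau>
                + 2 * of_real pi * \<i> * of_int r * ((w1 - w2) / 2))"
          by (simp only: \<rho>_def cf_def)
      qed
      finally show "(\<Sum>\<^sub>\<infinity>r\<in>C j. \<rho> r * theta r l \<tau> (w1 + w2)) = Rfun j l \<tau> ((w1 - w2) / 2) * theta j l \<tau> (w1 + w2)" .
    qed
    finally show ?thesis .
  qed
  finally show ?thesis by simp
qed

lemma appell_sum_minus: "appell_sum l \<tau> (- w1) (- w2) = - appell_sum l \<tau> w1 w2"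
proof -
  have "appell_sum l \<tau> (- w1) (- w2) = (\<Sum>\<^sub>\<infinity>x. (\<lambda>(a, b). appell_term l \<tau> (- w1) (- w2) a b) (- fst x, - snd x))"
    unfolding appell_sum_def
    by (rule infsum_reindex_bij_betw[symmetric]) (rule bij_betwI[where g = "\<lambda>x. (- fst x, - snd x)"], auto)
  also have "\<dots> = (\<Sum>\<^sub>\<infinity>x. - (case x of (a, b) \<Rightarrow> appell_term l \<tau> w1 w2 a b))"
  proof (rule infsum_cong)
    fix x :: "int \<times> int"
    obtain a b where x: "x = (a, b)" by (cases x)
    define W where "W = w1 + of_int a * \<tau> + of_int b"
    have W: "- w1 + of_int (- a) * \<tau> + of_int (- b) = - W" by (simp add: W_def)
    have "appell_term l \<tau> (- w1) (- w2) (- a) (- b) = - appell_term l \<tau> w1 w2 a b"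
    proof -
      define v where "v = cnj W + w2 - cnj w2"
      have e: "cnj (- W) + - w2 - cnj (- w2) = - v" by (simp add: v_def)
      show ?thesis unfolding appell_term_def W W_def[symmetric] e v_def[symmetric] by simp
    qed
    thus "(\<lambda>(a, b). appell_term l \<tau> (- w1) (- w2) a b) (- fst x, - snd x) = - (case x of (a, b) \<Rightarrow> appell_term l \<tau> w1 w2 a b)"
      by (simp add: x)
  qed
  finally show ?thesis by (simp add: appell_sum_def infsum_uminus)
qed

text \<open>The second half of \<Phi> lives at (-z2, -z1). There the argument (z1 - z2)/2 of
  \<open>Rfun\<close> is unchanged, while theta is evaluated at -(z1 + z2), which replaces j by -j:
  this is the origin of the difference of theta functions in the modification. Since
  \<open>appell_sum\<close> is odd, the two halves combine to a sum symmetric in z1 and z2.\<close>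

theorem Phi_mod_eq_appell:
  assumes \<tau>: "Im \<tau> > 0" and l: "l > 0"
    and nz1: "\<And>a b :: int. z1 + of_int a * \<tau> + of_int b \<noteq> 0"
    and nz2: "\<And>a b :: int. z2 + of_int a * \<tau> + of_int b \<noteq> 0"
  shows "Phi_mod l 0 \<tau> z1 z2 = - (appell_sum l \<tau> z1 z2 + appell_sum l \<tau> z2 z1) / (2 * of_real pi * \<i>)"
proof -
  have nz2': "- z2 + of_int a * \<tau> + of_int b \<noteq> 0" for a b :: int
    using nz2[of "-a" "-b"] by (auto simp: algebra_simps)
  define S where "S = (\<Sum>j\<in>{0..2 * int l - 1}. Rfun j l \<tau> ((z1 - z2) / 2) * theta j l \<tau> (z1 + z2))"
  define S' where "S' = (\<Sum>j\<in>{0..2 * int l - 1}. Rfun j l \<tau> ((z1 - z2) / 2) * theta (- j) l \<tau> (z1 + z2))"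
  have e1: "appell_sum l \<tau> z1 z2 = - 2 * of_real pi * \<i> * Phi1 l 0 \<tau> z1 z2 + of_real pi * \<i> * S"
    unfolding S_def by (rule appell_sum_eq[OF \<tau> l nz1])
  have "- z2 - - z1 = z1 - z2" "- z2 + - z1 = - (z1 + z2)" by simp_all
  hence e2: "- appell_sum l \<tau> z2 z1 = - 2 * of_real pi * \<i> * Phi1 l 0 \<tau> (- z2) (- z1) + of_real pi * \<i> * S'"
    using appell_sum_eq[OF \<tau> l nz2', of "- z1"] unfolding S'_def appell_sum_minus by (simp only: theta_minus[OF l])
  have "Phi_mod l 0 \<tau> z1 z2 = Phi1 l 0 \<tau> z1 z2 - Phi1 l 0 \<tau> (- z2) (- z1) + 1/2 * (S' - S)"
    unfolding Phi_mod_def Phi_def S_def S'_def by (simp add: right_diff_distrib sum_subtractf)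
  moreover have "appell_sum l \<tau> z1 z2 + appell_sum l \<tau> z2 z1 = - 2 * of_real pi * \<i> * (Phi1 l 0 \<tau> z1 z2 - Phi1 l 0 \<tau> (- z2) (- z1) + 1/2 * (S' - S))"
  proof -
    have e3: "appell_sum l \<tau> z2 z1 = - (- 2 * of_real pi * \<i> * Phi1 l 0 \<tau> (- z2) (- z1) + of_real pi * \<i> * S')"
      unfolding e2[symmetric] by simp
    show ?thesis unfolding e1 e3 by (simp add: field_simps)
  qed
  ultimately show ?thesis by simp
qed

section \<open>Lattice sums with bounded coefficients\<close>

definition ee :: "real \<Rightarrow> complex" where "ee x = cis (2 * pi * x)"

lemma ee_add: "ee (x + y) = ee x * ee y" by (simp add: ee_def cis_mult ring_distribs)
lemma ee_conv_exp: "ee x = exp (2 * of_real pi * \<i> * of_real x)" by (simp add: ee_def cis_conv_exp mult_ac)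
lemma norm_ee [simp]: "norm (ee x) = 1" by (simp add: ee_def)
lemma ee_nonzero [simp]: "ee x \<noteq> 0" by (simp add: ee_def)
lemma ee_Ints: "x \<in> \<int> \<Longrightarrow> ee x = 1"
  unfolding ee_conv_exp by (subst exp_2pi_eq_1_iff) (auto elim: Ints_cases)
lemma ee_eqI: "x - y \<in> \<int> \<Longrightarrow> ee x = ee y"
  using ee_add[of y "x - y"] by (simp add: ee_Ints)

text \<open>Coordinates such as j + \<sigma>'/2 with j in Z/2 need quarters. One index set serves
  all generators, whose actual supports are encoded in the coefficients, so that the modular group
  can act by reindexing.\<close>

definition quarter_lattice :: "(real \<times> real) set" where
  "quarter_lattice = {(P, Q). 4 * P \<in> \<int> \<and> 4 * Q \<in> \<int>}"

definition lat_kernel :: "real \<Rightarrow> complex \<Rightarrow> complex \<Rightarrow> real \<times> real \<Rightarrow> complex" where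
  "lat_kernel \<kappa> \<tau> z x = (let p = of_real (fst x) * \<tau> + of_real (snd x) in
     exp (- of_real (pi * \<kappa> / Im \<tau>) * (p * cnj p + cnj p * z + z\<^sup>2 / 4)) / (z / 2 + p))"

definition lat_sum :: "real \<Rightarrow> (real \<times> real \<Rightarrow> complex) \<Rightarrow> complex \<Rightarrow> complex \<Rightarrow> complex" where
  "lat_sum \<kappa> c \<tau> z = (\<Sum>\<^sub>\<infinity>x\<in>quarter_lattice. c x * lat_kernel \<kappa> \<tau> z x)"

definition bounded_coeff :: "(real \<times> real \<Rightarrow> complex) \<Rightarrow> bool" where
  "bounded_coeff c \<longleftrightarrow> (\<exists>B. \<forall>x. norm (c x) \<le> B)"

lemma bij_quarter_lattice:
  "bij_betw (\<lambda>(a::int, b::int). (of_int a / 4, of_int b / 4)) UNIV quarter_lattice"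
proof (rule bij_betwI')
  fix y assume "y \<in> quarter_lattice"
  then obtain P Q a b where "y = (P, Q)" "4 * P = of_int a" "4 * Q = of_int b"
    by (auto simp: quarter_lattice_def elim!: Ints_cases)
  thus "\<exists>x\<in>UNIV. y = (case x of (a::int, b::int) \<Rightarrow> (of_int a / 4, of_int b / 4))"
    by (intro bexI[of _ "(a, b)"]) auto
qed (auto simp: quarter_lattice_def)

lemma fdom_Im: "(\<tau>, z) \<in> fdom \<Longrightarrow> Im \<tau> > 0" by (simp add: fdom_def)

lemma fdom_nonzero:
  assumes "(\<tau>, z) \<in> fdom" "4 * P \<in> \<int>" "4 * Q \<in> \<int>"
  shows "z / 2 + (of_real P * \<tau> + of_real Q) \<noteq> 0"
proof
  assume e: "z / 2 + (of_real P * \<tau> + of_real Q) = 0"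
  obtain a b where ab: "4 * P = of_int a" "4 * Q = of_int b" using assms by (auto elim!: Ints_cases)
  have PQ: "P = of_int a / 4" "Q = of_int b / 4" using ab by auto
  have "z = - 2 * (of_real P * \<tau> + of_real Q)" using e by (simp add: add_eq_0_iff field_simps)
  also have "\<dots> = (of_int (- b) + of_int (- a) * \<tau>) / 2" unfolding PQ by (simp add: field_simps)
  finally show False using assms(1) unfolding fdom_def by blast
qed

text \<open>The real part of p p* + p* z + z^2/4 is |z/2 + p|^2 up to a term free of p, so the
  kernel decays as a Gaussian in its own denominator.\<close>

lemma norm_lat_kernel:
  "norm (lat_kernel \<kappa> \<tau> z x) = exp ((pi * \<kappa> / Im \<tau>) * ((norm z)\<^sup>2 - Re (z\<^sup>2)) / 4) *
     (exp (- (pi * \<kappa> / Im \<tau>) * (norm (z / 2 + (of_real (fst x) * \<tau> + of_real (snd x))))\<^sup>2) /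
      norm (z / 2 + (of_real (fst x) * \<tau> + of_real (snd x))))"
proof -
  define p where "p = of_real (fst x) * \<tau> + of_real (snd x)"
  define u where "u = pi * \<kappa> / Im \<tau>"
  have "Re (- of_real u * (p * cnj p + cnj p * z + z\<^sup>2 / 4)) = u * ((norm z)\<^sup>2 - Re (z\<^sup>2)) / 4 + - u * (norm (z / 2 + p))\<^sup>2"
    unfolding cmod_power2 by (simp add: power2_eq_square field_simps)
  thus ?thesis
    unfolding lat_kernel_def Let_def p_def[symmetric] u_def[symmetric] norm_divide norm_exp_eq_Re
    by (simp only: exp_add times_divide_eq_right)
qed

lemma lat_kernel_summable:
  assumes "(\<tau>, z) \<in> fdom" "\<kappa> > 0"
  shows "(\<lambda>x. norm (lat_kernel \<kappa> \<tau> z x)) summable_on quarter_lattice"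
proof -
  have "(\<lambda>x. exp ((pi * \<kappa> / Im \<tau>) * ((norm z)\<^sup>2 - Re (z\<^sup>2)) / 4) * (case x of (a::int, b::int) \<Rightarrow>
      exp (- (pi * \<kappa> / Im \<tau>) * (norm (z / 2 + of_real (1/4 * of_int a) * \<tau> + of_real (1/4 * of_int b)))\<^sup>2)
      / norm (z / 2 + of_real (1/4 * of_int a) * \<tau> + of_real (1/4 * of_int b)))) summable_on UNIV"
  proof (intro summable_on_cmult_right lattice_gauss_summable)
    show "z / 2 + of_real (1/4 * of_int a) * \<tau> + of_real (1/4 * of_int b) \<noteq> 0" for a b :: int
      using fdom_nonzero[OF assms(1), of "1/4 * of_int a" "1/4 * of_int b"] by (simp add: add.assoc)
  qed (use fdom_Im[OF assms(1)] assms(2) in auto)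
  hence "(\<lambda>x. norm (lat_kernel \<kappa> \<tau> z (case x of (a::int, b::int) \<Rightarrow> (of_int a / 4, of_int b / 4)))) summable_on UNIV"
    unfolding norm_lat_kernel by (simp add: case_prod_unfold add.assoc)
  thus ?thesis
    using summable_on_reindex_bij_betw[OF bij_quarter_lattice, of "\<lambda>x. norm (lat_kernel \<kappa> \<tau> z x)"] by simp
qed

lemma lat_term_summable:
  assumes "(\<tau>, z) \<in> fdom" "\<kappa> > 0" "bounded_coeff c"
  shows "(\<lambda>x. c x * lat_kernel \<kappa> \<tau> z x) summable_on quarter_lattice"
proof -
  obtain B where B: "\<And>x. norm (c x) \<le> B" using assms(3) by (auto simp: bounded_coeff_def)
  show ?thesis
  proof (rule abs_summable_summable, rule summable_on_comparison_test)
    show "(\<lambda>x. B * norm (lat_kernel \<kappa> \<tau> z x)) summable_on quarter_lattice"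
      by (intro summable_on_cmult_right lat_kernel_summable assms)
  qed (auto simp: norm_mult B intro!: mult_right_mono)
qed

lemma lat_sum_scale: "lat_sum \<kappa> (\<lambda>x. u * c x) \<tau> z = u * lat_sum \<kappa> c \<tau> z"
  by (simp add: lat_sum_def mult.assoc infsum_cmult_right')

lemma lat_sum_add:
  assumes "(\<tau>, z) \<in> fdom" "\<kappa> > 0" "bounded_coeff c" "bounded_coeff d"
  shows "lat_sum \<kappa> (\<lambda>x. c x + d x) \<tau> z = lat_sum \<kappa> c \<tau> z + lat_sum \<kappa> d \<tau> z"
  unfolding lat_sum_def distrib_right by (intro infsum_add lat_term_summable assms)

lemma bounded_coeff_add: "bounded_coeff c \<Longrightarrow> bounded_coeff d \<Longrightarrow> bounded_coeff (\<lambda>x. c x + d x)"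
  unfolding bounded_coeff_def by (meson add_mono norm_triangle_le)

lemma bounded_coeff_scale: "bounded_coeff c \<Longrightarrow> bounded_coeff (\<lambda>x. u * c x)"
  unfolding bounded_coeff_def norm_mult by (meson mult_left_mono norm_ge_zero)

lemma bounded_coeff_zero: "bounded_coeff (\<lambda>x. 0)"
  unfolding bounded_coeff_def by auto

lemma bounded_coeff_sum: "(\<And>i. i \<in> I \<Longrightarrow> bounded_coeff (c i)) \<Longrightarrow> bounded_coeff (\<lambda>x. \<Sum>i\<in>I. c i x)"
  by (induction I rule: infinite_finite_induct) (auto intro: bounded_coeff_add bounded_coeff_zero)

lemma lat_sum_sum:
  assumes "(\<tau>, z) \<in> fdom" "\<kappa> > 0" "\<And>i. i \<in> I \<Longrightarrow> bounded_coeff (c i)"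
  shows "lat_sum \<kappa> (\<lambda>x. \<Sum>i\<in>I. u i * c i x) \<tau> z = (\<Sum>i\<in>I. u i * lat_sum \<kappa> (c i) \<tau> z)"
  using assms(3)
proof (induction I rule: infinite_finite_induct)
  case (insert i I)
  thus ?case
    using assms(1,2) by (simp add: lat_sum_add lat_sum_scale bounded_coeff_scale bounded_coeff_sum)
qed (simp_all add: lat_sum_def)

section \<open>The functions \<open>f\<close> as lattice sums\<close>

text \<open>With s1 = \<sigma>'/2 and s2 = \<sigma>/2. The coordinate P runs modulo M and Q modulo 1
  because \<Phi> has the modular parameter M\<tau>. The phase is the one that
  \<open>f_exponent_identity\<close> leaves over, without the constant \<sigma>\<sigma>'/4.\<close>

definition half_coeff :: "nat \<Rightarrow> real \<Rightarrow> real \<Rightarrow> real \<Rightarrow> real \<Rightarrow> real \<Rightarrow> real \<Rightarrow> real \<times> real \<Rightarrow> complex" where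
  "half_coeff M \<kappa> j k \<epsilon> s1 s2 = (\<lambda>(P, Q).
     if (\<exists>a::int. P = j + s1 + real M * of_int a) \<and> (\<exists>b::int. Q = \<epsilon> + s2 + of_int b)
     then ee (\<kappa> * ((s1 * Q - s2 * P) - k * (Q - s2) + \<epsilon> * (P - s1 - j))) else 0)"

text \<open>The two summands come from \<open>\<Phi>\<^sub>1(\<tau>, z\<^sub>1, z\<^sub>2)\<close> and \<open>\<Phi>\<^sub>1(\<tau>, -z\<^sub>2, -z\<^sub>1)\<close>.\<close>

definition f_coeff :: "nat \<Rightarrow> real \<Rightarrow> real \<Rightarrow> real \<Rightarrow> real \<Rightarrow> real \<Rightarrow> real \<Rightarrow> real \<times> real \<Rightarrow> complex" where
  "f_coeff M \<kappa> \<epsilon> s1 s2 j k = (\<lambda>x. half_coeff M \<kappa> j k \<epsilon> s1 s2 x + half_coeff M \<kappa> k j \<epsilon> (- s1) (- s2) x)"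

lemma bounded_half_coeff: "bounded_coeff (half_coeff M \<kappa> j k \<epsilon> s1 s2)"
  unfolding bounded_coeff_def half_coeff_def by (intro exI[of _ 1]) auto

lemma bounded_f_coeff: "bounded_coeff (f_coeff M \<kappa> \<epsilon> s1 s2 j k)"
  unfolding f_coeff_def by (intro bounded_coeff_add bounded_half_coeff)

text \<open>The conjugates of \<tau> and z are replaced by independent variables \<open>tb\<close>
  and \<open>zb\<close>, which makes this a polynomial identity. On its right side the phase is
  multiplied by \<tau> - tb and the remainder is the exponent of \<open>lat_kernel\<close>.\<close>

lemma f_exponent_identity:
  fixes \<tau> tb z zb j k \<epsilon> \<sigma> \<sigma>' a b M :: complex
  defines "P \<equiv> j + \<sigma>' / 2 + M * a" and "Q \<equiv> \<epsilon> + \<sigma> / 2 + b"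
    and "z1 \<equiv> (z + \<sigma> + \<sigma>' * \<tau>) / 2" and "z2 \<equiv> (z - \<sigma> - \<sigma>' * \<tau>) / 2" and "z2b \<equiv> (zb - \<sigma> - \<sigma>' * tb) / 2"
  shows "(\<tau> - tb) * (- (\<sigma>'\<^sup>2 / 4) * \<tau> + j * k * \<tau> + (k * z1 + j * z2) + M * a * (z2 + k * \<tau> + \<epsilon>))
      - (z / 2 + (P * \<tau> + Q)) * (zb / 2 + (P * tb + Q) + (z2 + k * \<tau> + \<epsilon>) - (z2b + k * tb + \<epsilon>))
     = (\<tau> - tb) * (\<sigma> * \<sigma>' / 4 + (\<sigma>' / 2 * Q - \<sigma> / 2 * P) - k * (Q - \<sigma> / 2) + \<epsilon> * (P - \<sigma>' / 2 - j))
      - ((P * \<tau> + Q) * (P * tb + Q) + (P * tb + Q) * z + z\<^sup>2 / 4)"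
  unfolding P_def Q_def z1_def z2_def z2b_def by (simp add: field_simps power2_eq_square)

lemma f_term_identity:
  fixes M n :: nat and j k \<epsilon> \<sigma> \<sigma>' :: real and a b :: int and \<tau> z :: complex
  assumes M: "M > 0" and \<tau>: "Im \<tau> > 0"
  defines "\<kappa> \<equiv> real n / real M"
    and "P \<equiv> j + \<sigma>' / 2 + real M * of_int a" and "Q \<equiv> \<epsilon> + \<sigma> / 2 + of_int b"
    and "z1 \<equiv> (z + of_real \<sigma> + of_real \<sigma>' * \<tau>) / 2" and "z2 \<equiv> (z - of_real \<sigma> - of_real \<sigma>' * \<tau>) / 2"
  shows "qpow \<tau> (- (real n / (4 * real M)) * \<sigma>'\<^sup>2) * (qpow \<tau> (real n * j * k / real M)
      * exp (2 * of_real pi * \<i> * of_nat n / of_nat M * (of_real k * z1 + of_real j * z2)))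
      * appell_term n (of_nat M * \<tau>) (z1 + of_real j * \<tau> + of_real \<epsilon>) (z2 + of_real k * \<tau> + of_real \<epsilon>) a b
    = ee (\<kappa> * \<sigma> * \<sigma>' / 4) * (ee (\<kappa> * ((\<sigma>' / 2 * Q - \<sigma> / 2 * P) - k * (Q - \<sigma> / 2) + \<epsilon> * (P - \<sigma>' / 2 - j)))
      * lat_kernel \<kappa> \<tau> z (P, Q))"
proof -
  define U where "U = complex_of_real (pi * \<kappa> / Im \<tau>)"
  have M0: "complex_of_nat M \<noteq> 0" using M by simp
  have T: "\<tau> - cnj \<tau> = 2 * \<i> * of_real (Im \<tau>)" by (simp add: complex_eq_iff)
  \<comment> \<open>The bridge between the two kinds of exponents: a factor 2 pi i \<kappa>, as in
    the powers of q, is \<open>U\<close> times \<tau> minus its conjugate, so that \<open>U\<close>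
    can be taken out of everything.\<close>
  have UT: "U * (\<tau> - cnj \<tau>) = 2 * of_real pi * \<i> * of_real \<kappa>"
    unfolding T U_def using \<tau> by (simp add: field_simps)
  have n: "complex_of_nat n = of_real \<kappa> * of_nat M" using M0 by (simp add: \<kappa>_def)
  define p where "p = of_real P * \<tau> + of_real Q"
  have W: "(z1 + of_real j * \<tau> + of_real \<epsilon>) + of_int a * (of_nat M * \<tau>) + of_int b = z / 2 + p"
    by (simp add: z1_def p_def P_def Q_def field_simps)
  have U': "complex_of_real (pi * real n / Im (of_nat M * \<tau>)) = U"
    using M \<tau> by (simp add: U_def \<kappa>_def field_simps)
  have id: "(\<tau> - cnj \<tau>) * (- ((of_real \<sigma>')\<^sup>2 / 4) * \<tau> + of_real j * of_real k * \<tau> + (of_real k * z1 + of_real j * z2) + of_nat M * of_int a * (z2 + of_real k * \<tau> + of_real \<epsilon>))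
      - (z / 2 + p) * (cnj (z / 2 + p) + (z2 + of_real k * \<tau> + of_real \<epsilon>) - cnj (z2 + of_real k * \<tau> + of_real \<epsilon>))
     = (\<tau> - cnj \<tau>) * of_real (\<sigma> * \<sigma>' / 4 + ((\<sigma>' / 2 * Q - \<sigma> / 2 * P) - k * (Q - \<sigma> / 2) + \<epsilon> * (P - \<sigma>' / 2 - j)))
      - (p * cnj p + cnj p * z + z\<^sup>2 / 4)"
    using f_exponent_identity[of \<tau> "cnj \<tau>" "of_real \<sigma>'" "of_real j" "of_real k" z "of_real \<sigma>" "of_nat M" "of_int a" "of_real \<epsilon>" "of_int b" "cnj z"]
    unfolding p_def P_def Q_def z1_def z2_def by (simp add: mult_ac add_ac)
  have ex: "2 * of_real pi * \<i> * of_real (- (real n / (4 * real M)) * \<sigma>'\<^sup>2) * \<tau> + (2 * of_real pi * \<i> * of_real (real n * j * k / real M) * \<tau>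
      + 2 * of_real pi * \<i> * of_nat n / of_nat M * (of_real k * z1 + of_real j * z2))
      + (2 * of_real pi * \<i> * of_nat n * of_int a * (z2 + of_real k * \<tau> + of_real \<epsilon>)
        - U * (z / 2 + p) * (cnj (z / 2 + p) + (z2 + of_real k * \<tau> + of_real \<epsilon>) - cnj (z2 + of_real k * \<tau> + of_real \<epsilon>)))
     = 2 * of_real pi * \<i> * of_real (\<kappa> * \<sigma> * \<sigma>' / 4) + (2 * of_real pi * \<i> * of_real (\<kappa> * ((\<sigma>' / 2 * Q - \<sigma> / 2 * P) - k * (Q - \<sigma> / 2) + \<epsilon> * (P - \<sigma>' / 2 - j)))
       + - U * (p * cnj p + cnj p * z + z\<^sup>2 / 4))" (is "?L = ?R")
  proof -
    define T where "T = \<tau> - cnj \<tau>"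
    have V: "2 * of_real pi * \<i> * of_real \<kappa> = U * T" by (simp only: UT T_def)
    have nM: "complex_of_nat n / of_nat M = of_real \<kappa>" by (simp add: \<kappa>_def)
    have A1: "2 * of_real pi * \<i> * of_real (- (real n / (4 * real M)) * \<sigma>'\<^sup>2) * \<tau> = U * T * (- ((of_real \<sigma>')\<^sup>2 / 4) * \<tau>)"
      unfolding V[symmetric] nM[symmetric] by simp
    have A2: "2 * of_real pi * \<i> * of_real (real n * j * k / real M) * \<tau> = U * T * (of_real j * of_real k * \<tau>)"
      unfolding V[symmetric] nM[symmetric] by simp
    have A3: "2 * of_real pi * \<i> * of_nat n / of_nat M * X = U * T * X" for X
      unfolding V[symmetric] nM[symmetric] by simp
    have A4: "2 * of_real pi * \<i> * of_nat n * of_int a * X = U * T * (of_nat M * of_int a * X)" for X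
      unfolding V[symmetric] n by simp
    have gen: "U * T * x1 + (U * T * x2 + U * T * x3) + (U * T * x4 - U * w * w') = U * (T * (x1 + x2 + x3 + x4) - w * w')" for x1 x2 x3 x4 w w'
      by (simp add: algebra_simps)
    have gen2: "U * (T * of_real (\<sigma> * \<sigma>' / 4 + X) - q) = 2 * of_real pi * \<i> * of_real (\<kappa> * \<sigma> * \<sigma>' / 4) + (2 * of_real pi * \<i> * of_real (\<kappa> * X) + - U * q)" for X q
    proof -
      have "U * (T * of_real (\<sigma> * \<sigma>' / 4 + X) - q) = (U * T) * of_real (\<sigma> * \<sigma>' / 4 + X) - U * q" by (simp add: algebra_simps)
      thus ?thesis unfolding V[symmetric] by (simp add: distrib_left mult.assoc)
    qed
    show ?thesis unfolding A1 A2 A3 A4 gen id[folded T_def] gen2 ..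
  qed
  have "ee (\<kappa> * \<sigma> * \<sigma>' / 4) * (ee (\<kappa> * ((\<sigma>' / 2 * Q - \<sigma> / 2 * P) - k * (Q - \<sigma> / 2) + \<epsilon> * (P - \<sigma>' / 2 - j)))
      * lat_kernel \<kappa> \<tau> z (P, Q)) = exp ?R / (z / 2 + p)"
    unfolding lat_kernel_def Let_def fst_conv snd_conv p_def[symmetric] U_def[symmetric] ee_conv_exp exp_add by simp
  moreover have "qpow \<tau> (- (real n / (4 * real M)) * \<sigma>'\<^sup>2) * (qpow \<tau> (real n * j * k / real M)
      * exp (2 * of_real pi * \<i> * of_nat n / of_nat M * (of_real k * z1 + of_real j * z2)))
      * appell_term n (of_nat M * \<tau>) (z1 + of_real j * \<tau> + of_real \<epsilon>) (z2 + of_real k * \<tau> + of_real \<epsilon>) a b = exp ?L / (z / 2 + p)"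
    unfolding appell_term_def W U' qpow_def exp_add by simp
  ultimately show ?thesis unfolding ex by simp
qed

lemma half_sum:
  fixes M :: nat
  assumes M: "M > 0" and P: "4 * (j + s1) \<in> \<int>" and Q: "4 * (\<epsilon> + s2) \<in> \<int>"
  shows "(\<Sum>\<^sub>\<infinity>(a::int, b::int). ee (\<kappa> * ((s1 * (\<epsilon> + s2 + of_int b) - s2 * (j + s1 + real M * of_int a)) - k * (\<epsilon> + s2 + of_int b - s2)
        + \<epsilon> * (j + s1 + real M * of_int a - s1 - j))) * lat_kernel \<kappa> \<tau> z (j + s1 + real M * of_int a, \<epsilon> + s2 + of_int b))
     = lat_sum \<kappa> (half_coeff M \<kappa> j k \<epsilon> s1 s2) \<tau> z"
proof -
  define g where "g = (\<lambda>(a::int, b::int). (j + s1 + real M * of_int a, \<epsilon> + s2 + of_int b))"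
  define S where "S = range g"
  have bij: "bij_betw g UNIV S" unfolding S_def using M by (intro inj_on_imp_bij_betw) (auto simp: inj_on_def g_def)
  have sub: "S \<subseteq> quarter_lattice"
  proof
    fix x assume "x \<in> S"
    then obtain a b where x: "x = (j + s1 + real M * of_int a, \<epsilon> + s2 + of_int b)" by (auto simp: S_def g_def)
    have "4 * (j + s1 + real M * of_int a) = 4 * (j + s1) + of_int (4 * int M * a)" "4 * (\<epsilon> + s2 + of_int b) = 4 * (\<epsilon> + s2) + of_int (4 * b)"
      by simp_all
    thus "x \<in> quarter_lattice" unfolding x quarter_lattice_def using P Q by (simp only: mem_Collect_eq case_prod_conv Ints_add Ints_of_int)
  qed
  have S: "x \<in> S \<longleftrightarrow> (\<exists>a::int. fst x = j + s1 + real M * of_int a) \<and> (\<exists>b::int. snd x = \<epsilon> + s2 + of_int b)" for x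
    by (cases x) (auto simp: S_def g_def image_iff)
  have "lat_sum \<kappa> (half_coeff M \<kappa> j k \<epsilon> s1 s2) \<tau> z = (\<Sum>\<^sub>\<infinity>x\<in>S. half_coeff M \<kappa> j k \<epsilon> s1 s2 x * lat_kernel \<kappa> \<tau> z x)"
    unfolding lat_sum_def by (rule infsum_cong_neutral) (use sub S in \<open>auto simp: half_coeff_def case_prod_unfold\<close>)
  also have "\<dots> = (\<Sum>\<^sub>\<infinity>x. half_coeff M \<kappa> j k \<epsilon> s1 s2 (g x) * lat_kernel \<kappa> \<tau> z (g x))"
    by (rule infsum_reindex_bij_betw[OF bij, symmetric])
  also have "\<dots> = (\<Sum>\<^sub>\<infinity>(a::int, b::int). ee (\<kappa> * ((s1 * (\<epsilon> + s2 + of_int b) - s2 * (j + s1 + real M * of_int a)) - k * (\<epsilon> + s2 + of_int b - s2)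
        + \<epsilon> * (j + s1 + real M * of_int a - s1 - j))) * lat_kernel \<kappa> \<tau> z (j + s1 + real M * of_int a, \<epsilon> + s2 + of_int b))"
    by (rule infsum_cong) (auto simp: g_def half_coeff_def)
  finally show ?thesis by simp
qed

definition f_const :: "real \<Rightarrow> real \<Rightarrow> real \<Rightarrow> complex" where
  "f_const \<kappa> \<sigma> \<sigma>' = - ee (\<kappa> * \<sigma> * \<sigma>' / 4) / (2 * of_real pi * \<i>)"

lemma f_const_nonzero: "f_const \<kappa> \<sigma> \<sigma>' \<noteq> 0" by (simp add: f_const_def)

theorem f_fun_eq_lat_sum:
  assumes dom: "(\<tau>, z) \<in> fdom" and M: "M > 0" and n: "n > 0"
    and half: "2 * \<epsilon> \<in> \<int>" "2 * \<sigma> \<in> \<int>" "2 * \<sigma>' \<in> \<int>" "2 * j \<in> \<int>" "2 * k \<in> \<int>"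
  shows "f_fun M n \<epsilon> \<sigma> \<sigma>' j k \<tau> z =
    f_const (real n / real M) \<sigma> \<sigma>' * lat_sum (real n / real M) (f_coeff M (real n / real M) \<epsilon> (\<sigma>' / 2) (\<sigma> / 2) j k) \<tau> z"
proof -
  define \<kappa> where "\<kappa> = real n / real M"
  have \<kappa>: "\<kappa> > 0" using M n by (simp add: \<kappa>_def)
  have \<tau>: "Im \<tau> > 0" by (rule fdom_Im[OF dom])
  define pre where "pre = (\<lambda>j k (z1::complex) (z2::complex). qpow \<tau> (- (real n / (4 * real M)) * \<sigma>'\<^sup>2) * (qpow \<tau> (real n * j * k / real M)
      * exp (2 * of_real pi * \<i> * of_nat n / of_nat M * (of_real k * z1 + of_real j * z2))))"
  \<comment> \<open>Stated for arbitrary indices, since it is used twice: for z1, z2 as they stand,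
    and with j, k exchanged and both \<sigma>, \<sigma>' negated, which exchanges z1 and z2.\<close>
  have part: "(\<forall>a b :: int. w1 + of_int a * (of_nat M * \<tau>) + of_int b \<noteq> 0) \<and>
     pre j k z1 z2 * appell_sum n (of_nat M * \<tau>) w1 w2 = ee (\<kappa> * \<sigma> * \<sigma>' / 4) * lat_sum \<kappa> (half_coeff M \<kappa> j k \<epsilon> (\<sigma>' / 2) (\<sigma> / 2)) \<tau> z"
    if h: "2 * \<sigma> \<in> \<int>" "2 * \<sigma>' \<in> \<int>" "2 * j \<in> \<int>" "2 * k \<in> \<int>"
      and z1: "z1 = (z + of_real \<sigma> + of_real \<sigma>' * \<tau>) / 2" and z2: "z2 = (z - of_real \<sigma> - of_real \<sigma>' * \<tau>) / 2"
      and w1: "w1 = z1 + of_real j * \<tau> + of_real \<epsilon>" and w2: "w2 = z2 + of_real k * \<tau> + of_real \<epsilon>"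
      and pre: "pre = (\<lambda>j k (z1::complex) (z2::complex). qpow \<tau> (- (real n / (4 * real M)) * \<sigma>'\<^sup>2) * (qpow \<tau> (real n * j * k / real M)
      * exp (2 * of_real pi * \<i> * of_nat n / of_nat M * (of_real k * z1 + of_real j * z2))))"
    for j k \<sigma> \<sigma>' z1 z2 w1 w2 pre
  proof (intro conjI allI)
    have P4: "4 * (j + \<sigma>' / 2) \<in> \<int>" and Q4: "4 * (\<epsilon> + \<sigma> / 2) \<in> \<int>"
    proof -
      have "4 * (j + \<sigma>' / 2) = 2 * j + 2 * j + 2 * \<sigma>'" "4 * (\<epsilon> + \<sigma> / 2) = 2 * \<epsilon> + 2 * \<epsilon> + 2 * \<sigma>" by simp_all
      thus "4 * (j + \<sigma>' / 2) \<in> \<int>" "4 * (\<epsilon> + \<sigma> / 2) \<in> \<int>" using h half by (simp_all only: Ints_add)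
    qed
    show "w1 + of_int a * (of_nat M * \<tau>) + of_int b \<noteq> 0" for a b
    proof -
      have "4 * (j + \<sigma>' / 2 + real M * of_int a) = 4 * (j + \<sigma>' / 2) + of_int (4 * int M * a)" "4 * (\<epsilon> + \<sigma> / 2 + of_int b) = 4 * (\<epsilon> + \<sigma> / 2) + of_int (4 * b)"
        by simp_all
      hence "4 * (j + \<sigma>' / 2 + real M * of_int a) \<in> \<int>" "4 * (\<epsilon> + \<sigma> / 2 + of_int b) \<in> \<int>" using P4 Q4 by (simp_all only: Ints_add Ints_of_int)
      note ne = fdom_nonzero[OF dom this]
      have eq: "w1 + of_int a * (of_nat M * \<tau>) + of_int b = z / 2 + (of_real (j + \<sigma>' / 2 + real M * of_int a) * \<tau> + of_real (\<epsilon> + \<sigma> / 2 + of_int b))"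
        unfolding w1 z1 by (simp add: field_simps)
      show ?thesis unfolding eq by (rule ne)
    qed
    have "pre j k z1 z2 * appell_sum n (of_nat M * \<tau>) w1 w2 = (\<Sum>\<^sub>\<infinity>x. ee (\<kappa> * \<sigma> * \<sigma>' / 4) * (\<lambda>(a::int, b::int). ee (\<kappa> * ((\<sigma>' / 2 * (\<epsilon> + \<sigma> / 2 + of_int b) - \<sigma> / 2 * (j + \<sigma>' / 2 + real M * of_int a)) - k * (\<epsilon> + \<sigma> / 2 + of_int b - \<sigma> / 2)
        + \<epsilon> * (j + \<sigma>' / 2 + real M * of_int a - \<sigma>' / 2 - j))) * lat_kernel \<kappa> \<tau> z (j + \<sigma>' / 2 + real M * of_int a, \<epsilon> + \<sigma> / 2 + of_int b)) x)"
      unfolding appell_sum_def infsum_cmult_right'[symmetric]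
    proof (rule infsum_cong)
      fix x :: "int \<times> int"
      obtain a b where x: "x = (a, b)" by (cases x)
      show "pre j k z1 z2 * (case x of (a, b) \<Rightarrow> appell_term n (of_nat M * \<tau>) w1 w2 a b) = ee (\<kappa> * \<sigma> * \<sigma>' / 4) * (\<lambda>(a::int, b::int). ee (\<kappa> * ((\<sigma>' / 2 * (\<epsilon> + \<sigma> / 2 + of_int b) - \<sigma> / 2 * (j + \<sigma>' / 2 + real M * of_int a)) - k * (\<epsilon> + \<sigma> / 2 + of_int b - \<sigma> / 2)
        + \<epsilon> * (j + \<sigma>' / 2 + real M * of_int a - \<sigma>' / 2 - j))) * lat_kernel \<kappa> \<tau> z (j + \<sigma>' / 2 + real M * of_int a, \<epsilon> + \<sigma> / 2 + of_int b)) x"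
        unfolding x prod.case w1 w2 z1 z2 \<kappa>_def pre by (rule f_term_identity[OF M \<tau>])
    qed
    thus "pre j k z1 z2 * appell_sum n (of_nat M * \<tau>) w1 w2 = ee (\<kappa> * \<sigma> * \<sigma>' / 4) * lat_sum \<kappa> (half_coeff M \<kappa> j k \<epsilon> (\<sigma>' / 2) (\<sigma> / 2)) \<tau> z"
      unfolding infsum_cmult_right' half_sum[OF M P4 Q4] .
  qed
  define z1 z2 where "z1 = (z + of_real \<sigma> + of_real \<sigma>' * \<tau>) / 2" and "z2 = (z - of_real \<sigma> - of_real \<sigma>' * \<tau>) / 2"
  define w1 w2 where "w1 = z1 + of_real j * \<tau> + of_real \<epsilon>" and "w2 = z2 + of_real k * \<tau> + of_real \<epsilon>"
  have p1: "(\<forall>a b :: int. w1 + of_int a * (of_nat M * \<tau>) + of_int b \<noteq> 0) \<and>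
     pre j k z1 z2 * appell_sum n (of_nat M * \<tau>) w1 w2 = ee (\<kappa> * \<sigma> * \<sigma>' / 4) * lat_sum \<kappa> (half_coeff M \<kappa> j k \<epsilon> (\<sigma>' / 2) (\<sigma> / 2)) \<tau> z"
    by (rule part[OF half(2-5)]) (simp_all add: z1_def z2_def w1_def w2_def pre_def)
  have p2: "(\<forall>a b :: int. w2 + of_int a * (of_nat M * \<tau>) + of_int b \<noteq> 0) \<and>
     pre k j z2 z1 * appell_sum n (of_nat M * \<tau>) w2 w1 = ee (\<kappa> * (- \<sigma>) * (- \<sigma>') / 4) * lat_sum \<kappa> (half_coeff M \<kappa> k j \<epsilon> (- \<sigma>' / 2) (- \<sigma> / 2)) \<tau> z"
    by (rule part) (use half in \<open>simp_all add: z1_def z2_def w1_def w2_def pre_def\<close>)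
  have pre_sym: "pre k j z2 z1 = pre j k z1 z2" by (simp add: pre_def mult_ac add_ac)
  have \<tau>M: "Im (of_nat M * \<tau>) > 0" using \<tau> M by simp
  have "f_fun M n \<epsilon> \<sigma> \<sigma>' j k \<tau> z = pre j k z1 z2 * Phi_mod n 0 (of_nat M * \<tau>) w1 w2"
    unfolding f_fun_def Psi_mod_def pre_def z1_def z2_def w1_def w2_def by (simp only: mult.assoc)
  also have "\<dots> = - (pre j k z1 z2 * appell_sum n (of_nat M * \<tau>) w1 w2 + pre k j z2 z1 * appell_sum n (of_nat M * \<tau>) w2 w1) / (2 * of_real pi * \<i>)"
    unfolding pre_sym by (subst Phi_mod_eq_appell[OF \<tau>M n]) (use p1 p2 in \<open>auto simp: field_simps\<close>)
  also have "\<dots> = f_const \<kappa> \<sigma> \<sigma>' * lat_sum \<kappa> (f_coeff M \<kappa> \<epsilon> (\<sigma>' / 2) (\<sigma> / 2) j k) \<tau> z"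
    unfolding f_coeff_def lat_sum_add[OF dom \<kappa> bounded_half_coeff bounded_half_coeff] p1[THEN conjunct2] p2[THEN conjunct2] f_const_def
    by (simp add: field_simps)
  finally show ?thesis unfolding \<kappa>_def .
qed

section \<open>The modular action on lattice sums\<close>

text \<open>For the transformed parameter \<tau>' one has (P \<tau>' + Q)(c \<tau> + d) = (a P + c
  Q) \<tau> + (b P + d Q); these are the new coordinates of p.\<close>

definition act :: "int \<Rightarrow> int \<Rightarrow> int \<Rightarrow> int \<Rightarrow> real \<times> real \<Rightarrow> real \<times> real" where
  "act a b c d = (\<lambda>(P, Q). (of_int a * P + of_int c * Q, of_int b * P + of_int d * Q))"

lemma act_inverse:
  assumes "a * d - b * c = 1"
  shows "act a b c d (act d (- b) (- c) a x) = x" "act d (- b) (- c) a (act a b c d x) = x"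
proof -
  have e: "of_int a * of_int d - of_int b * of_int c = (1::real)" using assms by (metis of_int_1 of_int_diff of_int_mult)
  obtain P Q where x: "x = (P, Q)" by (cases x)
  have "of_int a * (of_int d * P - of_int c * Q) + of_int c * (of_int a * Q - of_int b * P) = (of_int a * of_int d - of_int b * of_int c) * P"
       "of_int b * (of_int d * P - of_int c * Q) + of_int d * (of_int a * Q - of_int b * P) = (of_int a * of_int d - of_int b * of_int c) * Q"
       "of_int d * (of_int a * P + of_int c * Q) - of_int c * (of_int b * P + of_int d * Q) = (of_int a * of_int d - of_int b * of_int c) * P"
       "of_int a * (of_int b * P + of_int d * Q) - of_int b * (of_int a * P + of_int c * Q) = (of_int a * of_int d - of_int b * of_int c) * Q"
    by (simp_all add: algebra_simps)
  thus "act a b c d (act d (- b) (- c) a x) = x" "act d (- b) (- c) a (act a b c d x) = x"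
    unfolding e x act_def by simp_all
qed

lemma act_quarter_lattice: "x \<in> quarter_lattice \<Longrightarrow> act a b c d x \<in> quarter_lattice"
proof (cases x)
  fix P Q assume x: "x = (P, Q)" and "x \<in> quarter_lattice"
  hence "4 * P \<in> \<int>" "4 * Q \<in> \<int>" by (auto simp: quarter_lattice_def)
  hence "of_int a * (4 * P) + of_int c * (4 * Q) \<in> \<int>" "of_int b * (4 * P) + of_int d * (4 * Q) \<in> \<int>" by auto
  thus ?thesis by (simp add: x act_def quarter_lattice_def algebra_simps)
qed

lemma bij_act:
  assumes "a * d - b * c = 1"
  shows "bij_betw (act a b c d) quarter_lattice quarter_lattice"
  by (rule bij_betwI[where g = "act d (- b) (- c) a"]) (auto simp: act_inverse[OF assms] act_quarter_lattice)

lemma denominator_nonzero: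
  assumes "a * d - b * c = (1::int)" "Im \<tau> > 0"
  shows "of_int c * \<tau> + of_int d \<noteq> (0::complex)"
proof
  assume e: "of_int c * \<tau> + of_int d = 0"
  hence "of_int c * Im \<tau> = 0" by (simp add: complex_eq_iff)
  hence "c = 0" using assms(2) by simp
  hence "d = 0" using e by simp
  thus False using assms(1) \<open>c = 0\<close> by simp
qed

lemma Im_moebius:
  assumes "a * d - b * c = (1::int)" "Im \<tau> > 0"
  shows "Im ((of_int a * \<tau> + of_int b) / (of_int c * \<tau> + of_int d)) = Im \<tau> / (norm (of_int c * \<tau> + of_int d))\<^sup>2"
proof -
  have e: "of_int a * of_int d - of_int b * of_int c = (1::real)" using assms by (metis of_int_1 of_int_diff of_int_mult)
  have "Im ((of_int a * \<tau> + of_int b) * cnj (of_int c * \<tau> + of_int d)) = (of_int a * of_int d - of_int b * of_int c) * Im \<tau>"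
    by (simp add: algebra_simps)
  thus ?thesis unfolding e by (simp add: complex_div_cnj[of "of_int a * \<tau> + of_int b"] Im_divide_of_real flip: of_real_power)
qed

lemma fdom_moebius:
  assumes g: "a * d - b * c = (1::int)" and dom: "(\<tau>, z) \<in> fdom"
  shows "((of_int a * \<tau> + of_int b) / (of_int c * \<tau> + of_int d), z / (of_int c * \<tau> + of_int d)) \<in> fdom"
proof -
  define D where "D = of_int c * \<tau> + of_int d"
  have D: "D \<noteq> 0" unfolding D_def by (rule denominator_nonzero[OF g fdom_Im[OF dom]])
  have "Im ((of_int a * \<tau> + of_int b) / D) > 0"
    unfolding D_def Im_moebius[OF g fdom_Im[OF dom]] using fdom_Im[OF dom] D by (simp add: D_def)
  moreover have "z / D \<noteq> (of_int u + of_int v * ((of_int a * \<tau> + of_int b) / D)) / 2" for u v :: int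
  proof
    assume "z / D = (of_int u + of_int v * ((of_int a * \<tau> + of_int b) / D)) / 2"
    hence "z = (of_int u * D + of_int v * (of_int a * \<tau> + of_int b)) / 2" using D by (simp add: field_simps)
    also have "\<dots> = (of_int (u * d + v * b) + of_int (u * c + v * a) * \<tau>) / 2" by (simp add: D_def algebra_simps)
    finally show False using dom unfolding fdom_def by blast
  qed
  ultimately show ?thesis unfolding D_def[symmetric] fdom_def by blast
qed

text \<open>Dividing z and p by D = c \<tau> + d pulls D out of the denominator, which is the weight
  one. In the exponent Im \<tau> is divided by |D|^2, which makes the terms with p p* and p* z
  invariant, whereas z^2/4 acquires the factor D*/D. Since \<open>U\<close> times D - D* is 2 pi i
  \<kappa> c, the exponential factor of \<open>slash\<close> repairs exactly this when C + 1/2 = 3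
  \<kappa> / 2.\<close>

lemma lat_kernel_moebius:
  fixes \<tau> z :: complex
  assumes g: "a * d - b * c = (1::int)" and dom: "(\<tau>, z) \<in> fdom"
  defines "D \<equiv> of_int c * \<tau> + of_int d"
  shows "inverse D * exp (- (of_real pi * \<i> * of_real (3 * \<kappa> / 2) * of_int c * z\<^sup>2) / (3 * D))
     * lat_kernel \<kappa> ((of_int a * \<tau> + of_int b) / D) (z / D) x = lat_kernel \<kappa> \<tau> z (act a b c d x)"
proof -
  obtain P Q where x: "x = (P, Q)" by (cases x)
  have \<tau>: "Im \<tau> > 0" by (rule fdom_Im[OF dom])
  have D: "D \<noteq> 0" unfolding D_def by (rule denominator_nonzero[OF g \<tau>])
  define p where "p = of_real (of_int a * P + of_int c * Q) * \<tau> + of_real (of_int b * P + of_int d * Q)"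
  have p: "of_real P * ((of_int a * \<tau> + of_int b) / D) + of_real Q = p / D"
    using D by (simp add: p_def D_def field_simps)
  define U where "U = complex_of_real (pi * \<kappa> / Im \<tau>)"
  have Y: "complex_of_real (pi * \<kappa> / Im ((of_int a * \<tau> + of_int b) / D)) = U * (D * cnj D)"
  proof -
    have "pi * \<kappa> / (Im \<tau> / (norm D)\<^sup>2) = (pi * \<kappa> / Im \<tau>) * (norm D)\<^sup>2" by simp
    thus ?thesis unfolding Im_moebius[OF g \<tau>, folded D_def] U_def complex_norm_square[symmetric] by (simp only: of_real_mult)
  qed
  have DD: "U * (D - cnj D) = 2 * of_real pi * \<i> * of_real \<kappa> * of_int c"
  proof -
    have "D - cnj D = 2 * \<i> * of_real (of_int c * Im \<tau>)" by (simp add: D_def complex_eq_iff)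
    hence e: "U * (D - cnj D) = U * (2 * \<i> * of_real (of_int c * Im \<tau>))" by (simp only:)
    show ?thesis unfolding e using \<tau> by (simp add: U_def field_simps)
  qed
  have E: "- (of_real pi * \<i> * of_real (3 * \<kappa> / 2) * of_int c * z\<^sup>2) / (3 * D) + - (U * (D * cnj D)) * (p / D * cnj (p / D) + cnj (p / D) * (z / D) + (z / D)\<^sup>2 / 4)
     = - U * (p * cnj p + cnj p * z + z\<^sup>2 / 4)"
  proof -
    have c0: "cnj D \<noteq> 0" using D by simp
    have h1: "- (of_real pi * \<i> * of_real (3 * \<kappa> / 2) * of_int c * z\<^sup>2) / (3 * D) = - (U * (D - cnj D)) * z\<^sup>2 / (4 * D)"
      unfolding DD by (simp add: field_simps)
    have h2: "- (U * (D * cnj D)) * (p / D * cnj (p / D) + cnj (p / D) * (z / D) + (z / D)\<^sup>2 / 4) = - (U * (p * cnj p + cnj p * z + z\<^sup>2 * cnj D / (4 * D)))"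
      unfolding complex_cnj_divide using D c0 by (simp add: field_simps power2_eq_square)
    have k: "- A / (4 * D) = - (A / (4 * D))" for A by simp
    have k2: "(U * (D - cnj D)) * z\<^sup>2 / (4 * D) = U * ((D - cnj D) * z\<^sup>2 / (4 * D))" by simp
    have "(D - cnj D) * z\<^sup>2 / (4 * D) = z\<^sup>2 / 4 - z\<^sup>2 * cnj D / (4 * D)"
      using D by (simp add: field_simps)
    hence "- (U * (D - cnj D)) * z\<^sup>2 / (4 * D) + - (U * (p * cnj p + cnj p * z + z\<^sup>2 * cnj D / (4 * D)))
      = - (U * (z\<^sup>2 / 4 - z\<^sup>2 * cnj D / (4 * D))) + - (U * (p * cnj p + cnj p * z + z\<^sup>2 * cnj D / (4 * D)))"
      unfolding mult_minus_left k k2 by (simp only:)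
    also have "\<dots> = - U * (p * cnj p + cnj p * z + z\<^sup>2 / 4)" by (simp add: algebra_simps)
    finally have "- (U * (D - cnj D)) * z\<^sup>2 / (4 * D) + - (U * (p * cnj p + cnj p * z + z\<^sup>2 * cnj D / (4 * D))) = - U * (p * cnj p + cnj p * z + z\<^sup>2 / 4)" .
    thus ?thesis unfolding h1 h2 .
  qed
  have dn: "inverse D * (A / (z / D / 2 + p / D)) = A / (z / 2 + p)" for A
  proof -
    have "z / D / 2 + p / D = (z / 2 + p) / D" using D by (simp add: field_simps)
    thus ?thesis using D by (simp add: field_simps)
  qed
  have "inverse D * exp (- (of_real pi * \<i> * of_real (3 * \<kappa> / 2) * of_int c * z\<^sup>2) / (3 * D))
     * lat_kernel \<kappa> ((of_int a * \<tau> + of_int b) / D) (z / D) x =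
     inverse D * ((exp (- (of_real pi * \<i> * of_real (3 * \<kappa> / 2) * of_int c * z\<^sup>2) / (3 * D)) *
       exp (- (U * (D * cnj D)) * (p / D * cnj (p / D) + cnj (p / D) * (z / D) + (z / D)\<^sup>2 / 4))) / (z / D / 2 + p / D))"
    unfolding lat_kernel_def Let_def x fst_conv snd_conv p Y by (simp only: mult.assoc times_divide_eq_right)
  also have "\<dots> = lat_kernel \<kappa> \<tau> z (act a b c d x)"
    unfolding dn exp_add[symmetric] E unfolding lat_kernel_def Let_def x act_def prod.case fst_conv snd_conv p_def[symmetric] U_def by simp
  finally show ?thesis .
qed

theorem slash_lat_sum:
  assumes g: "a * d - b * c = (1::int)" and C: "C + 1/2 = 3 * \<kappa> / 2"
  shows "slash C a b c d (on_dom (lat_sum \<kappa> u)) = on_dom (lat_sum \<kappa> (\<lambda>x. u (act d (- b) (- c) a x)))"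
proof (intro ext)
  fix \<tau> z
  show "slash C a b c d (on_dom (lat_sum \<kappa> u)) \<tau> z = on_dom (lat_sum \<kappa> (\<lambda>x. u (act d (- b) (- c) a x))) \<tau> z"
  proof (cases "(\<tau>, z) \<in> fdom")
    case False thus ?thesis by (simp add: slash_def on_dom_def)
  next
    case dom: True
    define D where "D = of_int c * \<tau> + of_int d"
    define A where "A = inverse D * exp (- (of_real pi * \<i> * of_real (3 * \<kappa> / 2) * of_int c * z\<^sup>2) / (3 * D))"
    have "slash C a b c d (on_dom (lat_sum \<kappa> u)) \<tau> z = A * lat_sum \<kappa> u ((of_int a * \<tau> + of_int b) / D) (z / D)"
      using dom fdom_moebius[OF g dom] unfolding slash_def on_dom_def A_def D_def C by simp
    also have "\<dots> = (\<Sum>\<^sub>\<infinity>x\<in>quarter_lattice. u x * (A * lat_kernel \<kappa> ((of_int a * \<tau> + of_int b) / D) (z / D) x))"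
      unfolding lat_sum_def infsum_cmult_right'[symmetric] by (simp only: mult.left_commute)
    also have "\<dots> = (\<Sum>\<^sub>\<infinity>x\<in>quarter_lattice. (\<lambda>y. u (act d (- b) (- c) a y) * lat_kernel \<kappa> \<tau> z y) (act a b c d x))"
      unfolding A_def D_def lat_kernel_moebius[OF g dom] act_inverse[OF g] ..
    also have "\<dots> = lat_sum \<kappa> (\<lambda>x. u (act d (- b) (- c) a x)) \<tau> z"
      unfolding lat_sum_def by (rule infsum_reindex_bij_betw[OF bij_act[OF g]])
    finally show ?thesis using dom by (simp add: on_dom_def)
  qed
qed

section \<open>The coefficient functions\<close>

definition symplectic :: "real \<times> real \<Rightarrow> real \<times> real \<Rightarrow> real" where
  "symplectic x y = fst x * snd y - snd x * fst y"

definition Lat :: "real \<Rightarrow> (real \<times> real) set" where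
  "Lat m = {(m * of_int a, m * of_int b) | a b :: int. True}"

definition half_lattice :: "(real \<times> real) set" where
  "half_lattice = {(P, Q). 2 * P \<in> \<int> \<and> 2 * Q \<in> \<int>}"

text \<open>The Fourier transform in k of \<open>f_coeff\<close>. Both supports are cosets of a full
  lattice, M Z^2 around s + y and Z^2 around y - s, and the phases use \<open>symplectic\<close>
  alone, so \<open>act\<close> just moves the parameters y and s. The factor M in the first summand
  is the value of a nonvanishing character sum.\<close>

definition g_coeff :: "nat \<Rightarrow> real \<Rightarrow> real \<times> real \<Rightarrow> real \<times> real \<Rightarrow> real \<times> real \<Rightarrow> complex" where
  "g_coeff M \<kappa> y s x =
     (if x - s - y \<in> Lat (real M) then of_nat M * ee (\<kappa> * (symplectic x y - symplectic s y - symplectic x s)) else 0)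
     + (if x + s - y \<in> Lat 1 then ee (\<kappa> * (symplectic x y + symplectic s y + symplectic x s)) else 0)"

lemma bounded_g_coeff: "bounded_coeff (g_coeff M \<kappa> y s)"
  unfolding bounded_coeff_def
proof (intro exI[of _ "real M + 1"] allI)
  fix x
  have "norm (if x - s - y \<in> Lat (real M) then of_nat M * ee (\<kappa> * (symplectic x y - symplectic s y - symplectic x s)) else 0) \<le> real M"
    by (simp add: norm_mult)
  moreover have "norm (if x + s - y \<in> Lat 1 then ee (\<kappa> * (symplectic x y + symplectic s y + symplectic x s)) else 0) \<le> 1" by simp
  ultimately show "norm (g_coeff M \<kappa> y s x) \<le> real M + 1" unfolding g_coeff_def by (intro norm_triangle_le) linarith
qed

lemma act_add: "act a b c d (x + y) = act a b c d x + act a b c d y"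
  and act_diff: "act a b c d (x - y) = act a b c d x - act a b c d y"
  by (cases x; cases y; simp add: act_def algebra_simps)+

lemma symplectic_act:
  assumes "a * d - b * c = (1::int)"
  shows "symplectic (act a b c d x) (act a b c d y) = symplectic x y"
proof -
  have e: "of_int a * of_int d - of_int b * of_int c = (1::real)" using assms by (metis of_int_1 of_int_diff of_int_mult)
  obtain P Q R S where xy: "x = (P, Q)" "y = (R, S)" by (cases x; cases y)
  have "symplectic (act a b c d x) (act a b c d y) = (of_int a * of_int d - of_int b * of_int c) * symplectic x y"
    by (simp add: xy symplectic_def act_def algebra_simps)
  thus ?thesis unfolding e by simp
qed

lemma act_Lat: "x \<in> Lat m \<Longrightarrow> act a b c d x \<in> Lat m"
proof -
  assume "x \<in> Lat m"
  then obtain u v where x: "x = (m * of_int u, m * of_int v)" by (auto simp: Lat_def)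
  have "act a b c d x = (m * of_int (a * u + c * v), m * of_int (b * u + d * v))"
    by (simp add: x act_def algebra_simps)
  thus ?thesis unfolding Lat_def by blast
qed

lemma act_Lat_iff:
  assumes "a * d - b * c = (1::int)"
  shows "act a b c d x \<in> Lat m \<longleftrightarrow> x \<in> Lat m"
  using act_Lat[of x m a b c d] act_Lat[of "act a b c d x" m d "-b" "-c" a] by (auto simp: act_inverse[OF assms])

lemma act_half_lattice: "x \<in> half_lattice \<Longrightarrow> act a b c d x \<in> half_lattice"
proof (cases x)
  fix P Q assume x: "x = (P, Q)" and "x \<in> half_lattice"
  hence "2 * P \<in> \<int>" "2 * Q \<in> \<int>" by (auto simp: half_lattice_def)
  hence "of_int a * (2 * P) + of_int c * (2 * Q) \<in> \<int>" "of_int b * (2 * P) + of_int d * (2 * Q) \<in> \<int>" by auto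
  thus ?thesis by (simp add: x act_def half_lattice_def algebra_simps)
qed

lemma g_coeff_act:
  assumes g: "a * d - b * c = (1::int)"
  shows "g_coeff M \<kappa> y s (act d (- b) (- c) a x) = g_coeff M \<kappa> (act a b c d y) (act a b c d s) x"
proof -
  define x' where "x' = act d (- b) (- c) a x"
  have x: "x = act a b c d x'" by (simp add: x'_def act_inverse[OF g])
  show ?thesis unfolding x'_def[symmetric] unfolding x g_coeff_def act_add[symmetric] act_diff[symmetric]
    by (simp only: act_Lat_iff[OF g] symplectic_act[OF g])
qed

lemma Lat_1_shift:
  assumes "v \<in> Lat 1" shows "x + v \<in> Lat 1 \<longleftrightarrow> x \<in> Lat 1"
proof -
  obtain a b where v: "v = (of_int a, of_int b)" using assms by (auto simp: Lat_def)
  have Lat1: "(P, Q) \<in> Lat 1 \<longleftrightarrow> P \<in> \<int> \<and> Q \<in> \<int>" for P Q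
    by (auto simp: Lat_def elim!: Ints_cases)
  have i: "(P + of_int m \<in> \<int>) = (P \<in> \<int>)" for P :: real and m
    using Ints_add[of P "of_int m"] Ints_diff[of "P + of_int m" "of_int m"] by auto
  show ?thesis by (cases x) (simp add: v Lat1 i)
qed

text \<open>A half-integral part of s can be moved into y. In the first summand the phases then
  differ by n times an integer, because \<kappa> M = n and 2 t is integral; in the second the
  support is unchanged because 2 t lies in Z^2. This allows s to be reduced to (\<sigma>'/2,
  \<sigma>/2).\<close>

lemma g_coeff_shift:
  fixes M n :: nat
  assumes M: "M > 0" and t: "t \<in> half_lattice"
  defines "\<kappa> \<equiv> real n / real M"
  shows "g_coeff M \<kappa> y (s + t) x = ee (- \<kappa> * (symplectic y t + symplectic s t)) * g_coeff M \<kappa> (y + t) s x"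
proof -
  obtain t1 t2 where t12: "t = (t1, t2)" by (cases t)
  obtain T1 T2 where T: "2 * t1 = of_int T1" "2 * t2 = of_int T2" using t by (auto simp: half_lattice_def t12 elim!: Ints_cases)
  have \<kappa>M: "\<kappa> * real M = real n" using M by (simp add: \<kappa>_def)
  have 1: "x - (s + t) - y = x - s - (y + t)" by (simp add: algebra_simps)
  have "t + t \<in> Lat 1" unfolding t12 Lat_def using T by (auto intro!: exI[of _ T1] exI[of _ T2])
  from Lat_1_shift[OF this, of "x + s - (y + t)"]
  have 2: "x + (s + t) - y \<in> Lat 1 \<longleftrightarrow> x + s - (y + t) \<in> Lat 1" by (simp add: algebra_simps)
  have 3: "ee (\<kappa> * (symplectic x y - symplectic (s + t) y - symplectic x (s + t))) = ee (- \<kappa> * (symplectic y t + symplectic s t)) * ee (\<kappa> * (symplectic x (y + t) - symplectic s (y + t) - symplectic x s))"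
    if h: "x - s - (y + t) \<in> Lat (real M)"
  proof -
    obtain a b :: int where "x - s - (y + t) = (real M * of_int a, real M * of_int b)" using h by (auto simp: Lat_def)
    hence x: "x = s + (y + t) + (real M * of_int a, real M * of_int b)" by (simp add: algebra_simps)
    have "\<kappa> * (symplectic x y - symplectic (s + t) y - symplectic x (s + t)) - (- \<kappa> * (symplectic y t + symplectic s t) + \<kappa> * (symplectic x (y + t) - symplectic s (y + t) - symplectic x s))
      = - (\<kappa> * real M) * (of_int a * (2 * t2) - of_int b * (2 * t1))"
      unfolding x by (cases y; cases s) (simp add: symplectic_def t12 algebra_simps)
    also have "\<dots> = of_int (- int n * (a * T2 - b * T1))" unfolding \<kappa>M T by simp
    finally show ?thesis unfolding ee_add[symmetric] by (intro ee_eqI) (simp only: Ints_of_int)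
  qed
  have 4: "ee (\<kappa> * (symplectic x y + symplectic (s + t) y + symplectic x (s + t))) = ee (- \<kappa> * (symplectic y t + symplectic s t)) * ee (\<kappa> * (symplectic x (y + t) + symplectic s (y + t) + symplectic x s))"
    unfolding ee_add[symmetric] by (rule arg_cong[where f = ee]) (simp add: symplectic_def algebra_simps)
  show ?thesis unfolding g_coeff_def 1 2 4 using 3 by (simp add: distrib_left)
qed

text \<open>Orthogonality of characters. Coprimality makes \<open>ee (n * m / M)\<close> an M-th
  root of unity different from 1 unless M divides m.\<close>

lemma sum_ee_residues:
  fixes M n :: nat and m :: int
  assumes M: "M > 0" and cop: "coprime n M"
  shows "(\<Sum>i<M. ee (real n / real M * (real i * of_int m))) = (if int M dvd m then of_nat M else 0)"
proof (cases "int M dvd m")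
  case True
  then obtain q where q: "m = int M * q" by (elim dvdE)
  have "ee (real n / real M * (real i * of_int m)) = 1" for i
  proof (rule ee_Ints)
    have "real n / real M * (real i * of_int m) = of_int (int n * int i * q)" using M by (simp add: q)
    thus "real n / real M * (real i * of_int m) \<in> \<int>" by (simp only: Ints_of_int)
  qed
  thus ?thesis using True by simp
next
  case False
  define z where "z = ee (real n / real M * of_int m)"
  have zi: "ee (real n / real M * (real i * of_int m)) = z ^ i" for i
    unfolding z_def ee_def Complex.DeMoivre by (simp add: mult_ac)
  have "z \<noteq> 1"
  proof
    assume "z = 1"
    hence "complex_of_real (real n / real M * of_int m) \<in> \<int>"
      unfolding z_def ee_conv_exp by (subst (asm) exp_2pi_eq_1_iff)
    then obtain q :: int where "complex_of_real (real n / real M * of_int m) = of_int q" by (auto elim: Ints_cases)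
    hence "complex_of_real (real n / real M * of_int m) = complex_of_real (of_int q)" by (simp only: of_real_of_int_eq)
    hence "real n / real M * of_int m = of_int q" by (rule of_real_eq_iff[THEN iffD1])
    hence "real n * of_int m = real M * of_int q" using M by (simp add: field_simps)
    hence "of_int (int n * m) = (of_int (int M * q) :: real)" by simp
    hence "int n * m = int M * q" by (simp only: of_int_eq_iff)
    hence "int M dvd int n * m" by simp
    moreover have "coprime (int M) (int n)" using cop by (simp add: coprime_commute)
    ultimately have "int M dvd m" by (simp add: coprime_dvd_mult_right_iff)
    thus False using False by simp
  qed
  moreover have "z ^ M = 1"
  proof -
    have "z ^ M = ee (real n / real M * (real M * of_int m))" by (rule zi[symmetric])
    also have "real n / real M * (real M * of_int m) = of_int (int n * m)" using M by simp
    finally show ?thesis by (simp only: ee_Ints Ints_of_int)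
  qed
  ultimately have "(\<Sum>i<M. z ^ i) = 0" using geometric_sum[of z M] by simp
  thus ?thesis using False by (simp only: zi if_False)
qed

lemma sum_residue_unique:
  fixes N :: int and h :: "nat \<Rightarrow> complex"
  assumes M: "M > 0"
  shows "(\<Sum>i<M. if \<exists>a. N = int i + int M * a then h i else 0) = h (nat (N mod int M))"
proof -
  have "(\<exists>a. N = int i + int M * a) \<longleftrightarrow> i = nat (N mod int M)" if "i < M" for i
  proof
    assume "\<exists>a. N = int i + int M * a"
    then obtain a where "N = int i + int M * a" by blast
    hence "N mod int M = int i" using that by simp
    thus "i = nat (N mod int M)" by simp
  next
    assume "i = nat (N mod int M)"
    hence "int i = N mod int M" using M by simp
    hence "N = int i + int M * (N div int M)" using mod_mult_div_eq[of N "int M"] by simp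
    thus "\<exists>a. N = int i + int M * a" by blast
  qed
  hence "(\<Sum>i<M. if \<exists>a. N = int i + int M * a then h i else 0) = (\<Sum>i<M. if i = nat (N mod int M) then h i else 0)"
    by (intro sum.cong refl) auto
  also have "\<dots> = h (nat (N mod int M))" using M by (simp add: nat_less_iff)
  finally show ?thesis .
qed

lemma in_Lat_iff: "(P, Q) \<in> Lat m \<longleftrightarrow> (\<exists>a::int. P = m * of_int a) \<and> (\<exists>b::int. Q = m * of_int b)"
  by (auto simp: Lat_def)

lemma real_eq_int_iff: "real_of_int N = real i + real M * real_of_int a \<longleftrightarrow> N = int i + int M * a"
proof -
  have "real_of_int N = real i + real M * real_of_int a \<longleftrightarrow> real_of_int N = real_of_int (int i + int M * a)" by simp
  thus ?thesis by (simp only: of_int_eq_iff)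
qed

text \<open>Since \<open>n\<close> and \<open>M\<close> are coprime, a finite Fourier transform in the index \<open>k\<close> passes between the
  coefficients of the functions \<open>f\<close> and the coefficients \<open>g_coeff\<close>, which are permuted by the modular group.\<close>

lemma g_coeff_eq_sum:
  fixes M n :: nat and j0 \<beta>0 :: int and \<epsilon> \<epsilon>' :: real
  assumes M: "M > 0" and cop: "coprime n M"
  defines "\<kappa> \<equiv> real n / real M" and "j \<equiv> \<epsilon>' + of_int j0" and "\<beta> \<equiv> \<epsilon> + of_int \<beta>0"
  shows "g_coeff M \<kappa> (j, \<beta>) (s1, s2) x = (\<Sum>i<M. ee (\<kappa> * (\<epsilon>' + real i) * \<beta>) * f_coeff M \<kappa> \<epsilon> s1 s2 j (\<epsilon>' + real i) x)"
proof -
  obtain P Q where x: "x = (P, Q)" by (cases x)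
  have \<kappa>M: "\<kappa> * real M = real n" using M by (simp add: \<kappa>_def)
  \<comment> \<open>In this half k enters only through the phase -\<kappa> k (Q - s2). As Q - s2 -
    \<beta> is an integer -m on the support, the weighted sum over k is a character sum and forces M
    to divide m: Q becomes M-sparse like P.\<close>
  have t1: "(\<Sum>i<M. ee (\<kappa> * (\<epsilon>' + real i) * \<beta>) * half_coeff M \<kappa> j (\<epsilon>' + real i) \<epsilon> s1 s2 x) =
    (if x - (s1, s2) - (j, \<beta>) \<in> Lat (real M) then of_nat M * ee (\<kappa> * (symplectic x (j, \<beta>) - symplectic (s1, s2) (j, \<beta>) - symplectic x (s1, s2))) else 0)"
  proof (cases "(\<exists>a::int. P = j + s1 + real M * of_int a) \<and> (\<exists>b::int. Q = \<epsilon> + s2 + of_int b)")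
    case False
    have "x - (s1, s2) - (j, \<beta>) \<notin> Lat (real M)"
    proof
      assume "x - (s1, s2) - (j, \<beta>) \<in> Lat (real M)"
      then obtain a b :: int where "P - s1 - j = real M * of_int a" "Q - s2 - \<beta> = real M * of_int b" by (auto simp: x in_Lat_iff)
      hence "P = j + s1 + real M * of_int a" "Q = \<epsilon> + s2 + of_int (\<beta>0 + int M * b)" by (auto simp: \<beta>_def)
      thus False using False by blast
    qed
    moreover have "half_coeff M \<kappa> j k \<epsilon> s1 s2 x = 0" for k using False by (auto simp: half_coeff_def x)
    ultimately show ?thesis by simp
  next
    case True
    then obtain a b :: int where ab: "P = j + s1 + real M * of_int a" "Q = \<epsilon> + s2 + of_int b" by blast
    define m where "m = \<beta>0 - b"
    define A where "A = \<kappa> * (s1 * Q - s2 * P) + \<kappa> * \<epsilon> * (P - s1 - j) + \<kappa> * \<epsilon>' * of_int m"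
    have "ee (\<kappa> * (\<epsilon>' + real i) * \<beta>) * half_coeff M \<kappa> j (\<epsilon>' + real i) \<epsilon> s1 s2 x = ee A * ee (\<kappa> * (real i * of_int m))" for i
    proof -
      have "half_coeff M \<kappa> j (\<epsilon>' + real i) \<epsilon> s1 s2 x = ee (\<kappa> * ((s1 * Q - s2 * P) - (\<epsilon>' + real i) * (Q - s2) + \<epsilon> * (P - s1 - j)))"
        using True by (simp add: half_coeff_def x)
      thus ?thesis unfolding ee_add[symmetric] A_def m_def \<beta>_def ab(2)
        by (simp only: ee_add[symmetric]) (rule arg_cong[where f = ee], simp add: algebra_simps)
    qed
    hence "(\<Sum>i<M. ee (\<kappa> * (\<epsilon>' + real i) * \<beta>) * half_coeff M \<kappa> j (\<epsilon>' + real i) \<epsilon> s1 s2 x) = ee A * (if int M dvd m then of_nat M else 0)"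
      unfolding \<kappa>_def by (simp only: sum_distrib_left[symmetric] sum_ee_residues[OF M cop])
    moreover have "x - (s1, s2) - (j, \<beta>) \<in> Lat (real M) \<longleftrightarrow> int M dvd m"
    proof
      assume "x - (s1, s2) - (j, \<beta>) \<in> Lat (real M)"
      then obtain b' :: int where "Q - s2 - \<beta> = real M * of_int b'" by (auto simp: x in_Lat_iff)
      hence "of_int (- m) = (of_int (int M * b') :: real)" by (simp add: ab \<beta>_def m_def)
      hence "- m = int M * b'" by (simp only: of_int_eq_iff)
      thus "int M dvd m" by (metis dvd_minus_iff dvd_triv_left)
    next
      assume "int M dvd m"
      then obtain q where q: "m = int M * q" by (elim dvdE)
      have "P - s1 - j = real M * of_int a" by (simp add: ab)
      moreover have "b = \<beta>0 - int M * q" using q by (simp add: m_def)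
      hence "Q - s2 - \<beta> = real M * of_int (- q)" by (simp add: ab \<beta>_def)
      ultimately have "(P - s1 - j, Q - s2 - \<beta>) \<in> Lat (real M)" unfolding in_Lat_iff by blast
      thus "x - (s1, s2) - (j, \<beta>) \<in> Lat (real M)" by (simp add: x)
    qed
    moreover have "ee A = ee (\<kappa> * (symplectic x (j, \<beta>) - symplectic (s1, s2) (j, \<beta>) - symplectic x (s1, s2)))" if "int M dvd m"
    proof (rule ee_eqI)
      obtain q where q: "m = int M * q" using \<open>int M dvd m\<close> by (elim dvdE)
      from arg_cong[OF this[unfolded m_def], of real_of_int]
      have b: "of_int b = \<beta> - \<epsilon> - real M * of_int q" by (simp add: \<beta>_def)
      have "A - \<kappa> * (symplectic x (j, \<beta>) - symplectic (s1, s2) (j, \<beta>) - symplectic x (s1, s2)) = (\<kappa> * real M) * ((\<epsilon> - \<beta>) * of_int a + (\<epsilon>' - j) * of_int q)"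
        unfolding A_def symplectic_def x ab b q by (simp add: algebra_simps)
      also have "\<dots> = of_int (int n * (- \<beta>0 * a - j0 * q))" unfolding \<kappa>M by (simp add: \<beta>_def j_def)
      finally show "A - \<kappa> * (symplectic x (j, \<beta>) - symplectic (s1, s2) (j, \<beta>) - symplectic x (s1, s2)) \<in> \<int>" by (simp only: Ints_of_int)
    qed
    ultimately show ?thesis by simp
  qed
  \<comment> \<open>In this half k is tied to P modulo M, so exactly one summand survives at each
    point of the larger support and P is no longer restricted modulo M. The phases fit together
    because \<kappa> M = n.\<close>
  have t2: "(\<Sum>i<M. ee (\<kappa> * (\<epsilon>' + real i) * \<beta>) * half_coeff M \<kappa> (\<epsilon>' + real i) j \<epsilon> (- s1) (- s2) x) =
    (if x + (s1, s2) - (j, \<beta>) \<in> Lat 1 then ee (\<kappa> * (symplectic x (j, \<beta>) + symplectic (s1, s2) (j, \<beta>) + symplectic x (s1, s2))) else 0)"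
  proof (cases "(\<exists>N::int. P = \<epsilon>' - s1 + of_int N) \<and> (\<exists>b::int. Q = \<epsilon> - s2 + of_int b)")
    case False
    have "x + (s1, s2) - (j, \<beta>) \<notin> Lat 1"
    proof
      assume "x + (s1, s2) - (j, \<beta>) \<in> Lat 1"
      then obtain a b :: int where "P + s1 - j = of_int a" "Q + s2 - \<beta> = of_int b" by (auto simp: x in_Lat_iff)
      hence "P = \<epsilon>' - s1 + of_int (j0 + a)" "Q = \<epsilon> - s2 + of_int (\<beta>0 + b)" by (auto simp: \<beta>_def j_def)
      thus False using False by blast
    qed
    moreover have "half_coeff M \<kappa> (\<epsilon>' + real i) j \<epsilon> (- s1) (- s2) x = 0" for i
    proof -
      have "\<not> ((\<exists>a::int. P = \<epsilon>' + real i + - s1 + real M * of_int a) \<and> (\<exists>b::int. Q = \<epsilon> + - s2 + of_int b))"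
      proof
        assume "(\<exists>a::int. P = \<epsilon>' + real i + - s1 + real M * of_int a) \<and> (\<exists>b::int. Q = \<epsilon> + - s2 + of_int b)"
        then obtain a b :: int where "P = \<epsilon>' + real i + - s1 + real M * of_int a" "Q = \<epsilon> + - s2 + of_int b" by blast
        hence "P = \<epsilon>' - s1 + of_int (int i + int M * a)" "Q = \<epsilon> - s2 + of_int b" by simp_all
        thus False using False by blast
      qed
      thus ?thesis by (simp only: half_coeff_def x prod.case if_False)
    qed
    ultimately show ?thesis by simp
  next
    case True
    then obtain N b :: int where Nb: "P = \<epsilon>' - s1 + of_int N" "Q = \<epsilon> - s2 + of_int b" by blast
    define G where "G = ee (\<kappa> * (symplectic x (j, \<beta>) + symplectic (s1, s2) (j, \<beta>) + symplectic x (s1, s2)))"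
    have "ee (\<kappa> * (\<epsilon>' + real i) * \<beta>) * half_coeff M \<kappa> (\<epsilon>' + real i) j \<epsilon> (- s1) (- s2) x = (if \<exists>a. N = int i + int M * a then G else 0)" for i
    proof -
      have cond: "(\<exists>a::int. P = \<epsilon>' + real i + - s1 + real M * of_int a) \<longleftrightarrow> (\<exists>a. N = int i + int M * a)"
        unfolding Nb real_eq_int_iff[symmetric] by auto
      have condQ: "\<exists>b::int. Q = \<epsilon> + - s2 + of_int b" using Nb by auto
      show ?thesis
      proof (cases "\<exists>a. N = int i + int M * a")
        case False
        thus ?thesis unfolding half_coeff_def x prod.case cond by simp
      next
        case T: True
        then obtain a where a: "N = int i + int M * a" by blast
        have "ee (\<kappa> * (\<epsilon>' + real i) * \<beta>) * half_coeff M \<kappa> (\<epsilon>' + real i) j \<epsilon> (- s1) (- s2) x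
          = ee (\<kappa> * (\<epsilon>' + real i) * \<beta> + \<kappa> * ((- s1 * Q - (- s2) * P) - j * (Q - (- s2)) + \<epsilon> * (P - (- s1) - (\<epsilon>' + real i))))"
          unfolding half_coeff_def x prod.case cond ee_add using T condQ by simp
        also have "\<dots> = G" unfolding G_def
        proof (rule ee_eqI)
          have iN: "real i = of_int N - real M * of_int a" using a by simp
          have "\<kappa> * (\<epsilon>' + real i) * \<beta> + \<kappa> * ((- s1 * Q - (- s2) * P) - j * (Q - (- s2)) + \<epsilon> * (P - (- s1) - (\<epsilon>' + real i))) -
             \<kappa> * (symplectic x (j, \<beta>) + symplectic (s1, s2) (j, \<beta>) + symplectic x (s1, s2)) = (\<kappa> * real M) * (of_int a * (\<epsilon> - \<beta>))"
            unfolding iN symplectic_def x Nb by (simp add: algebra_simps)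
          also have "\<dots> = of_int (- int n * a * \<beta>0)" unfolding \<kappa>M by (simp add: \<beta>_def)
          finally show "\<kappa> * (\<epsilon>' + real i) * \<beta> + \<kappa> * ((- s1 * Q - (- s2) * P) - j * (Q - (- s2)) + \<epsilon> * (P - (- s1) - (\<epsilon>' + real i))) -
             \<kappa> * (symplectic x (j, \<beta>) + symplectic (s1, s2) (j, \<beta>) + symplectic x (s1, s2)) \<in> \<int>" by (simp only: Ints_of_int)
        qed
        finally show ?thesis using T by simp
      qed
    qed
    hence "(\<Sum>i<M. ee (\<kappa> * (\<epsilon>' + real i) * \<beta>) * half_coeff M \<kappa> (\<epsilon>' + real i) j \<epsilon> (- s1) (- s2) x) = G"
      by (simp only: sum_residue_unique[OF M])
    moreover have "x + (s1, s2) - (j, \<beta>) \<in> Lat 1"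
    proof -
      have "x + (s1, s2) - (j, \<beta>) = (1 * of_int (N - j0), 1 * of_int (b - \<beta>0))" by (simp add: x Nb j_def \<beta>_def)
      thus ?thesis unfolding Lat_def by blast
    qed
    ultimately show ?thesis by (simp add: G_def)
  qed
  show ?thesis unfolding g_coeff_def t1[symmetric] t2[symmetric] sum.distrib[symmetric] f_coeff_def
    by (intro sum.cong refl) (rule distrib_left[symmetric])
qed

text \<open>The inverse transform, with the roles exchanged. In the first half the support fixes the
  residue of the second component of y, and one summand survives; in the second half every summand
  is present and the character sum restores the restriction of P modulo M. Either way a factor M
  appears.\<close>

lemma f_coeff_eq_sum:
  fixes M n :: nat and k0 :: int and \<epsilon> j :: real
  assumes M: "M > 0" and cop: "coprime n M"
  defines "\<kappa> \<equiv> real n / real M" and "k \<equiv> j + of_int k0"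
  shows "of_nat M * f_coeff M \<kappa> \<epsilon> s1 s2 j k x = (\<Sum>i<M. ee (- \<kappa> * k * (\<epsilon> + real i)) * g_coeff M \<kappa> (j, \<epsilon> + real i) (s1, s2) x)"
proof -
  obtain P Q where x: "x = (P, Q)" by (cases x)
  have \<kappa>M: "\<kappa> * real M = real n" using M by (simp add: \<kappa>_def)
  have t1: "(\<Sum>i<M. ee (- \<kappa> * k * (\<epsilon> + real i)) * (if x - (s1, s2) - (j, \<epsilon> + real i) \<in> Lat (real M) then of_nat M * ee (\<kappa> * (symplectic x (j, \<epsilon> + real i) - symplectic (s1, s2) (j, \<epsilon> + real i) - symplectic x (s1, s2))) else 0))
    = of_nat M * half_coeff M \<kappa> j k \<epsilon> s1 s2 x"
  proof (cases "(\<exists>a::int. P = j + s1 + real M * of_int a) \<and> (\<exists>b::int. Q = \<epsilon> + s2 + of_int b)")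
    case False
    have "x - (s1, s2) - (j, \<epsilon> + real i) \<notin> Lat (real M)" for i
    proof
      assume "x - (s1, s2) - (j, \<epsilon> + real i) \<in> Lat (real M)"
      then obtain a b :: int where "P - s1 - j = real M * of_int a" "Q - s2 - (\<epsilon> + real i) = real M * of_int b" by (auto simp: x in_Lat_iff)
      hence "P = j + s1 + real M * of_int a" "Q = \<epsilon> + s2 + of_int (int i + int M * b)" by auto
      thus False using False by blast
    qed
    moreover have "half_coeff M \<kappa> j k \<epsilon> s1 s2 x = 0" using False by (auto simp: half_coeff_def x)
    ultimately show ?thesis by simp
  next
    case True
    then obtain a N :: int where ab: "P = j + s1 + real M * of_int a" "Q = \<epsilon> + s2 + of_int N" by blast
    have h: "half_coeff M \<kappa> j k \<epsilon> s1 s2 x = ee (\<kappa> * ((s1 * Q - s2 * P) - k * (Q - s2) + \<epsilon> * (P - s1 - j)))"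
      using True by (simp add: half_coeff_def x)
    have "ee (- \<kappa> * k * (\<epsilon> + real i)) * (if x - (s1, s2) - (j, \<epsilon> + real i) \<in> Lat (real M) then of_nat M * ee (\<kappa> * (symplectic x (j, \<epsilon> + real i) - symplectic (s1, s2) (j, \<epsilon> + real i) - symplectic x (s1, s2))) else 0)
      = (if \<exists>b. N = int i + int M * b then of_nat M * half_coeff M \<kappa> j k \<epsilon> s1 s2 x else 0)" for i
    proof -
      have cond: "x - (s1, s2) - (j, \<epsilon> + real i) \<in> Lat (real M) \<longleftrightarrow> (\<exists>b. N = int i + int M * b)"
        unfolding real_eq_int_iff[symmetric] by (auto simp: x in_Lat_iff ab algebra_simps)
      show ?thesis
      proof (cases "\<exists>b. N = int i + int M * b")
        case False thus ?thesis unfolding cond by simp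
      next
        case T: True
        then obtain b where b: "N = int i + int M * b" by blast
        hence iN: "real i = of_int N - real M * of_int b" by simp
        have "ee (- \<kappa> * k * (\<epsilon> + real i)) * ee (\<kappa> * (symplectic x (j, \<epsilon> + real i) - symplectic (s1, s2) (j, \<epsilon> + real i) - symplectic x (s1, s2))) = half_coeff M \<kappa> j k \<epsilon> s1 s2 x"
          unfolding h ee_add[symmetric]
        proof (rule ee_eqI)
          have "- \<kappa> * k * (\<epsilon> + real i) + \<kappa> * (symplectic x (j, \<epsilon> + real i) - symplectic (s1, s2) (j, \<epsilon> + real i) - symplectic x (s1, s2)) -
             \<kappa> * ((s1 * Q - s2 * P) - k * (Q - s2) + \<epsilon> * (P - s1 - j)) = (\<kappa> * real M) * (of_int b * (k - j) + of_int a * of_int (int i))"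
            unfolding symplectic_def x ab iN by (simp add: algebra_simps iN)
          also have "\<dots> = of_int (int n * (b * k0 + a * int i))" unfolding \<kappa>M by (simp add: k_def)
          finally show "- \<kappa> * k * (\<epsilon> + real i) + \<kappa> * (symplectic x (j, \<epsilon> + real i) - symplectic (s1, s2) (j, \<epsilon> + real i) - symplectic x (s1, s2)) -
             \<kappa> * ((s1 * Q - s2 * P) - k * (Q - s2) + \<epsilon> * (P - s1 - j)) \<in> \<int>" by (simp only: Ints_of_int)
        qed
        thus ?thesis unfolding cond using T by (simp add: mult.left_commute)
      qed
    qed
    thus ?thesis by (simp only: sum_residue_unique[OF M])
  qed
  have t2: "(\<Sum>i<M. ee (- \<kappa> * k * (\<epsilon> + real i)) * (if x + (s1, s2) - (j, \<epsilon> + real i) \<in> Lat 1 then ee (\<kappa> * (symplectic x (j, \<epsilon> + real i) + symplectic (s1, s2) (j, \<epsilon> + real i) + symplectic x (s1, s2))) else 0))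
    = of_nat M * half_coeff M \<kappa> k j \<epsilon> (- s1) (- s2) x"
  proof (cases "(\<exists>N::int. P = k - s1 + of_int N) \<and> (\<exists>b::int. Q = \<epsilon> - s2 + of_int b)")
    case False
    have "x + (s1, s2) - (j, \<epsilon> + real i) \<notin> Lat 1" for i
    proof
      assume "x + (s1, s2) - (j, \<epsilon> + real i) \<in> Lat 1"
      then obtain a b :: int where "P + s1 - j = of_int a" "Q + s2 - (\<epsilon> + real i) = of_int b" by (auto simp: x in_Lat_iff)
      hence "P = k - s1 + of_int (a - k0)" "Q = \<epsilon> - s2 + of_int (int i + b)" by (auto simp: k_def)
      thus False using False by blast
    qed
    moreover have "half_coeff M \<kappa> k j \<epsilon> (- s1) (- s2) x = 0"
    proof -
      have "\<not> ((\<exists>a::int. P = k + - s1 + real M * of_int a) \<and> (\<exists>b::int. Q = \<epsilon> + - s2 + of_int b))"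
      proof
        assume "(\<exists>a::int. P = k + - s1 + real M * of_int a) \<and> (\<exists>b::int. Q = \<epsilon> + - s2 + of_int b)"
        then obtain a b :: int where "P = k - s1 + of_int (int M * a)" "Q = \<epsilon> - s2 + of_int b" by auto
        thus False using False by blast
      qed
      thus ?thesis by (simp only: half_coeff_def x prod.case if_False)
    qed
    ultimately show ?thesis by simp
  next
    case True
    then obtain N b :: int where Nb: "P = k - s1 + of_int N" "Q = \<epsilon> - s2 + of_int b" by blast
    define A where "A = \<kappa> * (of_int N * \<epsilon> - j * (Q + s2) + (P * s2 - Q * s1))"
    have L: "x + (s1, s2) - (j, \<epsilon> + real i) \<in> Lat 1" for i
    proof -
      have "x + (s1, s2) - (j, \<epsilon> + real i) = (1 * of_int (N + k0), 1 * of_int (b - int i))" by (simp add: x Nb k_def)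
      thus ?thesis unfolding Lat_def by blast
    qed
    have "ee (- \<kappa> * k * (\<epsilon> + real i)) * ee (\<kappa> * (symplectic x (j, \<epsilon> + real i) + symplectic (s1, s2) (j, \<epsilon> + real i) + symplectic x (s1, s2))) = ee A * ee (\<kappa> * (real i * of_int N))" for i
      unfolding ee_add[symmetric] A_def by (rule arg_cong[where f = ee]) (simp add: symplectic_def x Nb algebra_simps)
    hence "(\<Sum>i<M. ee (- \<kappa> * k * (\<epsilon> + real i)) * (if x + (s1, s2) - (j, \<epsilon> + real i) \<in> Lat 1 then ee (\<kappa> * (symplectic x (j, \<epsilon> + real i) + symplectic (s1, s2) (j, \<epsilon> + real i) + symplectic x (s1, s2))) else 0))
       = ee A * (if int M dvd N then of_nat M else 0)"
      using L unfolding \<kappa>_def by (simp only: if_True sum_distrib_left[symmetric] sum_ee_residues[OF M cop])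
    moreover have cond: "(\<exists>a::int. P = k + - s1 + real M * of_int a) \<longleftrightarrow> int M dvd N"
    proof -
      have "(of_int N = real M * of_int a) = (N = int M * a)" for a using real_eq_int_iff[of N 0 M a] by simp
      thus ?thesis unfolding Nb by (auto simp: dvd_def)
    qed
    moreover have condQ: "\<exists>b::int. Q = \<epsilon> + - s2 + of_int b" using Nb by auto
    have "half_coeff M \<kappa> k j \<epsilon> (- s1) (- s2) x = (if int M dvd N then ee A else 0)"
    proof -
      have "\<kappa> * ((- s1 * Q - (- s2) * P) - j * (Q - (- s2)) + \<epsilon> * (P - (- s1) - k)) = A"
        by (simp add: A_def Nb algebra_simps)
      thus ?thesis unfolding half_coeff_def x prod.case cond using condQ by (simp only: simp_thms)
    qed
    ultimately show ?thesis by simp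
  qed
  have "(\<Sum>i<M. ee (- \<kappa> * k * (\<epsilon> + real i)) * g_coeff M \<kappa> (j, \<epsilon> + real i) (s1, s2) x) =
    of_nat M * half_coeff M \<kappa> j k \<epsilon> s1 s2 x + of_nat M * half_coeff M \<kappa> k j \<epsilon> (- s1) (- s2) x"
    unfolding t1[symmetric] t2[symmetric] sum.distrib[symmetric] g_coeff_def
    by (intro sum.cong refl) (rule distrib_left)
  thus ?thesis unfolding f_coeff_def by (simp only: distrib_left)
qed

section \<open>Quasi-periodicity of the coefficients and the symmetry in j and k\<close>

text \<open>Multiples of M in j do not change the support, and \<kappa> M = n makes the change of
  phase an integer up to the constant -n \<epsilon> (a + b). That constant is symmetric in a and b,
  so both halves of \<open>f_coeff\<close> acquire the same factor.\<close>

lemma half_coeff_shift: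
  fixes M n :: nat
  assumes M: "M > 0"
  defines "\<kappa> \<equiv> real n / real M"
  shows "half_coeff M \<kappa> (j + real M * of_int a) (k + real M * of_int b) \<epsilon> s1 s2 x =
    ee (- (real n * \<epsilon> * of_int (a + b))) * half_coeff M \<kappa> j k \<epsilon> s1 s2 x"
proof -
  obtain P Q where x: "x = (P, Q)" by (cases x)
  have \<kappa>M: "\<kappa> * real M = real n" using M by (simp add: \<kappa>_def)
  have c: "(\<exists>u::int. P = j + real M * of_int a + s1 + real M * of_int u) \<longleftrightarrow> (\<exists>u::int. P = j + s1 + real M * of_int u)"
  proof
    assume "\<exists>u::int. P = j + real M * of_int a + s1 + real M * of_int u"
    then obtain u :: int where "P = j + real M * of_int a + s1 + real M * of_int u" by blast
    hence "P = j + s1 + real M * of_int (a + u)" by (simp add: algebra_simps)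
    thus "\<exists>u::int. P = j + s1 + real M * of_int u" by blast
  next
    assume "\<exists>u::int. P = j + s1 + real M * of_int u"
    then obtain u :: int where "P = j + s1 + real M * of_int u" by blast
    hence "P = j + real M * of_int a + s1 + real M * of_int (u - a)" by (simp add: algebra_simps)
    thus "\<exists>u::int. P = j + real M * of_int a + s1 + real M * of_int u" by blast
  qed
  show ?thesis
  proof (cases "(\<exists>u::int. P = j + s1 + real M * of_int u) \<and> (\<exists>v::int. Q = \<epsilon> + s2 + of_int v)")
    case True
    then obtain u v :: int where uv: "P = j + s1 + real M * of_int u" "Q = \<epsilon> + s2 + of_int v" by blast
    have "ee (\<kappa> * ((s1 * Q - s2 * P) - (k + real M * of_int b) * (Q - s2) + \<epsilon> * (P - s1 - (j + real M * of_int a)))) =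
       ee (- (real n * \<epsilon> * of_int (a + b)) + \<kappa> * ((s1 * Q - s2 * P) - k * (Q - s2) + \<epsilon> * (P - s1 - j)))"
    proof (rule ee_eqI)
      have "\<kappa> * ((s1 * Q - s2 * P) - (k + real M * of_int b) * (Q - s2) + \<epsilon> * (P - s1 - (j + real M * of_int a))) -
        (- (real n * \<epsilon> * of_int (a + b)) + \<kappa> * ((s1 * Q - s2 * P) - k * (Q - s2) + \<epsilon> * (P - s1 - j))) =
        of_int (- int n * (b * v))"
        unfolding uv \<kappa>M[symmetric] of_int_mult of_int_minus of_int_of_nat_eq by (simp add: algebra_simps)
      thus "\<kappa> * ((s1 * Q - s2 * P) - (k + real M * of_int b) * (Q - s2) + \<epsilon> * (P - s1 - (j + real M * of_int a))) -
        (- (real n * \<epsilon> * of_int (a + b)) + \<kappa> * ((s1 * Q - s2 * P) - k * (Q - s2) + \<epsilon> * (P - s1 - j))) \<in> \<int>"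
        by (simp only: Ints_of_int)
    qed
    thus ?thesis unfolding half_coeff_def x prod.case c ee_add using True by simp
  next
    case False
    thus ?thesis unfolding half_coeff_def x prod.case c by auto
  qed
qed

lemma f_coeff_shift:
  fixes M n :: nat
  assumes M: "M > 0"
  defines "\<kappa> \<equiv> real n / real M"
  shows "f_coeff M \<kappa> \<epsilon> s1 s2 (j + real M * of_int a) (k + real M * of_int b) x =
    ee (- (real n * \<epsilon> * of_int (a + b))) * f_coeff M \<kappa> \<epsilon> s1 s2 j k x"
  unfolding f_coeff_def \<kappa>_def half_coeff_shift[OF M] by (simp add: distrib_left add.commute)

lemma half_coeff_eps:
  fixes M n :: nat
  assumes M: "M > 0"
  defines "\<kappa> \<equiv> real n / real M"
  shows "half_coeff M \<kappa> j k (\<epsilon> + of_int m) s1 s2 x = half_coeff M \<kappa> j k \<epsilon> s1 s2 x"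
proof -
  obtain P Q where x: "x = (P, Q)" by (cases x)
  have \<kappa>M: "\<kappa> * real M = real n" using M by (simp add: \<kappa>_def)
  have c: "(\<exists>v::int. Q = \<epsilon> + of_int m + s2 + of_int v) \<longleftrightarrow> (\<exists>v::int. Q = \<epsilon> + s2 + of_int v)"
  proof
    assume "\<exists>v::int. Q = \<epsilon> + of_int m + s2 + of_int v"
    then obtain v :: int where "Q = \<epsilon> + of_int m + s2 + of_int v" by blast
    hence "Q = \<epsilon> + s2 + of_int (m + v)" by simp
    thus "\<exists>v::int. Q = \<epsilon> + s2 + of_int v" by blast
  next
    assume "\<exists>v::int. Q = \<epsilon> + s2 + of_int v"
    then obtain v :: int where "Q = \<epsilon> + s2 + of_int v" by blast
    hence "Q = \<epsilon> + of_int m + s2 + of_int (v - m)" by simp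
    thus "\<exists>v::int. Q = \<epsilon> + of_int m + s2 + of_int v" by blast
  qed
  show ?thesis
  proof (cases "(\<exists>u::int. P = j + s1 + real M * of_int u)")
    case True
    then obtain u :: int where u: "P = j + s1 + real M * of_int u" by blast
    have "ee (\<kappa> * ((s1 * Q - s2 * P) - k * (Q - s2) + (\<epsilon> + of_int m) * (P - s1 - j))) = ee (\<kappa> * ((s1 * Q - s2 * P) - k * (Q - s2) + \<epsilon> * (P - s1 - j)))"
    proof (rule ee_eqI)
      have "\<kappa> * ((s1 * Q - s2 * P) - k * (Q - s2) + (\<epsilon> + of_int m) * (P - s1 - j)) - \<kappa> * ((s1 * Q - s2 * P) - k * (Q - s2) + \<epsilon> * (P - s1 - j)) = (\<kappa> * real M) * (of_int m * of_int u)"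
        unfolding u by (simp add: algebra_simps)
      also have "\<dots> = of_int (int n * (m * u))" unfolding \<kappa>M by simp
      finally show "\<kappa> * ((s1 * Q - s2 * P) - k * (Q - s2) + (\<epsilon> + of_int m) * (P - s1 - j)) - \<kappa> * ((s1 * Q - s2 * P) - k * (Q - s2) + \<epsilon> * (P - s1 - j)) \<in> \<int>"
        by (simp only: Ints_of_int)
    qed
    thus ?thesis unfolding half_coeff_def x prod.case c by simp
  next
    case False thus ?thesis unfolding half_coeff_def x prod.case c by simp
  qed
qed

lemma f_coeff_eps:
  assumes M: "M > 0"
  shows "f_coeff M (real n / real M) (\<epsilon> + of_int m) s1 s2 j k x = f_coeff M (real n / real M) \<epsilon> s1 s2 j k x"
  unfolding f_coeff_def half_coeff_eps[OF M] ..

text \<open>The substitution is found by matching supports: (k - 2 s1) + s1 = k - s1, and \<epsilon>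
  + 3 s2 agrees with \<epsilon> - s2 modulo 1 because 4 s2 is an integer. It thus turns one half of
  \<open>f_coeff\<close> into the other.\<close>

lemma half_coeff_swap:
  fixes M n :: nat
  assumes M: "M > 0" and s: "4 * s2 = of_int m"
  defines "\<kappa> \<equiv> real n / real M"
  shows "half_coeff M \<kappa> (k - 2 * s1) (j + 2 * s1) (\<epsilon> + 2 * s2) s1 s2 x =
    ee (\<kappa> * (2 * s2 * (j - k) + 4 * s1 * s2)) * half_coeff M \<kappa> k j \<epsilon> (- s1) (- s2) x"
proof -
  obtain P Q where x: "x = (P, Q)" by (cases x)
  have cP: "(\<exists>u::int. P = k - 2 * s1 + s1 + real M * of_int u) \<longleftrightarrow> (\<exists>u::int. P = k + - s1 + real M * of_int u)" by simp
  have cQ: "(\<exists>v::int. Q = \<epsilon> + 2 * s2 + s2 + of_int v) \<longleftrightarrow> (\<exists>v::int. Q = \<epsilon> + - s2 + of_int v)"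
  proof
    assume "\<exists>v::int. Q = \<epsilon> + 2 * s2 + s2 + of_int v"
    then obtain v :: int where "Q = \<epsilon> + 2 * s2 + s2 + of_int v" by blast
    hence "Q = \<epsilon> + - s2 + of_int (m + v)" using s by simp
    thus "\<exists>v::int. Q = \<epsilon> + - s2 + of_int v" by blast
  next
    assume "\<exists>v::int. Q = \<epsilon> + - s2 + of_int v"
    then obtain v :: int where "Q = \<epsilon> + - s2 + of_int v" by blast
    hence "Q = \<epsilon> + 2 * s2 + s2 + of_int (v - m)" using s by simp
    thus "\<exists>v::int. Q = \<epsilon> + 2 * s2 + s2 + of_int v" by blast
  qed
  have "\<kappa> * ((s1 * Q - s2 * P) - (j + 2 * s1) * (Q - s2) + (\<epsilon> + 2 * s2) * (P - s1 - (k - 2 * s1))) =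
    \<kappa> * (2 * s2 * (j - k) + 4 * s1 * s2) + \<kappa> * ((- s1 * Q - (- s2) * P) - j * (Q - (- s2)) + \<epsilon> * (P - (- s1) - k))"
    by (simp add: algebra_simps)
  thus ?thesis unfolding half_coeff_def x prod.case cP cQ by (simp add: ee_add)
qed

lemma f_coeff_swap:
  fixes M n :: nat
  assumes M: "M > 0" and s: "4 * s2 = of_int m"
  defines "\<kappa> \<equiv> real n / real M"
  shows "f_coeff M \<kappa> (\<epsilon> + 2 * s2) s1 s2 (k - 2 * s1) (j + 2 * s1) x =
    ee (\<kappa> * (2 * s2 * (j - k) + 4 * s1 * s2)) * f_coeff M \<kappa> \<epsilon> s1 s2 j k x"
proof -
  have s': "4 * (- s2) = of_int (- m)" using s by simp
  \<comment> \<open>For the remaining half \<open>half_coeff_swap\<close> is used with s1 and s2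
    negated. It then asks for \<epsilon> - 2 s2, which differs from \<epsilon> + 2 s2 by the integer
    4 s2.\<close>
  have e: "\<epsilon> + 2 * s2 = (\<epsilon> + 2 * (- s2)) + of_int m" using s by simp
  have "half_coeff M \<kappa> (j + 2 * s1) (k - 2 * s1) (\<epsilon> + 2 * s2) (- s1) (- s2) x = half_coeff M \<kappa> (j - 2 * (- s1)) (k + 2 * (- s1)) (\<epsilon> + 2 * (- s2)) (- s1) (- s2) x"
    unfolding e \<kappa>_def half_coeff_eps[OF M] by simp
  also have "\<dots> = ee (\<kappa> * (2 * (- s2) * (k - j) + 4 * (- s1) * (- s2))) * half_coeff M \<kappa> j k \<epsilon> (- (- s1)) (- (- s2)) x"
    unfolding \<kappa>_def by (rule half_coeff_swap[OF M s'])
  also have "\<kappa> * (2 * (- s2) * (k - j) + 4 * (- s1) * (- s2)) = \<kappa> * (2 * s2 * (j - k) + 4 * s1 * s2)" by (simp add: algebra_simps)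
  finally show ?thesis unfolding f_coeff_def \<kappa>_def half_coeff_swap[OF M s] by (simp add: distrib_left add.commute)
qed

section \<open>Zeros of the denominators\<close>

text \<open>Gaussian binomial coefficients through a Pascal recursion. This form is free of division
  and makes the q-binomial theorem an induction; \<open>qbin_closed\<close> supplies the product
  formula needed for the limit.\<close>

fun qbin :: "complex \<Rightarrow> nat \<Rightarrow> nat \<Rightarrow> complex" where
  "qbin q n 0 = 1"
| "qbin q 0 (Suc i) = 0"
| "qbin q (Suc n) (Suc i) = q ^ (n - i) * qbin q n i + qbin q n (Suc i)"

lemma qbin_eq_0: "n < i \<Longrightarrow> qbin q n i = 0"
  by (induction q n i rule: qbin.induct) auto

lemma triangle_Suc: "Suc i * (Suc i - 1) div 2 = i * (i - 1) div 2 + i"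
proof -
  have "Suc i * (Suc i - 1) = i * (i - 1) + 2 * i" by (cases i) (auto simp: algebra_simps)
  thus ?thesis by simp
qed

lemma qbinomial:
  "(\<Prod>k<n. 1 + x * q ^ k) = (\<Sum>i\<le>n. q ^ (i * (i - 1) div 2) * qbin q n i * x ^ i)"
proof (induction n)
  case (Suc n)
  define T where "T n i = q ^ (i * (i - 1) div 2) * qbin q n i * x ^ i" for n i
  have step: "T (Suc n) (Suc i) = x * q ^ n * T n i + T n (Suc i)" if "i \<le> n" for i
  proof -
    have "q ^ i * q ^ (n - i) = q ^ n" using that by (simp add: power_add[symmetric])
    hence "q ^ (i * (i - 1) div 2 + i) * (q ^ (n - i) * qbin q n i) = q ^ (i * (i - 1) div 2) * q ^ n * qbin q n i"
      by (simp only: power_add mult.assoc[symmetric]) (simp only: mult.assoc)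
    thus ?thesis unfolding T_def triangle_Suc qbin.simps by (simp add: algebra_simps)
  qed
  have "(\<Sum>i\<le>Suc n. T (Suc n) i) = T (Suc n) 0 + (\<Sum>i\<le>n. T (Suc n) (Suc i))" by (rule sum.atMost_Suc_shift)
  also have "(\<Sum>i\<le>n. T (Suc n) (Suc i)) = x * q ^ n * (\<Sum>i\<le>n. T n i) + (\<Sum>i\<le>n. T n (Suc i))"
    unfolding sum_distrib_left sum.distrib[symmetric] by (rule sum.cong) (auto simp: step)
  also have "T (Suc n) 0 + (x * q ^ n * (\<Sum>i\<le>n. T n i) + (\<Sum>i\<le>n. T n (Suc i))) = x * q ^ n * (\<Sum>i\<le>n. T n i) + (T n 0 + (\<Sum>i\<le>n. T n (Suc i)))"
    by (simp add: T_def)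
  also have "T n 0 + (\<Sum>i\<le>n. T n (Suc i)) = (\<Sum>i\<le>Suc n. T n i)" by (rule sum.atMost_Suc_shift[symmetric])
  also have "\<dots> = (\<Sum>i\<le>n. T n i)" by (simp add: T_def qbin_eq_0)
  also have "x * q ^ n * (\<Sum>i\<le>n. T n i) + (\<Sum>i\<le>n. T n i) = (\<Sum>i\<le>n. T n i) * (1 + x * q ^ n)" by (simp add: algebra_simps)
  finally show ?case using Suc by (simp add: T_def)
qed simp

lemma qbin_closed:
  "i \<le> n \<Longrightarrow> qbin q n i * (\<Prod>k<i. 1 - q * q ^ k) * (\<Prod>k<n - i. 1 - q * q ^ k) = (\<Prod>k<n. 1 - q * q ^ k)"
proof (induction q n i rule: qbin.induct)
  case (3 q n i)
  define Q where "Q = (\<lambda>n. \<Prod>k<n. 1 - q * q ^ k)"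
  have i: "i \<le> n" using 3 by simp
  have IH1: "qbin q n i * Q i * Q (n - i) = Q n" using 3 i by (simp add: Q_def)
  have "qbin q n (Suc i) * Q (Suc i) * Q (n - i) = (1 - q ^ (n - i)) * Q n"
  proof (cases "i < n")
    case True
    have "qbin q n (Suc i) * Q (Suc i) * Q (n - Suc i) = Q n" using 3 True unfolding Q_def by (intro 3) simp
    moreover have "Q (n - i) = Q (n - Suc i) * (1 - q ^ (n - i))"
    proof -
      have "n - i = Suc (n - Suc i)" using True by simp
      thus ?thesis by (simp add: Q_def)
    qed
    ultimately show ?thesis by (simp add: mult_ac)
  next
    case False
    thus ?thesis using i by (simp add: qbin_eq_0)
  qed
  moreover have "q ^ (n - i) * qbin q n i * Q (Suc i) * Q (n - i) = q ^ (n - i) * (1 - q ^ Suc i) * Q n"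
  proof -
    have "q ^ (n - i) * qbin q n i * Q (Suc i) * Q (n - i) = q ^ (n - i) * (1 - q ^ Suc i) * (qbin q n i * Q i * Q (n - i))"
      by (simp add: Q_def)
    thus ?thesis unfolding IH1 .
  qed
  moreover have "qbin q (Suc n) (Suc i) * Q (Suc i) * Q (n - i) = q ^ (n - i) * qbin q n i * Q (Suc i) * Q (n - i) + qbin q n (Suc i) * Q (Suc i) * Q (n - i)"
    by (simp only: qbin.simps distrib_right)
  ultimately have "qbin q (Suc n) (Suc i) * Q (Suc i) * Q (n - i) = (q ^ (n - i) * (1 - q ^ Suc i) + (1 - q ^ (n - i))) * Q n"
    by (simp only: distrib_right)
  also have "q ^ (n - i) * (1 - q ^ Suc i) + (1 - q ^ (n - i)) = 1 - q * q ^ n"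
  proof -
    have "q ^ (n - i) * q ^ Suc i = q * (q ^ i * q ^ (n - i))" by (simp add: mult_ac)
    also have "q ^ i * q ^ (n - i) = q ^ n" using i by (simp add: power_add[symmetric])
    finally have "q ^ (n - i) * (1 - q ^ Suc i) = q ^ (n - i) - q * q ^ n" by (simp only: right_diff_distrib mult_1_right)
    thus ?thesis by simp
  qed
  finally show ?case by (simp add: Q_def mult_ac)
qed simp_all

lemma prod_tendsto_nonzero:
  fixes a w :: complex
  assumes w: "norm w < 1" and nz: "\<And>k. 1 + a * w ^ k \<noteq> 0"
  obtains L where "L \<noteq> 0" "(\<lambda>N. \<Prod>k<N. 1 + a * w ^ k) \<longlonglongrightarrow> L"
proof -
  have "summable (\<lambda>k. norm (1 + a * w ^ k - 1))"
    using w by (simp add: norm_mult norm_power)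
  hence c: "convergent_prod (\<lambda>k. 1 + a * w ^ k)"
    by (intro abs_convergent_prod_imp_convergent_prod) (simp add: abs_convergent_prod_conv_summable)
  have "(\<lambda>N. \<Prod>k\<le>N. 1 + a * w ^ k) \<longlonglongrightarrow> prodinf (\<lambda>k. 1 + a * w ^ k)" by (rule convergent_prod_LIMSEQ[OF c])
  hence "(\<lambda>N. \<Prod>k<Suc N. 1 + a * w ^ k) \<longlonglongrightarrow> prodinf (\<lambda>k. 1 + a * w ^ k)" by (simp only: lessThan_Suc_atMost)
  hence "(\<lambda>N. \<Prod>k<N. 1 + a * w ^ k) \<longlonglongrightarrow> prodinf (\<lambda>k. 1 + a * w ^ k)" by (rule LIMSEQ_imp_Suc)
  moreover have "prodinf (\<lambda>k. 1 + a * w ^ k) \<noteq> 0" by (rule prodinf_nonzero[OF c nz])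
  ultimately show ?thesis using that by blast
qed

text \<open>The q-binomial theorem for 2 N factors, recentred. The choice of \<open>x\<close> puts
  the factors with exp(u + t) into the upper half of the product; in the lower half a monomial is
  taken out of each factor, which inverts exp(u). The collected monomials exp(N u - N^2 t) cancel on
  both sides.\<close>

lemma jacobi_triple_finite:
  fixes u t :: complex
  defines "q \<equiv> exp (2 * t)"
  shows "(\<Prod>k<N. 1 + exp (u + t) * q ^ k) * (\<Prod>k<N. 1 + exp (- u + t) * q ^ k)
    = (\<Sum>i\<le>2 * N. qbin q (2 * N) i * exp ((of_nat i - of_nat N) * u + (of_nat i - of_nat N)\<^sup>2 * t))"
proof -
  define x where "x = exp (u + t * (1 - 2 * of_nat N))"
  have qk: "q ^ k = exp (2 * t * of_nat k)" for k
    unfolding q_def exp_of_nat_mult[symmetric] by (simp add: mult_ac)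
  have up: "(\<Prod>k<N. 1 + x * q ^ (N + k)) = (\<Prod>k<N. 1 + exp (u + t) * q ^ k)"
    unfolding qk x_def exp_add[symmetric] by (simp add: algebra_simps)
  have "(\<Prod>k<N. 1 + x * q ^ k) = (\<Prod>k<N. 1 + x * q ^ (N - Suc k))" by (rule prod.nat_diff_reindex[symmetric])
  also have "\<dots> = (\<Prod>k<N. exp (u - t * (2 * of_nat k + 1)) * (1 + exp (- u + t) * q ^ k))"
  proof (rule prod.cong[OF refl])
    fix k assume "k \<in> {..<N}"
    hence k: "of_nat (N - Suc k) = (of_nat N - of_nat k - 1 :: complex)" by (simp add: of_nat_diff)
    have 1: "x * q ^ (N - Suc k) = exp (u - t * (2 * of_nat k + 1))"
      unfolding qk x_def exp_add[symmetric] k by (simp add: algebra_simps)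
    have 2: "exp (u - t * (2 * of_nat k + 1)) * (exp (- u + t) * q ^ k) = 1"
    proof -
      have "(u - t * (2 * of_nat k + 1)) + ((- u + t) + 2 * t * of_nat k) = 0" by (simp add: algebra_simps)
      from arg_cong[OF this, of exp] show ?thesis unfolding qk exp_add by simp
    qed
    show "1 + x * q ^ (N - Suc k) = exp (u - t * (2 * of_nat k + 1)) * (1 + exp (- u + t) * q ^ k)"
      unfolding 1 distrib_left[of "exp (u - t * (2 * of_nat k + 1))" 1] 2 by simp
  qed
  also have "\<dots> = (\<Prod>k<N. exp (u - t * (2 * of_nat k + 1))) * (\<Prod>k<N. 1 + exp (- u + t) * q ^ k)" by (rule prod.distrib)
  also have "(\<Prod>k<N. exp (u - t * (2 * of_nat k + 1))) = exp (of_nat N * u - (of_nat N)\<^sup>2 * t)"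
    by (induction N) (simp_all add: exp_add[symmetric] algebra_simps power2_eq_square)
  finally have lo: "(\<Prod>k<N. 1 + x * q ^ k) = exp (of_nat N * u - (of_nat N)\<^sup>2 * t) * (\<Prod>k<N. 1 + exp (- u + t) * q ^ k)" .
  have split: "(\<Prod>k<N + m. h k) = (\<Prod>k<N. h k) * (\<Prod>k<m. h (N + k))" for h :: "nat \<Rightarrow> complex" and m
    by (induction m) (simp_all add: mult_ac)
  have "(\<Prod>k<2 * N. 1 + x * q ^ k) = (\<Prod>k<N. 1 + x * q ^ k) * (\<Prod>k<N. 1 + x * q ^ (N + k))"
    unfolding mult_2 by (rule split)
  also have "\<dots> = exp (of_nat N * u - (of_nat N)\<^sup>2 * t) * ((\<Prod>k<N. 1 + exp (u + t) * q ^ k) * (\<Prod>k<N. 1 + exp (- u + t) * q ^ k))"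
    unfolding up lo by (simp only: mult_ac)
  finally have A: "(\<Prod>k<2 * N. 1 + x * q ^ k) = exp (of_nat N * u - (of_nat N)\<^sup>2 * t) * ((\<Prod>k<N. 1 + exp (u + t) * q ^ k) * (\<Prod>k<N. 1 + exp (- u + t) * q ^ k))" .
  have B: "(\<Prod>k<2 * N. 1 + x * q ^ k) = exp (of_nat N * u - (of_nat N)\<^sup>2 * t) * (\<Sum>i\<le>2 * N. qbin q (2 * N) i * exp ((of_nat i - of_nat N) * u + (of_nat i - of_nat N)\<^sup>2 * t))"
    unfolding qbinomial sum_distrib_left
  proof (rule sum.cong[OF refl])
    fix i :: nat
    have "2 * (i * (i - 1) div 2) = i * (i - 1)" by (rule dvd_mult_div_cancel) auto
    hence "2 * of_nat (i * (i - 1) div 2) = (of_nat (i * (i - 1)) :: complex)" by (metis of_nat_mult of_nat_numeral)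
    also have "\<dots> = of_nat i * (of_nat i - 1)" by (cases i) (auto simp: algebra_simps)
    finally have tri: "2 * of_nat (i * (i - 1) div 2) = (of_nat i * (of_nat i - 1) :: complex)" .
    have "q ^ (i * (i - 1) div 2) = exp (t * (2 * of_nat (i * (i - 1) div 2)))" unfolding qk by (simp add: mult_ac)
    hence a: "q ^ (i * (i - 1) div 2) = exp (t * (of_nat i * (of_nat i - 1)))" unfolding tri .
    have b: "x ^ i = exp (of_nat i * (u + t * (1 - 2 * of_nat N)))" unfolding x_def exp_of_nat_mult ..
    have "t * (of_nat i * (of_nat i - 1)) + of_nat i * (u + t * (1 - 2 * of_nat N)) = (of_nat N * u - (of_nat N)\<^sup>2 * t) + ((of_nat i - of_nat N) * u + (of_nat i - of_nat N)\<^sup>2 * t)"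
      by (simp add: algebra_simps power2_eq_square)
    from arg_cong[OF this, of exp]
    show "q ^ (i * (i - 1) div 2) * qbin q (2 * N) i * x ^ i = exp (of_nat N * u - (of_nat N)\<^sup>2 * t) * (qbin q (2 * N) i * exp ((of_nat i - of_nat N) * u + (of_nat i - of_nat N)\<^sup>2 * t))"
      unfolding a b exp_add by (simp only: mult_ac)
  qed
  show ?thesis using A B by simp
qed

text \<open>The limit N -> infinity of the finite triple product: the series is a nonzero constant
  times two convergent infinite products without vanishing factors.\<close>

theorem theta_series_nonzero:
  fixes u t :: complex
  assumes t: "Re t < 0"
    and nz1: "\<And>k::nat. 1 + exp (u + t) * exp (2 * t) ^ k \<noteq> 0"
    and nz2: "\<And>k::nat. 1 + exp (- u + t) * exp (2 * t) ^ k \<noteq> 0"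
  shows "(\<Sum>\<^sub>\<infinity>j::int. exp (of_int j * u + (of_int j)\<^sup>2 * t)) \<noteq> 0"
proof -
  define q where "q = exp (2 * t)"
  have q: "norm q < 1" using t by (simp add: q_def)
  define Q where "Q = (\<lambda>n. \<Prod>k<n. 1 - q * q ^ k)"
  have Qf: "1 + (- q) * q ^ k \<noteq> 0" for k
  proof
    assume "1 + (- q) * q ^ k = 0"
    hence "q ^ Suc k = 1" by simp
    hence "norm q ^ Suc k = 1" by (metis norm_one norm_power)
    thus False using q power_strict_mono[of "norm q" 1 "Suc k"] by simp
  qed
  have Q0: "Q n \<noteq> 0" for n unfolding Q_def using Qf by simp
  obtain Qi where Qi: "Qi \<noteq> 0" "Q \<longlonglongrightarrow> Qi"
    using prod_tendsto_nonzero[OF q, of "- q"] Qf unfolding Q_def by auto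
  obtain B1 where B1: "\<And>n. norm (Q n) \<le> B1" using convergent_imp_Bseq[OF convergentI[OF Qi(2)]] by (auto simp: Bseq_def)
  have "(\<lambda>n. inverse (Q n)) \<longlonglongrightarrow> inverse Qi" by (intro tendsto_inverse Qi)
  from convergent_imp_Bseq[OF convergentI[OF this]]
  obtain B2 where B2: "\<And>n. norm (inverse (Q n)) \<le> B2" by (auto simp: Bseq_def)
  obtain L1 where L1: "L1 \<noteq> 0" "(\<lambda>N. \<Prod>k<N. 1 + exp (u + t) * q ^ k) \<longlonglongrightarrow> L1"
    using prod_tendsto_nonzero[OF q nz1[folded q_def]] by blast
  obtain L2 where L2: "L2 \<noteq> 0" "(\<lambda>N. \<Prod>k<N. 1 + exp (- u + t) * q ^ k) \<longlonglongrightarrow> L2"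
    using prod_tendsto_nonzero[OF q nz2[folded q_def]] by blast
  define e where "e j = exp (of_int j * u + (of_int j)\<^sup>2 * t)" for j :: int
  \<comment> \<open>The coefficient of the j-th exponential in the finite identity, by the product
    formula for \<open>qbin\<close> with index i = j + N. It is bounded by
    \<open>B1 * B2 * B2\<close> and tends to \<open>inverse Qi\<close>.\<close>
  define c where "c N j = (if \<bar>j\<bar> \<le> int N then Q (2 * N) * inverse (Q (nat (int N + j))) * inverse (Q (nat (int N - j))) else 0)" for N j
  have fin: "(\<Prod>k<N. 1 + exp (u + t) * q ^ k) * (\<Prod>k<N. 1 + exp (- u + t) * q ^ k) = (\<Sum>\<^sub>\<infinity>j. c N j * e j)" for N
  proof -
    have inj: "inj_on (\<lambda>i. int i - int N) {..2 * N}" by (auto simp: inj_on_def)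
    have im: "(\<lambda>i. int i - int N) ` {..2 * N} = {j. \<bar>j\<bar> \<le> int N}"
    proof (intro equalityI subsetI)
      fix j assume "j \<in> {j. \<bar>j\<bar> \<le> int N}"
      thus "j \<in> (\<lambda>i. int i - int N) ` {..2 * N}" by (intro image_eqI[of _ _ "nat (j + int N)"]) auto
    qed auto
    have "(\<Sum>\<^sub>\<infinity>j. c N j * e j) = (\<Sum>\<^sub>\<infinity>j\<in>(\<lambda>i. int i - int N) ` {..2 * N}. c N j * e j)"
      by (rule infsum_cong_neutral) (auto simp: im c_def)
    also have "\<dots> = (\<Sum>j\<in>(\<lambda>i. int i - int N) ` {..2 * N}. c N j * e j)" by (rule infsum_finite) simp
    also have "\<dots> = (\<Sum>i\<le>2 * N. c N (int i - int N) * e (int i - int N))" by (simp add: sum.reindex[OF inj])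
    also have "\<dots> = (\<Sum>i\<le>2 * N. qbin q (2 * N) i * exp ((of_nat i - of_nat N) * u + (of_nat i - of_nat N)\<^sup>2 * t))"
    proof (rule sum.cong[OF refl])
      fix i assume i: "i \<in> {..2 * N}"
      have "nat (int N - (int i - int N)) = 2 * N - i" "nat (int N + (int i - int N)) = i" "\<bar>int i - int N\<bar> \<le> int N" using i by auto
      moreover have "qbin q (2 * N) i * Q i * Q (2 * N - i) = Q (2 * N)" using qbin_closed[of i "2 * N" q] i by (simp add: Q_def)
      hence "qbin q (2 * N) i = Q (2 * N) * inverse (Q i) * inverse (Q (2 * N - i))"
        using Q0 by (simp add: field_simps)
      ultimately show "c N (int i - int N) * e (int i - int N) = qbin q (2 * N) i * exp ((of_nat i - of_nat N) * u + (of_nat i - of_nat N)\<^sup>2 * t)"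
        by (simp add: c_def e_def)
    qed
    finally show ?thesis unfolding q_def jacobi_triple_finite by simp
  qed
  have "(\<lambda>N. \<Sum>\<^sub>\<infinity>j. c N j * e j) \<longlonglongrightarrow> (\<Sum>\<^sub>\<infinity>j. inverse Qi * e j)"
  proof (rule infsum_dominated_convergence)
    show "(\<lambda>j::int. (B1 * B2 * B2) * exp (- (- Re t) * (of_int j)\<^sup>2 + Re u * of_int j)) summable_on UNIV"
      using t by (intro summable_on_cmult_right gauss_linear_summable_int) auto
    fix N and j :: int
    have B0: "B1 \<ge> 0" "B2 \<ge> 0" by (rule order_trans[OF norm_ge_zero B1[of 0]], rule order_trans[OF norm_ge_zero B2[of 0]])
    have "norm (c N j) \<le> B1 * B2 * B2"
    proof (cases "\<bar>j\<bar> \<le> int N")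
      case True
      thus ?thesis unfolding c_def using B0 by (simp only: if_True norm_mult) (intro mult_mono B1 B2 mult_nonneg_nonneg norm_ge_zero, auto)
    next
      case False
      thus ?thesis using B0 by (simp add: c_def)
    qed
    moreover have "norm (e j) = exp (- (- Re t) * (of_int j)\<^sup>2 + Re u * of_int j)"
      by (simp add: e_def algebra_simps flip: of_int_power)
    ultimately show "norm (c N j * e j) \<le> (B1 * B2 * B2) * exp (- (- Re t) * (of_int j)\<^sup>2 + Re u * of_int j)"
      unfolding norm_mult by (simp only:) (rule mult_right_mono, auto)
  next
    fix j :: int
    have f1: "filterlim (\<lambda>N. 2 * N) at_top sequentially" by (rule filterlim_subseq) (auto simp: strict_mono_def)
    have f2: "filterlim (\<lambda>N. nat (int N + m)) at_top sequentially" for m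
      unfolding filterlim_at_top
    proof
      fix Z :: nat
      show "\<forall>\<^sub>F N in sequentially. Z \<le> nat (int N + m)"
        using eventually_ge_at_top[of "Z + nat \<bar>m\<bar>"] by eventually_elim linarith
    qed
    have "(\<lambda>N. Q (2 * N) * inverse (Q (nat (int N + j))) * inverse (Q (nat (int N - j))) * e j) \<longlonglongrightarrow> Qi * inverse Qi * inverse Qi * e j"
      using f2[of j] f2[of "- j"]
      by (intro tendsto_intros filterlim_compose[OF Qi(2)] f1 Qi(1)) auto
    moreover have "\<forall>\<^sub>F N in sequentially. Q (2 * N) * inverse (Q (nat (int N + j))) * inverse (Q (nat (int N - j))) * e j = c N j * e j"
      using eventually_ge_at_top[of "nat \<bar>j\<bar>"] by eventually_elim (auto simp: c_def)
    ultimately show "(\<lambda>N. c N j * e j) \<longlonglongrightarrow> inverse Qi * e j"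
      using Qi(1) by (simp add: tendsto_cong)
  qed
  hence "(\<lambda>N. (\<Prod>k<N. 1 + exp (u + t) * q ^ k) * (\<Prod>k<N. 1 + exp (- u + t) * q ^ k)) \<longlonglongrightarrow> inverse Qi * infsum e UNIV"
    unfolding fin infsum_cmult_right' .
  moreover have "(\<lambda>N. (\<Prod>k<N. 1 + exp (u + t) * q ^ k) * (\<Prod>k<N. 1 + exp (- u + t) * q ^ k)) \<longlonglongrightarrow> L1 * L2"
    by (intro tendsto_intros L1 L2)
  ultimately have "inverse Qi * infsum e UNIV = L1 * L2" by (rule LIMSEQ_unique)
  hence "infsum e UNIV \<noteq> 0" using L1(1) L2(1) by auto
  moreover have "infsum e UNIV = (\<Sum>\<^sub>\<infinity>j::int. exp (of_int j * u + (of_int j)\<^sup>2 * t))"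
    by (rule infsum_cong, rule e_def)
  ultimately show ?thesis by simp
qed

section \<open>Zeros of the Jacobi theta functions\<close>

definition half_period :: "complex \<Rightarrow> complex \<Rightarrow> bool" where
  "half_period \<tau> v \<longleftrightarrow> (\<exists>a b :: int. v = (of_int a + of_int b * \<tau>) / 2)"

lemma half_period_shift: "half_period \<tau> (v + (of_int c + of_int d * \<tau>) / 2) \<longleftrightarrow> half_period \<tau> v"
proof
  assume "half_period \<tau> (v + (of_int c + of_int d * \<tau>) / 2)"
  then obtain a b :: int where "v + (of_int c + of_int d * \<tau>) / 2 = (of_int a + of_int b * \<tau>) / 2" by (auto simp: half_period_def)
  hence "v = (of_int a + of_int b * \<tau>) / 2 - (of_int c + of_int d * \<tau>) / 2" by (simp only: eq_diff_eq)
  also have "\<dots> = (of_int (a - c) + of_int (b - d) * \<tau>) / 2" by (simp add: diff_divide_distrib add_divide_distrib left_diff_distrib)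
  finally have "v = (of_int (a - c) + of_int (b - d) * \<tau>) / 2" .
  thus "half_period \<tau> v" unfolding half_period_def by blast
next
  assume "half_period \<tau> v"
  then obtain a b :: int where "v = (of_int a + of_int b * \<tau>) / 2" by (auto simp: half_period_def)
  hence "v + (of_int c + of_int d * \<tau>) / 2 = (of_int (a + c) + of_int (b + d) * \<tau>) / 2" by (simp add: field_simps)
  thus "half_period \<tau> (v + (of_int c + of_int d * \<tau>) / 2)" unfolding half_period_def by blast
qed

text \<open>A factor of the triple product vanishes only if v, or -v, plus (1 + (2 k + 1) \<tau>)/2
  is an integer, and then v is a half period.\<close>

lemma theta_series_nonzero_off_half_periods:
  assumes \<tau>: "Im \<tau> > 0" and v: "\<not> half_period \<tau> v"
  shows "(\<Sum>\<^sub>\<infinity>j::int. exp (of_int j * (2 * of_real pi * \<i> * v) + (of_int j)\<^sup>2 * (of_real pi * \<i> * \<tau>))) \<noteq> 0"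
proof (rule theta_series_nonzero)
  show "Re (of_real pi * \<i> * \<tau>) < 0" using \<tau> by simp
  have key: "1 + exp (2 * of_real pi * \<i> * v + of_real pi * \<i> * \<tau>) * exp (2 * (of_real pi * \<i> * \<tau>)) ^ k \<noteq> 0"
    if "\<not> half_period \<tau> v" for k :: nat and v
  proof
    assume "1 + exp (2 * of_real pi * \<i> * v + of_real pi * \<i> * \<tau>) * exp (2 * (of_real pi * \<i> * \<tau>)) ^ k = 0"
    hence "exp (2 * of_real pi * \<i> * v + of_real pi * \<i> * \<tau>) * exp (2 * (of_real pi * \<i> * \<tau>)) ^ k * exp (of_real pi * \<i>) = 1"
      by (simp add: add_eq_0_iff)
    moreover have "exp (2 * of_real pi * \<i> * v + of_real pi * \<i> * \<tau>) * exp (2 * (of_real pi * \<i> * \<tau>)) ^ k * exp (of_real pi * \<i>)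
      = exp (2 * of_real pi * \<i> * (v + (of_int 1 + of_int (2 * int k + 1) * \<tau>) / 2))"
    proof -
      have "2 * of_real pi * \<i> * v + of_real pi * \<i> * \<tau> + of_nat k * (2 * (of_real pi * \<i> * \<tau>)) + of_real pi * \<i>
        = 2 * of_real pi * \<i> * (v + (of_int 1 + of_int (2 * int k + 1) * \<tau>) / 2)" by (simp add: algebra_simps add_divide_distrib)
      from arg_cong[OF this, of exp] show ?thesis unfolding exp_of_nat_mult[symmetric] exp_add[symmetric] .
    qed
    ultimately have "v + (of_int 1 + of_int (2 * int k + 1) * \<tau>) / 2 \<in> \<int>" by (simp only: exp_2pi_eq_1_iff)
    then obtain m where "v + (of_int 1 + of_int (2 * int k + 1) * \<tau>) / 2 = of_int m" by (auto elim: Ints_cases)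
    hence "v + (of_int 1 + of_int (2 * int k + 1) * \<tau>) / 2 = (of_int (2 * m) + of_int 0 * \<tau>) / 2" by simp
    hence "half_period \<tau> (v + (of_int 1 + of_int (2 * int k + 1) * \<tau>) / 2)" unfolding half_period_def by blast
    thus False using that half_period_shift by blast
  qed
  show "1 + exp (2 * of_real pi * \<i> * v + of_real pi * \<i> * \<tau>) * exp (2 * (of_real pi * \<i> * \<tau>)) ^ k \<noteq> 0" for k :: nat
    by (rule key[OF v])
  have "\<not> half_period \<tau> (- v)"
  proof
    assume "half_period \<tau> (- v)"
    then obtain a b :: int where "- v = (of_int a + of_int b * \<tau>) / 2" by (auto simp: half_period_def)
    hence "v = - ((of_int a + of_int b * \<tau>) / 2)" by (metis minus_minus)
    also have "\<dots> = (of_int (- a) + of_int (- b) * \<tau>) / 2" by (simp add: minus_divide_left)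
    finally have "v = (of_int (- a) + of_int (- b) * \<tau>) / 2" .
    thus False using v unfolding half_period_def by blast
  qed
  from key[OF this] show "1 + exp (- (2 * of_real pi * \<i> * v) + of_real pi * \<i> * \<tau>) * exp (2 * (of_real pi * \<i> * \<tau>)) ^ k \<noteq> 0" for k :: nat
    by simp
qed

lemma infsum_even_odd:
  fixes h :: "int \<Rightarrow> complex" and d :: int
  assumes h: "h summable_on UNIV" and d: "odd d"
  shows "(\<Sum>\<^sub>\<infinity>a. h (2 * a)) + (\<Sum>\<^sub>\<infinity>a. h (2 * a + d)) = infsum h UNIV"
proof -
  have 1: "(\<Sum>\<^sub>\<infinity>a. h (2 * a)) = infsum h {m. even m}"
    by (rule infsum_reindex_bij_betw) (rule bij_betwI[where g = "\<lambda>m. m div 2"], auto)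
  have 2: "(\<Sum>\<^sub>\<infinity>a. h (2 * a + d)) = infsum h {m. odd m}"
    by (rule infsum_reindex_bij_betw) (rule bij_betwI[where g = "\<lambda>m. (m - d) div 2"], use d in auto)
  have "infsum h ({m. even m} \<union> {m. odd m}) = infsum h {m. even m} + infsum h {m. odd m}"
    by (rule infsum_Un_disjoint) (auto intro: summable_on_subset_banach[OF h])
  moreover have "{m::int. even m} \<union> {m. odd m} = UNIV" by auto
  ultimately show ?thesis unfolding 1 2 by simp
qed

text \<open>Each of the four Jacobi functions is, up to a factor without zeros, one theta series at
  z + (c + d \<tau>)/2: odd c gives the alternating signs, odd d the half-integral exponents. Half
  periods are closed under this translation, and \<open>fdom\<close> avoids them. \<open>d'\<close>
  says how the odd indices are enumerated.\<close>

lemma theta_combination_nonzero: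
  fixes c d d' :: int and \<tau> z :: complex
  assumes dom: "(\<tau>, z) \<in> fdom" and d: "odd d'"
  defines "h \<equiv> \<lambda>m::int. exp (of_real pi * \<i> * of_int (c * m)) * (qpow \<tau> ((of_int m + of_int d / 2)\<^sup>2 / 2) * exp (2 * of_real pi * \<i> * of_real (of_int m + of_int d / 2) * z))"
  shows "(\<Sum>\<^sub>\<infinity>a. h (2 * a)) + (\<Sum>\<^sub>\<infinity>a. h (2 * a + d')) \<noteq> 0"
proof -
  have \<tau>: "Im \<tau> > 0" by (rule fdom_Im[OF dom])
  define v where "v = z + (of_int c + of_int d * \<tau>) / 2"
  define K where "K = exp (of_real pi * \<i> * \<tau> * (of_int d / 2)\<^sup>2 + 2 * of_real pi * \<i> * (of_int d / 2) * z)"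
  have hK: "h m = K * exp (of_int m * (2 * of_real pi * \<i> * v) + (of_int m)\<^sup>2 * (of_real pi * \<i> * \<tau>))" for m
    unfolding h_def K_def qpow_def v_def exp_add[symmetric] by (rule arg_cong[where f = exp]) (simp add: field_simps power2_eq_square)
  have "h summable_on UNIV"
  proof (rule abs_summable_summable, rule summable_on_cong[THEN iffD1])
    show "(\<lambda>m::int. norm K * exp (- (pi * Im \<tau>) * (of_int m)\<^sup>2 + (- 2 * pi * Im v) * of_int m)) summable_on UNIV"
      using \<tau> by (intro summable_on_cmult_right gauss_linear_summable_int) auto
    show "norm K * exp (- (pi * Im \<tau>) * (of_int m)\<^sup>2 + (- 2 * pi * Im v) * of_int m) = norm (h m)" for m
      unfolding hK norm_mult by (simp add: algebra_simps flip: of_int_power)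
  qed
  from infsum_even_odd[OF this d]
  have "(\<Sum>\<^sub>\<infinity>a. h (2 * a)) + (\<Sum>\<^sub>\<infinity>a. h (2 * a + d')) = K * (\<Sum>\<^sub>\<infinity>m. exp (of_int m * (2 * of_real pi * \<i> * v) + (of_int m)\<^sup>2 * (of_real pi * \<i> * \<tau>)))"
    unfolding hK infsum_cmult_right' .
  moreover have "\<not> half_period \<tau> v" unfolding v_def half_period_shift using dom by (simp add: fdom_def half_period_def)
  ultimately show ?thesis using theta_series_nonzero_off_half_periods[OF \<tau>] by (simp add: K_def)
qed

lemma theta_2_term:
  assumes x: "2 * (real_of_int a + of_int j / (2 * real 2)) = of_int m + of_int d / 2"
  shows "qpow \<tau> (real 2 * (of_int a + of_int j / (2 * real 2))\<^sup>2) * exp (2 * of_real pi * \<i> * of_nat 2 * of_real (of_int a + of_int j / (2 * real 2)) * z)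
    = qpow \<tau> ((of_int m + of_int d / 2)\<^sup>2 / 2) * exp (2 * of_real pi * \<i> * of_real (of_int m + of_int d / 2) * z)"
proof -
  have "real 2 * y\<^sup>2 = (2 * y)\<^sup>2 / 2" for y :: real by (simp add: power2_eq_square)
  moreover have "2 * of_real pi * \<i> * of_nat 2 * of_real y * z = 2 * of_real pi * \<i> * of_real (2 * y) * z" for y by simp
  ultimately show ?thesis unfolding x[symmetric] by (simp only:)
qed

lemma exp_pi_even: "exp (of_real pi * \<i> * of_int (c * (2 * a))) = 1"
proof -
  have "of_real pi * \<i> * of_int (c * (2 * a)) = 2 * of_real pi * \<i> * of_int (c * a)" by simp
  thus ?thesis by (simp only: exp_2pi_eq_1_iff Ints_of_int)
qed

lemma exp_pi_odd: "exp (of_real pi * \<i> * of_int (1 * (2 * a + d))) = exp (of_real pi * \<i> * of_int d)"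
proof -
  have "of_real pi * \<i> * of_int (1 * (2 * a + d)) = of_real pi * \<i> * of_int d + of_real pi * \<i> * of_int (1 * (2 * a))" by (simp add: algebra_simps)
  thus ?thesis by (simp only: exp_add exp_pi_even mult_1_right)
qed

lemma vtheta_nonzero:
  assumes dom: "(\<tau>, z) \<in> fdom"
  shows "vtheta00 \<tau> z \<noteq> 0" "vtheta01 \<tau> z \<noteq> 0" "vtheta10 \<tau> z \<noteq> 0" "vtheta11 \<tau> z \<noteq> 0"
proof -
  have l: "(2::nat) > 0" by simp
  define T where "T m d = qpow \<tau> ((of_int m + of_int d / 2)\<^sup>2 / 2) * exp (2 * of_real pi * \<i> * of_real (of_int m + of_int d / 2) * z)" for m d :: int
  have th0: "theta 0 2 \<tau> z = (\<Sum>\<^sub>\<infinity>a. T (2 * a) 0)" unfolding theta_reindex[OF l] T_def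
    by (rule infsum_cong, rule theta_2_term) simp
  have th2: "theta 2 2 \<tau> z = (\<Sum>\<^sub>\<infinity>a. T (2 * a + 1) 0)" unfolding theta_reindex[OF l] T_def
    by (rule infsum_cong, rule theta_2_term) simp
  have th1: "theta 1 2 \<tau> z = (\<Sum>\<^sub>\<infinity>a. T (2 * a) 1)" unfolding theta_reindex[OF l] T_def
    by (rule infsum_cong, rule theta_2_term) simp
  have thm1: "theta (-1) 2 \<tau> z = (\<Sum>\<^sub>\<infinity>a. T (2 * a + (-1)) 1)" unfolding theta_reindex[OF l] T_def
    by (rule infsum_cong, rule theta_2_term) simp
  have o: "odd (1::int)" "odd (-1::int)" by auto
  have e1: "exp (of_real pi * \<i> * of_int 1) = -1" "exp (of_real pi * \<i> * of_int (-1)) = -1" by (simp_all add: exp_minus)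
  note R = theta_combination_nonzero[OF dom, folded T_def]
  show "vtheta00 \<tau> z \<noteq> 0"
    using R[OF o(1), of 0 0] unfolding vtheta00_def th0 th2 by (simp add: add.commute)
  show "vtheta10 \<tau> z \<noteq> 0"
    using R[OF o(2), of 0 1] unfolding vtheta10_def th1 thm1 by simp
  show "vtheta01 \<tau> z \<noteq> 0"
    using R[OF o(1), of 1 0] unfolding vtheta01_def th0 th2 exp_pi_even exp_pi_odd e1 by (simp add: infsum_uminus add.commute)
  have "(\<Sum>\<^sub>\<infinity>a. T (2 * a) 1) - (\<Sum>\<^sub>\<infinity>a. T (2 * a + (-1)) 1) \<noteq> 0"
    using R[OF o(2), of 1 1] unfolding exp_pi_even exp_pi_odd e1 by (simp add: infsum_uminus)
  thus "vtheta11 \<tau> z \<noteq> 0" unfolding vtheta11_def th1 thm1 right_diff_distrib[symmetric] by simp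
qed

lemma eta_nonzero:
  assumes \<tau>: "Im \<tau> > 0" shows "eta \<tau> \<noteq> 0"
proof -
  define q where "q = exp (2 * of_real pi * \<i> * \<tau>)"
  have q: "norm q < 1" using \<tau> by (simp add: q_def)
  have qk: "qpow \<tau> (real (Suc k)) = q ^ Suc k" for k
    unfolding qpow_def q_def exp_of_nat_mult[symmetric] by (simp add: algebra_simps)
  have "summable (\<lambda>k. norm (1 - q ^ Suc k - 1))"
    using q by (simp add: norm_mult norm_power)
  hence c: "convergent_prod (\<lambda>k. 1 - q ^ Suc k)"
    by (intro abs_convergent_prod_imp_convergent_prod) (simp add: abs_convergent_prod_conv_summable)
  have nz: "1 - q ^ Suc k \<noteq> 0" for k
  proof
    assume "1 - q ^ Suc k = 0"
    hence "norm q ^ Suc k = 1" by (metis eq_iff_diff_eq_0 norm_one norm_power)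
    thus False using q power_strict_mono[of "norm q" 1 "Suc k"] by simp
  qed
  have "(\<Prod>k. 1 - q ^ Suc k) \<noteq> 0" by (rule prodinf_nonzero[OF c nz])
  thus ?thesis unfolding eta_def qk by (simp add: qpow_def)
qed

lemma denominators_nonzero:
  assumes dom: "(\<tau>, z) \<in> fdom"
  shows "R_plus \<tau> z \<noteq> 0" "R_minus \<tau> z \<noteq> 0" "R_tw \<tau> z \<noteq> 0"
proof -
  have "Im \<tau> > 0" by (rule fdom_Im[OF dom])
  hence "eta \<tau> \<noteq> 0" "eta (\<tau> / 2) \<noteq> 0" "eta (2 * \<tau>) \<noteq> 0" by (simp_all add: eta_nonzero)
  thus "R_plus \<tau> z \<noteq> 0" "R_minus \<tau> z \<noteq> 0" "R_tw \<tau> z \<noteq> 0"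
    using vtheta_nonzero[OF dom] by (auto simp: R_plus_def R_minus_def R_tw_def)
qed

section \<open>Spans\<close>

interpretation fs: vector_space fscale by (rule vector_space_fscale)

lemma cspan_minimal: "S \<subseteq> cspan T \<Longrightarrow> cspan S \<subseteq> cspan T"
  unfolding cspan_def by (rule fs.span_minimal) simp_all

lemma sum_fun_apply2: "(\<Sum>i\<in>I. F i) \<tau> z = (\<Sum>i\<in>I. F i \<tau> z :: complex)"
  by (induction I rule: infinite_finite_induct) auto

lemma on_dom_lat_scale: "on_dom (lat_sum \<kappa> (\<lambda>x. u * c x)) = fscale u (on_dom (lat_sum \<kappa> c))"
  by (auto simp: on_dom_def fscale_def fun_eq_iff lat_sum_scale)

lemma on_dom_lat_sum:
  assumes "\<kappa> > 0" "\<And>i. i \<in> I \<Longrightarrow> bounded_coeff (c i)"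
  shows "on_dom (lat_sum \<kappa> (\<lambda>x. \<Sum>i\<in>I. u i * c i x)) = (\<Sum>i\<in>I. fscale (u i) (on_dom (lat_sum \<kappa> (c i))))"
proof (intro ext)
  fix \<tau> z
  show "on_dom (lat_sum \<kappa> (\<lambda>x. \<Sum>i\<in>I. u i * c i x)) \<tau> z = (\<Sum>i\<in>I. fscale (u i) (on_dom (lat_sum \<kappa> (c i)))) \<tau> z"
    unfolding sum_fun_apply2 using lat_sum_sum[of \<tau> z \<kappa> I c u] assms by (simp add: on_dom_def fscale_def)
qed

lemma on_dom_f_fun:
  assumes "M > 0" "n > 0" "2 * \<epsilon> \<in> \<int>" "2 * \<sigma> \<in> \<int>" "2 * \<sigma>' \<in> \<int>" "2 * j \<in> \<int>" "2 * k \<in> \<int>"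
  shows "on_dom (f_fun M n \<epsilon> \<sigma> \<sigma>' j k) = fscale (f_const (real n / real M) \<sigma> \<sigma>')
     (on_dom (lat_sum (real n / real M) (f_coeff M (real n / real M) \<epsilon> (\<sigma>' / 2) (\<sigma> / 2) j k)))"
  using f_fun_eq_lat_sum[OF _ assms] by (auto simp: on_dom_def fscale_def fun_eq_iff)

lemma fscale_mem_iff:
  assumes "c \<noteq> 0" shows "fscale c F \<in> cspan S \<longleftrightarrow> F \<in> cspan S"
proof
  assume "fscale c F \<in> cspan S"
  hence "fscale (1 / c) (fscale c F) \<in> cspan S" unfolding cspan_def by (rule fs.span_scale)
  thus "F \<in> cspan S" using assms by (simp add: fscale_def)
next
  assume "F \<in> cspan S"
  thus "fscale c F \<in> cspan S" unfolding cspan_def by (rule fs.span_scale)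
qed

section \<open>Passage between the two systems of generators\<close>

definition f_span_gens :: "nat \<Rightarrow> nat \<Rightarrow> (complex \<Rightarrow> complex \<Rightarrow> complex) set" where
  "f_span_gens M n = {on_dom (f_fun M n \<epsilon> \<sigma> \<sigma>' j k) | \<epsilon> \<epsilon>' \<sigma> \<sigma>' j k.
        \<epsilon> \<in> {0, 1/2} \<and> \<epsilon>' \<in> {0, 1/2} \<and> \<sigma> \<in> {0, 1/2} \<and> \<sigma>' \<in> {0, 1/2} \<and>
        (\<sigma>, \<sigma>') \<noteq> (0, 0) \<and> j - \<epsilon>' \<in> \<int> \<and> k - \<epsilon>' \<in> \<int>}"

text \<open>The restriction on s is the orbit-stable form of (\<sigma>, \<sigma>') \<noteq> (0, 0):
  SL2(Z) preserves both lattices, hence their difference.\<close>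

definition g_span_gens :: "nat \<Rightarrow> nat \<Rightarrow> (complex \<Rightarrow> complex \<Rightarrow> complex) set" where
  "g_span_gens M n = {on_dom (lat_sum (real n / real M) (g_coeff M (real n / real M) y s)) | y s.
        y \<in> half_lattice \<and> s \<in> quarter_lattice \<and> s \<notin> half_lattice}"

lemma half_eps: "\<epsilon> \<in> {0, 1/2 :: real} \<Longrightarrow> 2 * \<epsilon> \<in> \<int>"
  by (elim insertE emptyE) (simp_all only:, simp_all)

lemma half_integer_cases:
  assumes "2 * y \<in> \<int>"
  obtains \<epsilon> m where "\<epsilon> \<in> {0, 1/2 :: real}" "y = \<epsilon> + of_int m"
proof -
  obtain A where A: "2 * y = of_int A" using assms by (auto elim: Ints_cases)
  have "real_of_int A = real_of_int (2 * (A div 2) + A mod 2)" by simp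
  also have "\<dots> = 2 * of_int (A div 2) + of_int (A mod 2)" by (simp only: of_int_add of_int_mult of_int_numeral)
  finally have "y = of_int (A mod 2) / 2 + of_int (A div 2)" using A by linarith
  moreover have "A mod 2 = 0 \<or> A mod 2 = 1" by auto
  ultimately show ?thesis using that[of "of_int (A mod 2) / 2" "A div 2"] by auto
qed

lemma Ints_double:
  assumes "\<epsilon> \<in> {0, 1/2 :: real}" "j - \<epsilon> \<in> \<int>" shows "2 * j \<in> \<int>"
proof -
  have "2 * j = 2 * \<epsilon> + 2 * (j - \<epsilon>)" by simp
  thus ?thesis using half_eps[OF assms(1)] assms(2) by (simp only: Ints_add Ints_mult Ints_numeral)
qed

lemma sigma_quarter:
  fixes \<sigma> \<sigma>' :: real
  assumes "\<sigma> \<in> {0, 1/2}" "\<sigma>' \<in> {0, 1/2}" "(\<sigma>, \<sigma>') \<noteq> (0, 0)"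
  shows "(\<sigma>' / 2, \<sigma> / 2) \<in> quarter_lattice" "(\<sigma>' / 2, \<sigma> / 2) \<notin> half_lattice"
proof -
  have h: "(1/2::real) \<notin> \<int>"
  proof
    assume "(1/2::real) \<in> \<int>"
    then obtain k :: int where "(1/2::real) = of_int k" by (auto elim: Ints_cases)
    hence "real_of_int (2 * k) = of_int 1" by simp
    hence "2 * k = 1" by (simp only: of_int_eq_iff)
    thus False by presburger
  qed
  show "(\<sigma>' / 2, \<sigma> / 2) \<in> quarter_lattice"
    using half_eps[OF assms(1)] half_eps[OF assms(2)] by (simp add: quarter_lattice_def)
  have "\<sigma> \<notin> \<int> \<or> \<sigma>' \<notin> \<int>" using assms h by blast
  thus "(\<sigma>' / 2, \<sigma> / 2) \<notin> half_lattice" by (auto simp: half_lattice_def)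
qed

lemma span_f_subset_g:
  assumes M: "M > 0" and n: "n > 0" and cop: "coprime n M"
  shows "cspan (f_span_gens M n) \<subseteq> cspan (g_span_gens M n)"
proof (rule cspan_minimal, rule subsetI)
  fix F assume "F \<in> f_span_gens M n"
  then obtain \<epsilon> \<epsilon>' \<sigma> \<sigma>' j k where F: "F = on_dom (f_fun M n \<epsilon> \<sigma> \<sigma>' j k)"
    and h: "\<epsilon> \<in> {0, 1/2}" "\<epsilon>' \<in> {0, 1/2}" "\<sigma> \<in> {0, 1/2}" "\<sigma>' \<in> {0, 1/2}" "(\<sigma>, \<sigma>') \<noteq> (0, 0)" "j - \<epsilon>' \<in> \<int>" "k - \<epsilon>' \<in> \<int>"
    unfolding f_span_gens_def by blast
  define \<kappa> where "\<kappa> = real n / real M"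
  have \<kappa>: "\<kappa> > 0" using M n by (simp add: \<kappa>_def)
  have j2: "2 * j \<in> \<int>" and k2: "2 * k \<in> \<int>" using Ints_double h by blast+
  have "k - j = (k - \<epsilon>') - (j - \<epsilon>')" by simp
  hence "k - j \<in> \<int>" using h by (simp only: Ints_diff)
  then obtain k0 where "k - j = of_int k0" by (auto elim: Ints_cases)
  hence k: "k = j + of_int k0" by simp
  have "f_coeff M \<kappa> \<epsilon> (\<sigma>' / 2) (\<sigma> / 2) j k x = (\<Sum>i<M. (ee (- \<kappa> * k * (\<epsilon> + real i)) / of_nat M) * g_coeff M \<kappa> (j, \<epsilon> + real i) (\<sigma>' / 2, \<sigma> / 2) x)" for x
  proof -
    have "(\<Sum>i<M. (ee (- \<kappa> * k * (\<epsilon> + real i)) / of_nat M) * g_coeff M \<kappa> (j, \<epsilon> + real i) (\<sigma>' / 2, \<sigma> / 2) x)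
      = (\<Sum>i<M. ee (- \<kappa> * k * (\<epsilon> + real i)) * g_coeff M \<kappa> (j, \<epsilon> + real i) (\<sigma>' / 2, \<sigma> / 2) x) / of_nat M"
      by (simp add: sum_divide_distrib)
    also have "\<dots> = of_nat M * f_coeff M \<kappa> \<epsilon> (\<sigma>' / 2) (\<sigma> / 2) j k x / of_nat M"
      unfolding \<kappa>_def k f_coeff_eq_sum[OF M cop] ..
    finally show ?thesis using M by simp
  qed
  hence "f_coeff M \<kappa> \<epsilon> (\<sigma>' / 2) (\<sigma> / 2) j k = (\<lambda>x. \<Sum>i<M. (ee (- \<kappa> * k * (\<epsilon> + real i)) / of_nat M) * g_coeff M \<kappa> (j, \<epsilon> + real i) (\<sigma>' / 2, \<sigma> / 2) x)"
    by (rule ext)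
  hence "on_dom (lat_sum \<kappa> (f_coeff M \<kappa> \<epsilon> (\<sigma>' / 2) (\<sigma> / 2) j k)) =
     (\<Sum>i<M. fscale (ee (- \<kappa> * k * (\<epsilon> + real i)) / of_nat M) (on_dom (lat_sum \<kappa> (g_coeff M \<kappa> (j, \<epsilon> + real i) (\<sigma>' / 2, \<sigma> / 2)))))"
    by (simp only: on_dom_lat_sum[OF \<kappa> bounded_g_coeff])
  also have "\<dots> \<in> cspan (g_span_gens M n)"
    unfolding cspan_def
  proof (intro fs.span_sum fs.span_scale fs.span_base)
    fix i
    have "2 * (\<epsilon> + real i) = 2 * \<epsilon> + of_int (2 * int i)" by simp
    hence "2 * (\<epsilon> + real i) \<in> \<int>" using half_eps[OF h(1)] by (simp only: Ints_add Ints_of_int)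
    hence "(j, \<epsilon> + real i) \<in> half_lattice" using j2 by (simp add: half_lattice_def)
    thus "on_dom (lat_sum \<kappa> (g_coeff M \<kappa> (j, \<epsilon> + real i) (\<sigma>' / 2, \<sigma> / 2))) \<in> g_span_gens M n"
      using sigma_quarter[OF h(3-5)] unfolding g_span_gens_def \<kappa>_def by blast
  qed
  finally show "F \<in> cspan (g_span_gens M n)"
    unfolding F on_dom_f_fun[OF M n half_eps[OF h(1)] half_eps[OF h(3)] half_eps[OF h(4)] j2 k2] \<kappa>_def[symmetric]
    by (simp only: fscale_mem_iff[OF f_const_nonzero])
qed

text \<open>A general s is (\<sigma>'/2, \<sigma>/2) plus a half-integral t. With t moved into y by
  \<open>g_coeff_shift\<close>, the residues of y + t modulo 1 are \<epsilon>' and \<epsilon>, and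
  the Fourier expansion applies. The case \<sigma> = \<sigma>' = 0 is excluded since s would then
  equal t.\<close>

lemma span_g_subset_f:
  assumes M: "M > 0" and n: "n > 0" and cop: "coprime n M"
  shows "cspan (g_span_gens M n) \<subseteq> cspan (f_span_gens M n)"
proof (rule cspan_minimal, rule subsetI)
  fix F assume "F \<in> g_span_gens M n"
  then obtain y s where F: "F = on_dom (lat_sum (real n / real M) (g_coeff M (real n / real M) y s))"
    and ys: "y \<in> half_lattice" "s \<in> quarter_lattice" "s \<notin> half_lattice"
    unfolding g_span_gens_def by blast
  define \<kappa> where "\<kappa> = real n / real M"
  have \<kappa>: "\<kappa> > 0" using M n by (simp add: \<kappa>_def)
  obtain y1 y2 s1 s2 where ys12: "y = (y1, y2)" "s = (s1, s2)" by (cases y; cases s)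
  have "2 * (2 * s1) \<in> \<int>" "2 * (2 * s2) \<in> \<int>" using ys(2) by (auto simp: ys12 quarter_lattice_def)
  then obtain \<sigma>' \<sigma> a b where \<sigma>: "\<sigma>' \<in> {0, 1/2}" "2 * s1 = \<sigma>' + of_int a" "\<sigma> \<in> {0, 1/2}" "2 * s2 = \<sigma> + of_int b"
    by (metis half_integer_cases)
  define t where "t = (of_int a / 2 :: real, of_int b / 2 :: real)"
  have t: "t \<in> half_lattice" by (simp add: t_def half_lattice_def)
  have s: "s = (\<sigma>' / 2, \<sigma> / 2) + t" using \<sigma> by (simp add: ys12 t_def)
  have \<sigma>0: "(\<sigma>, \<sigma>') \<noteq> (0, 0)"
  proof
    assume "(\<sigma>, \<sigma>') = (0, 0)"
    hence "s = t" using s by (simp add: t_def)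
    thus False using t ys(3) by simp
  qed
  have "2 * (y1 + of_int a / 2) = 2 * y1 + of_int a" "2 * (y2 + of_int b / 2) = 2 * y2 + of_int b" by simp_all
  hence "2 * (y1 + of_int a / 2) \<in> \<int>" "2 * (y2 + of_int b / 2) \<in> \<int>" using ys(1) by (simp_all only: ys12 half_lattice_def mem_Collect_eq prod.case Ints_add Ints_of_int)
  then obtain \<epsilon>' j0 \<epsilon> \<beta>0 where Y: "\<epsilon>' \<in> {0, 1/2}" "y1 + of_int a / 2 = \<epsilon>' + of_int j0" "\<epsilon> \<in> {0, 1/2}" "y2 + of_int b / 2 = \<epsilon> + of_int \<beta>0"
    by (metis half_integer_cases)
  have yt: "y + t = (\<epsilon>' + of_int j0, \<epsilon> + of_int \<beta>0)" using Y by (simp add: ys12 t_def)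
  have g: "g_coeff M \<kappa> y s x = ee (- \<kappa> * (symplectic y t + symplectic (\<sigma>' / 2, \<sigma> / 2) t)) *
      (\<Sum>i<M. ee (\<kappa> * (\<epsilon>' + real i) * (\<epsilon> + of_int \<beta>0)) * f_coeff M \<kappa> \<epsilon> (\<sigma>' / 2) (\<sigma> / 2) (\<epsilon>' + of_int j0) (\<epsilon>' + real i) x)" for x
    unfolding s \<kappa>_def g_coeff_shift[OF M t] yt g_coeff_eq_sum[OF M cop] ..
  have "F = fscale (ee (- \<kappa> * (symplectic y t + symplectic (\<sigma>' / 2, \<sigma> / 2) t))) (\<Sum>i<M. fscale (ee (\<kappa> * (\<epsilon>' + real i) * (\<epsilon> + of_int \<beta>0)))
       (on_dom (lat_sum \<kappa> (f_coeff M \<kappa> \<epsilon> (\<sigma>' / 2) (\<sigma> / 2) (\<epsilon>' + of_int j0) (\<epsilon>' + real i)))))"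
  proof -
    have "g_coeff M \<kappa> y s = (\<lambda>x. ee (- \<kappa> * (symplectic y t + symplectic (\<sigma>' / 2, \<sigma> / 2) t)) *
      (\<Sum>i<M. ee (\<kappa> * (\<epsilon>' + real i) * (\<epsilon> + of_int \<beta>0)) * f_coeff M \<kappa> \<epsilon> (\<sigma>' / 2) (\<sigma> / 2) (\<epsilon>' + of_int j0) (\<epsilon>' + real i) x))"
      by (rule ext) (rule g)
    thus ?thesis unfolding F \<kappa>_def[symmetric] by (simp only: on_dom_lat_scale on_dom_lat_sum[OF \<kappa> bounded_f_coeff])
  qed
  also have "\<dots> \<in> cspan (f_span_gens M n)"
    unfolding cspan_def
  proof (intro fs.span_scale fs.span_sum)
    fix i
    have d: "\<epsilon>' + of_int j0 - \<epsilon>' \<in> \<int>" "\<epsilon>' + real i - \<epsilon>' \<in> \<int>" by simp_all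
    hence "on_dom (f_fun M n \<epsilon> \<sigma> \<sigma>' (\<epsilon>' + of_int j0) (\<epsilon>' + real i)) \<in> f_span_gens M n"
      unfolding f_span_gens_def using Y \<sigma> \<sigma>0 by blast
    hence "on_dom (f_fun M n \<epsilon> \<sigma> \<sigma>' (\<epsilon>' + of_int j0) (\<epsilon>' + real i)) \<in> cspan (f_span_gens M n)"
      unfolding cspan_def by (rule fs.span_base)
    hence "on_dom (lat_sum \<kappa> (f_coeff M \<kappa> \<epsilon> (\<sigma>' / 2) (\<sigma> / 2) (\<epsilon>' + of_int j0) (\<epsilon>' + real i))) \<in> cspan (f_span_gens M n)"
      unfolding on_dom_f_fun[OF M n half_eps[OF Y(3)] half_eps[OF \<sigma>(3)] half_eps[OF \<sigma>(1)] Ints_double[OF Y(1) d(1)] Ints_double[OF Y(1) d(2)]] \<kappa>_def[symmetric]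
      by (simp only: fscale_mem_iff[OF f_const_nonzero])
    thus "on_dom (lat_sum \<kappa> (f_coeff M \<kappa> \<epsilon> (\<sigma>' / 2) (\<sigma> / 2) (\<epsilon>' + of_int j0) (\<epsilon>' + real i))) \<in> fs.span (f_span_gens M n)"
      unfolding cspan_def .
  qed
  finally show "F \<in> cspan (f_span_gens M n)" .
qed

section \<open>Invariance of the span under the modular action\<close>

lemma slash_add: "slash C a b c d (F + G) = slash C a b c d F + slash C a b c d G"
  and slash_scale: "slash C a b c d (fscale u F) = fscale u (slash C a b c d F)"
  by (auto simp: slash_def on_dom_def fscale_def fun_eq_iff algebra_simps)

lemma slash_g_span:
  assumes g: "a * d - b * c = (1::int)" and C: "C + 1/2 = 3 * (real n / real M) / 2"
    and F: "F \<in> cspan (g_span_gens M n)"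
  shows "slash C a b c d F \<in> cspan (g_span_gens M n)"
proof -
  \<comment> \<open>As \<open>slash\<close> is linear, the functions that it sends into the span
    form a subspace, so it is enough to look at the generators.\<close>
  have sub: "fs.subspace {F. slash C a b c d F \<in> cspan (g_span_gens M n)}"
  proof (rule fs.subspaceI)
    have "slash C a b c d 0 = 0" by (auto simp: slash_def on_dom_def fun_eq_iff)
    thus "0 \<in> {F. slash C a b c d F \<in> cspan (g_span_gens M n)}" by (simp add: cspan_def fs.span_zero)
  qed (auto simp: slash_add slash_scale cspan_def intro: fs.span_add fs.span_scale)
  have "g_span_gens M n \<subseteq> {F. slash C a b c d F \<in> cspan (g_span_gens M n)}"
  proof
    fix F assume "F \<in> g_span_gens M n"
    then obtain y s where F: "F = on_dom (lat_sum (real n / real M) (g_coeff M (real n / real M) y s))"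
      and ys: "y \<in> half_lattice" "s \<in> quarter_lattice" "s \<notin> half_lattice"
      unfolding g_span_gens_def by blast
    have "act a b c d s \<notin> half_lattice"
    proof
      assume "act a b c d s \<in> half_lattice"
      from act_half_lattice[OF this, of d "- b" "- c" a] show False using ys(3) by (simp add: act_inverse[OF g])
    qed
    hence "on_dom (lat_sum (real n / real M) (g_coeff M (real n / real M) (act a b c d y) (act a b c d s))) \<in> g_span_gens M n"
      unfolding g_span_gens_def using act_half_lattice[OF ys(1)] act_quarter_lattice[OF ys(2)] by blast
    hence "slash C a b c d F \<in> g_span_gens M n"
      unfolding F slash_lat_sum[OF g C] g_coeff_act[OF g] .
    thus "F \<in> {F. slash C a b c d F \<in> cspan (g_span_gens M n)}" by (simp add: cspan_def fs.span_base)
  qed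
  from fs.span_minimal[OF this sub] F show ?thesis unfolding cspan_def by blast
qed

section \<open>The labels\<close>

definition labels :: "nat \<Rightarrow> label set" where "labels M = principal_labels M \<union> nonprincipal_labels M"

definition num_span_gens :: "nat \<Rightarrow> nat \<Rightarrow> (complex \<Rightarrow> complex \<Rightarrow> complex) set" where
  "num_span_gens M n = {on_dom (mod_numerator M n \<sigma> \<sigma>' l) | \<sigma> \<sigma>' l. \<sigma> \<in> {0, 1/2} \<and> \<sigma>' \<in> {0, 1/2} \<and> (\<sigma>, \<sigma>') \<noteq> (0, 0) \<and> l \<in> labels M}"

lemma times_den_character:
  assumes "\<forall>\<tau> z. (\<tau>, z) \<in> fdom \<longrightarrow> R \<tau> z \<noteq> 0"
  shows "times_den R (on_dom (\<lambda>\<tau> z. a * mod_numerator M n \<sigma> \<sigma>' l \<tau> z / R \<tau> z)) = fscale a (on_dom (mod_numerator M n \<sigma> \<sigma>' l))"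
  using assms by (auto simp: times_den_def on_dom_def fscale_def fun_eq_iff)

lemma times_den_mod_characters:
  assumes "\<forall>\<tau> z. (\<tau>, z) \<in> fdom \<longrightarrow> R \<tau> z \<noteq> 0"
  shows "times_den R ` mod_characters R \<sigma> \<sigma>' M n m \<Lambda> = {fscale a (on_dom (mod_numerator M n \<sigma> \<sigma>' l)) | a l. a \<noteq> 0 \<and> l \<in> labels M \<and> adm_weight M m l = \<Lambda>}"
proof (intro equalityI subsetI)
  fix F assume "F \<in> times_den R ` mod_characters R \<sigma> \<sigma>' M n m \<Lambda>"
  then obtain a l where "F = times_den R (on_dom (\<lambda>\<tau> z. a * mod_numerator M n \<sigma> \<sigma>' l \<tau> z / R \<tau> z))" "a \<noteq> 0" "l \<in> labels M" "adm_weight M m l = \<Lambda>"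
    unfolding mod_characters_def labels_def by blast
  thus "F \<in> {fscale a (on_dom (mod_numerator M n \<sigma> \<sigma>' l)) | a l. a \<noteq> 0 \<and> l \<in> labels M \<and> adm_weight M m l = \<Lambda>}"
    unfolding times_den_character[of R, OF assms] by blast
next
  fix F assume "F \<in> {fscale a (on_dom (mod_numerator M n \<sigma> \<sigma>' l)) | a l. a \<noteq> 0 \<and> l \<in> labels M \<and> adm_weight M m l = \<Lambda>}"
  then obtain a l where F: "F = fscale a (on_dom (mod_numerator M n \<sigma> \<sigma>' l))" and al: "a \<noteq> 0" "l \<in> labels M" "adm_weight M m l = \<Lambda>" by blast
  have "on_dom (\<lambda>\<tau> z. a * mod_numerator M n \<sigma> \<sigma>' l \<tau> z / R \<tau> z) \<in> mod_characters R \<sigma> \<sigma>' M n m \<Lambda>"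
    unfolding mod_characters_def using al unfolding labels_def by blast
  thus "F \<in> times_den R ` mod_characters R \<sigma> \<sigma>' M n m \<Lambda>"
    unfolding F times_den_character[of R, OF assms, symmetric] by (rule imageI)
qed

text \<open>On \<open>fdom\<close> the denominators cancel against \<open>times_den\<close>, and
  normalizing scalars do not matter for a span. A weight brings in the numerators of all its
  presentations, but every one of these labels is among the generators on the right as well.\<close>

lemma V_eq_num_span: "V M n m = cspan (num_span_gens M n)"
proof
  have D: "\<forall>\<tau> z. (\<tau>, z) \<in> fdom \<longrightarrow> R_plus \<tau> z \<noteq> 0" "\<forall>\<tau> z. (\<tau>, z) \<in> fdom \<longrightarrow> R_minus \<tau> z \<noteq> 0"
    "\<forall>\<tau> z. (\<tau>, z) \<in> fdom \<longrightarrow> R_tw \<tau> z \<noteq> 0"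
    using denominators_nonzero by blast+
  note T = times_den_mod_characters[of R_plus, OF D(1)] times_den_mod_characters[of R_minus, OF D(2)] times_den_mod_characters[of R_tw, OF D(3)]
  have num: "fscale a (on_dom (mod_numerator M n \<sigma> \<sigma>' l)) \<in> cspan (num_span_gens M n)"
    if "\<sigma> \<in> {0, 1/2}" "\<sigma>' \<in> {0, 1/2}" "(\<sigma>, \<sigma>') \<noteq> (0, 0)" "l \<in> labels M" for a \<sigma> \<sigma>' l
    unfolding cspan_def by (rule fs.span_scale, rule fs.span_base) (use that in \<open>unfold num_span_gens_def, blast\<close>)
  have gNS: "gens_NS M n m \<Lambda> \<subseteq> cspan (num_span_gens M n)" and gR: "gens_Ramond M n m \<Lambda> \<subseteq> cspan (num_span_gens M n)" for \<Lambda>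
    unfolding gens_NS_def gens_Ramond_def NS_characters_def NS_supercharacters_def Ramond_characters_def T
    by (auto intro!: num)
  show "V M n m \<subseteq> cspan (num_span_gens M n)"
    unfolding V_def by (rule cspan_minimal) (use gNS gR in blast)
  show "cspan (num_span_gens M n) \<subseteq> V M n m"
    unfolding V_def
  proof (rule cspan_minimal, rule subsetI)
    fix F assume "F \<in> num_span_gens M n"
    then obtain \<sigma> \<sigma>' l where F: "F = on_dom (mod_numerator M n \<sigma> \<sigma>' l)" and h: "\<sigma> \<in> {0, 1/2}" "\<sigma>' \<in> {0, 1/2}" "(\<sigma>, \<sigma>') \<noteq> (0, 0)" and l: "l \<in> labels M"
      unfolding num_span_gens_def by blast
    define \<Lambda> where "\<Lambda> = adm_weight M m l"
    have F1: "F = fscale 1 (on_dom (mod_numerator M n \<sigma> \<sigma>' l))" unfolding F by (simp add: fscale_def)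
    have mem: "F \<in> {fscale a (on_dom (mod_numerator M n \<sigma> \<sigma>' l)) | a l. a \<noteq> 0 \<and> l \<in> labels M \<and> adm_weight M m l = \<Lambda>}"
      using F1 l \<Lambda>_def one_neq_zero by blast
    have "(\<sigma>, \<sigma>') = (1/2, 1/2) \<or> (\<sigma>, \<sigma>') = (0, 1/2) \<or> (\<sigma>, \<sigma>') = (1/2, 0)" using h by blast
    hence "F \<in> gens_NS M n m \<Lambda> \<or> F \<in> gens_Ramond M n m \<Lambda>"
      unfolding gens_NS_def gens_Ramond_def NS_characters_def NS_supercharacters_def Ramond_characters_def T Un_iff
      using mem by (elim disjE) (simp_all only: prod.inject simp_thms)
    moreover have "\<Lambda> \<in> adm_weight M m ` principal_labels M \<or> \<Lambda> \<in> adm_weight M m ` nonprincipal_labels M"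
      using l unfolding labels_def \<Lambda>_def by blast
    ultimately have "F \<in> (\<Union>\<Lambda>\<in>adm_weight M m ` principal_labels M. gens_NS M n m \<Lambda>)
      \<union> (\<Union>\<Lambda>\<in>adm_weight M m ` nonprincipal_labels M. gens_NS M n m \<Lambda>)
      \<union> (\<Union>\<Lambda>\<in>adm_weight M m ` (principal_labels M \<union> nonprincipal_labels M). gens_Ramond M n m \<Lambda>)"
      by blast
    thus "F \<in> cspan ((\<Union>\<Lambda>\<in>adm_weight M m ` principal_labels M. gens_NS M n m \<Lambda>)
      \<union> (\<Union>\<Lambda>\<in>adm_weight M m ` nonprincipal_labels M. gens_NS M n m \<Lambda>)
      \<union> (\<Union>\<Lambda>\<in>adm_weight M m ` (principal_labels M \<union> nonprincipal_labels M). gens_Ramond M n m \<Lambda>))"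
      unfolding cspan_def by (rule fs.span_base)
  qed
qed

text \<open>In the coordinates \<open>u = j - k\<close>, \<open>v = j + k\<close> the labels cover the strip \<open>0 \<le> u \<le> (M - 1)/2\<close>,
  with \<open>v\<close> running over a full set of residues modulo \<open>2M\<close>.\<close>

lemma label_exists:
  assumes "0 \<le> u" "2 * u \<le> int M - 1" "1 - int M \<le> v" "v \<le> int M"
  obtains D J k1 k2 where
    "\<And>m2. m2 \<in> {0, 1} \<Longrightarrow> (D, m2, J, k1, k2) \<in> labels M"
    "\<And>m2. label_j M (D, m2, J, k1, k2) = of_int (u + v) / 2"
    "\<And>m2. label_k M (D, m2, J, k1, k2) = of_int (v - u) / 2"
proof -
  \<comment> \<open>The pieces of the strip, in this order, belong to I, III, I', III', dotted I and
    dotted III. In each series u = k1 + k2, and the range conditions become the inequalities that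
    bound the piece.\<close>
  consider "- u \<le> v" "v \<le> 0" | "0 < v" "v \<le> u" | "v < - u" "u - int M + 1 \<le> v" | "u < v" "v \<le> int M - u"
    | "int M - u < v" | "v \<le> u - int M" by linarith
  thus ?thesis
  proof cases
    case 1
    show ?thesis
      by (rule that[where D = False and J = Ser_I and ?k1.0 = "u + v" and ?k2.0 = "- v"])
         (use 1 assms in \<open>auto simp: labels_def principal_labels_def\<close>)
  next
    case 2
    show ?thesis
      by (rule that[where D = False and J = Ser_III and ?k1.0 = "u - v" and ?k2.0 = v])
         (use 2 assms in \<open>auto simp: labels_def principal_labels_def\<close>)
  next
    case 3
    show ?thesis
      by (rule that[where D = False and J = Ser_I' and ?k1.0 = "u + v" and ?k2.0 = "- v"])
         (use 3 assms in \<open>auto simp: labels_def nonprincipal_labels_def\<close>)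
  next
    case 4
    show ?thesis
      by (rule that[where D = False and J = Ser_III' and ?k1.0 = "u - v" and ?k2.0 = v])
         (use 4 assms in \<open>auto simp: labels_def nonprincipal_labels_def\<close>)
  next
    case 5
    show ?thesis
      by (rule that[where D = True and J = Ser_I and ?k1.0 = "u + v - int M" and ?k2.0 = "int M - v"])
         (use 5 assms in \<open>auto simp: labels_def principal_labels_def\<close>)
  next
    case 6
    show ?thesis
      by (rule that[where D = True and J = Ser_III and ?k1.0 = "u - v - int M" and ?k2.0 = "v + int M"])
         (use 6 assms in \<open>auto simp: labels_def principal_labels_def\<close>)
  qed
qed

text \<open>In every series j - k equals k1 + k2, so j and k lie in the same class modulo 1.\<close>

lemma label_half:
  assumes "odd M" "l \<in> labels M"
  obtains \<epsilon>' where "\<epsilon>' \<in> {0, 1/2 :: real}" "label_j M l - \<epsilon>' \<in> \<int>" "label_k M l - \<epsilon>' \<in> \<int>"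
proof -
  obtain D m2 J k1 k2 where l: "l = (D, m2, J, k1, k2)" by (cases l)
  obtain A B :: int where A: "2 * label_j M l = of_int A" and AB: "label_j M l - label_k M l = of_int B"
  proof (cases "J \<in> {Ser_I, Ser_I'}")
    case True
    show ?thesis
      by (rule that[of "if D then k1 + int M else k1" "k1 + k2"]) (use True in \<open>auto simp: l field_simps\<close>)
  next
    case False
    show ?thesis
      by (rule that[of "if D then k1 + 2 * k2 - int M else k1 + 2 * k2" "k1 + k2"]) (use False in \<open>auto simp: l field_simps\<close>)
  qed
  have "2 * label_j M l \<in> \<int>" unfolding A by simp
  then obtain \<epsilon> p where \<epsilon>: "\<epsilon> \<in> {0, 1/2 :: real}" "label_j M l = \<epsilon> + of_int p" by (rule half_integer_cases)
  have "label_k M l = \<epsilon> + of_int (p - B)" using \<epsilon> AB by simp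
  thus ?thesis using that[of \<epsilon>] \<epsilon> by simp
qed

lemma on_dom_numerator:
  "on_dom (mod_numerator M n \<sigma> \<sigma>' l) = on_dom (f_fun M n 0 \<sigma> \<sigma>' (label_j M l) (label_k M l))
     - fscale ((- 1) ^ label_m2 l) (on_dom (f_fun M n (1/2) \<sigma> \<sigma>' (label_j M l) (label_k M l)))"
  by (auto simp: on_dom_def fscale_def mod_numerator_def fun_eq_iff)

lemma span_num_subset_f:
  assumes "odd M" shows "cspan (num_span_gens M n) \<subseteq> cspan (f_span_gens M n)"
proof (rule cspan_minimal, rule subsetI)
  fix F assume "F \<in> num_span_gens M n"
  then obtain \<sigma> \<sigma>' l where F: "F = on_dom (mod_numerator M n \<sigma> \<sigma>' l)" and h: "\<sigma> \<in> {0, 1/2}" "\<sigma>' \<in> {0, 1/2}" "(\<sigma>, \<sigma>') \<noteq> (0, 0)" and l: "l \<in> labels M"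
    unfolding num_span_gens_def by blast
  obtain \<epsilon>' where e: "\<epsilon>' \<in> {0, 1/2 :: real}" "label_j M l - \<epsilon>' \<in> \<int>" "label_k M l - \<epsilon>' \<in> \<int>" using label_half[OF assms l] by blast
  have "on_dom (f_fun M n \<epsilon> \<sigma> \<sigma>' (label_j M l) (label_k M l)) \<in> f_span_gens M n" if "\<epsilon> \<in> {0, 1/2}" for \<epsilon>
    unfolding f_span_gens_def using that e h by blast
  hence m: "on_dom (f_fun M n \<epsilon> \<sigma> \<sigma>' (label_j M l) (label_k M l)) \<in> fs.span (f_span_gens M n)" if "\<epsilon> \<in> {0, 1/2}" for \<epsilon>
    using that by (intro fs.span_base)
  show "F \<in> cspan (f_span_gens M n)"
    unfolding F on_dom_numerator cspan_def by (intro fs.span_diff fs.span_scale m) auto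
qed

lemma f_label_in_num_span:
  assumes h: "\<sigma> \<in> {0, 1/2}" "\<sigma>' \<in> {0, 1/2}" "(\<sigma>, \<sigma>') \<noteq> (0, 0)" and \<epsilon>: "\<epsilon> \<in> {0, 1/2}"
    and l: "\<And>m2. m2 \<in> {0, 1} \<Longrightarrow> (D, m2, J, k1, k2) \<in> labels M"
    and j: "\<And>m2. label_j M (D, m2, J, k1, k2) = j" and k: "\<And>m2. label_k M (D, m2, J, k1, k2) = k"
  shows "on_dom (f_fun M n \<epsilon> \<sigma> \<sigma>' j k) \<in> cspan (num_span_gens M n)"
proof -
  define f0 f1 where "f0 = on_dom (f_fun M n 0 \<sigma> \<sigma>' j k)" and "f1 = on_dom (f_fun M n (1/2) \<sigma> \<sigma>' j k)"
  have m: "on_dom (mod_numerator M n \<sigma> \<sigma>' (D, m2, J, k1, k2)) \<in> fs.span (num_span_gens M n)" if "m2 \<in> {0, 1}" for m2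
    by (rule fs.span_base) (use l[OF that] h in \<open>unfold num_span_gens_def, blast\<close>)
  have 0: "f0 - fscale 1 f1 \<in> fs.span (num_span_gens M n)"
    using m[of 0] unfolding on_dom_numerator j k f0_def f1_def by (simp only: label_m2.simps power_0 insert_iff simp_thms)
  have 1: "f0 - fscale (- 1) f1 \<in> fs.span (num_span_gens M n)"
    using m[of 1] unfolding on_dom_numerator j k f0_def f1_def by (simp only: label_m2.simps power_one_right insert_iff simp_thms)
  have "f0 = fscale (1/2) ((f0 - fscale 1 f1) + (f0 - fscale (- 1) f1))" by (simp add: fscale_def fun_eq_iff)
  also have "\<dots> \<in> fs.span (num_span_gens M n)" by (intro fs.span_scale fs.span_add 0 1)
  finally have r0: "f0 \<in> fs.span (num_span_gens M n)" .
  have "f1 = fscale (1/2) ((f0 - fscale (- 1) f1) - (f0 - fscale 1 f1))" by (simp add: fscale_def fun_eq_iff)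
  also have "\<dots> \<in> fs.span (num_span_gens M n)" by (intro fs.span_scale fs.span_diff 0 1)
  finally have r1: "f1 \<in> fs.span (num_span_gens M n)" .
  have "\<epsilon> = 0 \<or> \<epsilon> = 1/2" using \<epsilon> by blast
  thus ?thesis using r0 r1 unfolding cspan_def f0_def f1_def by (elim disjE) (simp_all only:)
qed

text \<open>A shift of j alone by M t moves both u and v by M t and brings u into the strip. A
  common shift of j and k by M w then fixes u and moves v by 2 M w, which reduces v modulo 2 M. Each
  shift costs only a nonzero factor.\<close>

lemma f_coeff_in_num_span:
  assumes M: "M > 0" and n: "n > 0"
    and h: "\<sigma> \<in> {0, 1/2}" "\<sigma>' \<in> {0, 1/2}" "(\<sigma>, \<sigma>') \<noteq> (0, 0)" and \<epsilon>: "\<epsilon> \<in> {0, 1/2}"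
    and j: "2 * j = of_int (u + v)" and k: "2 * k = of_int (v - u)" and u: "2 * (u mod int M) \<le> int M - 1"
  shows "on_dom (lat_sum (real n / real M) (f_coeff M (real n / real M) \<epsilon> (\<sigma>' / 2) (\<sigma> / 2) j k)) \<in> cspan (num_span_gens M n)"
proof -
  define \<kappa> where "\<kappa> = real n / real M"
  define u0 where "u0 = u mod int M"
  define t where "t = - (u div int M)"
  have u0: "u0 = u + int M * t" "0 \<le> u0" "2 * u0 \<le> int M - 1"
  proof -
    show "u0 = u + int M * t" unfolding u0_def t_def by (simp add: minus_mult_div_eq_mod[symmetric])
    show "0 \<le> u0" "2 * u0 \<le> int M - 1" unfolding u0_def using M u by (simp_all only: u) simp
  qed
  \<comment> \<open>The offset M - 1 makes the residue of \<open>v1\<close> modulo 2 M, moved back,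
    range over the window from 1 - M to M that \<open>label_exists\<close> covers.\<close>
  define v1 where "v1 = v + int M * t + int M - 1"
  define w where "w = - (v1 div (2 * int M))"
  define v0 where "v0 = v1 mod (2 * int M) - int M + 1"
  have v0: "v0 = v + int M * t + 2 * int M * w"
    by (simp add: v0_def w_def v1_def minus_mult_div_eq_mod[symmetric])
  have "0 \<le> v1 mod (2 * int M)" "v1 mod (2 * int M) < 2 * int M" using M by auto
  hence vr: "1 - int M \<le> v0" "v0 \<le> int M" by (auto simp: v0_def)
  obtain D J k1 k2 where L:
    "\<And>m2. m2 \<in> {0, 1} \<Longrightarrow> (D, m2, J, k1, k2) \<in> labels M"
    "\<And>m2. label_j M (D, m2, J, k1, k2) = of_int (u0 + v0) / 2"
    "\<And>m2. label_k M (D, m2, J, k1, k2) = of_int (v0 - u0) / 2"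
    using label_exists[OF u0(2,3) vr] by metis
  define j' k' where "j' = (of_int (u0 + v0) / 2 :: real)" and "k' = (of_int (v0 - u0) / 2 :: real)"
  have jk: "j' = j + real M * of_int (t + w)" "k' = k + real M * of_int w"
    using j k by (auto simp: j'_def k'_def u0(1) v0 field_simps)
  have i: "2 * j' \<in> \<int>" "2 * k' \<in> \<int>"
  proof -
    have "2 * j' = of_int (u0 + v0)" "2 * k' = of_int (v0 - u0)" by (simp_all add: j'_def k'_def)
    thus "2 * j' \<in> \<int>" "2 * k' \<in> \<int>" by (simp_all only: Ints_of_int)
  qed
  have "on_dom (f_fun M n \<epsilon> \<sigma> \<sigma>' j' k') \<in> cspan (num_span_gens M n)"
    by (rule f_label_in_num_span[OF h \<epsilon> L(1)]) (simp_all only: L j'_def k'_def)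
  hence "on_dom (lat_sum \<kappa> (f_coeff M \<kappa> \<epsilon> (\<sigma>' / 2) (\<sigma> / 2) j' k')) \<in> cspan (num_span_gens M n)"
    unfolding on_dom_f_fun[OF M n half_eps[OF \<epsilon>] half_eps[OF h(1)] half_eps[OF h(2)] i] \<kappa>_def[symmetric]
    by (simp only: fscale_mem_iff[OF f_const_nonzero])
  moreover have "f_coeff M \<kappa> \<epsilon> (\<sigma>' / 2) (\<sigma> / 2) j' k' = (\<lambda>x. ee (- (real n * \<epsilon> * of_int (t + w + w))) * f_coeff M \<kappa> \<epsilon> (\<sigma>' / 2) (\<sigma> / 2) j k x)"
    unfolding jk \<kappa>_def by (rule ext) (rule f_coeff_shift[OF M])
  ultimately show ?thesis
    unfolding \<kappa>_def[symmetric] by (simp only: on_dom_lat_scale fscale_mem_iff[OF ee_nonzero])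
qed

text \<open>\<open>f_coeff_swap\<close> replaces u by -u - s', with s' = 2 \<sigma>'. A residue r
  outside the strip becomes M - r - s'; as M is odd, r is at least (M + 1)/2, so the new residue is
  at most (M - 1)/2. For even M and s' = 0 the residue M/2 would be stuck.\<close>

lemma span_f_subset_num:
  assumes M: "M > 0" and n: "n > 0" and odd: "odd M"
  shows "cspan (f_span_gens M n) \<subseteq> cspan (num_span_gens M n)"
proof (rule cspan_minimal, rule subsetI)
  fix F assume "F \<in> f_span_gens M n"
  then obtain \<epsilon> \<epsilon>' \<sigma> \<sigma>' j k where F: "F = on_dom (f_fun M n \<epsilon> \<sigma> \<sigma>' j k)"
    and h: "\<epsilon> \<in> {0, 1/2}" "\<epsilon>' \<in> {0, 1/2}" "\<sigma> \<in> {0, 1/2}" "\<sigma>' \<in> {0, 1/2}" "(\<sigma>, \<sigma>') \<noteq> (0, 0)" "j - \<epsilon>' \<in> \<int>" "k - \<epsilon>' \<in> \<int>"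
    unfolding f_span_gens_def by blast
  define \<kappa> where "\<kappa> = real n / real M"
  have j2: "2 * j \<in> \<int>" and k2: "2 * k \<in> \<int>" using Ints_double h by blast+
  obtain p q where pq: "j - \<epsilon>' = of_int p" "k - \<epsilon>' = of_int q" using h(6,7) by (auto elim!: Ints_cases)
  obtain e' :: int where e': "2 * \<epsilon>' = of_int e'" using half_eps[OF h(2)] by (auto elim: Ints_cases)
  obtain s' :: int where s': "2 * \<sigma>' = of_int s'" "s' \<in> {0, 1}" using h(4) by (auto intro: that[of 0] that[of 1])
  obtain s :: int where s: "2 * \<sigma> = of_int s" using half_eps[OF h(3)] by (auto elim: Ints_cases)
  define u where "u = p - q"
  define v where "v = p + q + e'"
  have ju: "2 * j = of_int (u + v)" and kv: "2 * k = of_int (v - u)"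
    using pq e' by (auto simp: u_def v_def)
  have "on_dom (lat_sum \<kappa> (f_coeff M \<kappa> \<epsilon> (\<sigma>' / 2) (\<sigma> / 2) j k)) \<in> cspan (num_span_gens M n)"
  proof (cases "2 * (u mod int M) \<le> int M - 1")
    case True
    show ?thesis unfolding \<kappa>_def by (rule f_coeff_in_num_span[OF M n h(3-5) h(1) ju kv True])
  next
    case False
    have oM: "odd (int M)" using odd by simp
    have r: "0 \<le> u mod int M" "u mod int M < int M" using M by auto
    have um: "(- u - s') mod int M = int M - (u mod int M) - s'"
    proof -
      have "- u - s' = (int M - (u mod int M) - s') + int M * (- (u div int M) - 1)"
        using mod_mult_div_eq[of u "int M"] by (simp add: algebra_simps)
      moreover have "0 \<le> int M - (u mod int M) - s'" "int M - (u mod int M) - s' < int M"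
        using r s'(2) False oM by auto
      ultimately show ?thesis by (metis mod_mult_self2 mod_pos_pos_trivial)
    qed
    have um2: "2 * ((- u - s') mod int M) \<le> int M - 1"
    proof -
      have "2 * (u mod int M) \<ge> int M + 1"
      proof -
        have "\<not> 2 * r \<le> i - 1 \<Longrightarrow> odd i \<Longrightarrow> 2 * r \<ge> i + 1" for r i :: int by presburger
        thus ?thesis using False oM .
      qed
      thus ?thesis unfolding um using s'(2) by auto
    qed
    \<comment> \<open>The swap turns \<epsilon> into \<epsilon> + \<sigma>, which may equal 1; the
      integral part is discarded by \<open>f_coeff_eps\<close>.\<close>
    obtain \<epsilon>2 d where \<epsilon>2: "\<epsilon>2 \<in> {0, 1/2}" "\<epsilon> + 2 * (\<sigma> / 2) = \<epsilon>2 + of_int d"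
    proof -
      have "2 * (\<epsilon> + 2 * (\<sigma> / 2)) = 2 * \<epsilon> + 2 * \<sigma>" by simp
      hence "2 * (\<epsilon> + 2 * (\<sigma> / 2)) \<in> \<int>" using half_eps[OF h(1)] half_eps[OF h(3)] by (simp only: Ints_add)
      thus ?thesis using that by (rule half_integer_cases)
    qed
    have j': "2 * (k - 2 * (\<sigma>' / 2)) = of_int ((- u - s') + v)" and k': "2 * (j + 2 * (\<sigma>' / 2)) = of_int (v - (- u - s'))"
      using ju kv s'(1) by auto
    have "on_dom (lat_sum \<kappa> (f_coeff M \<kappa> \<epsilon>2 (\<sigma>' / 2) (\<sigma> / 2) (k - 2 * (\<sigma>' / 2)) (j + 2 * (\<sigma>' / 2)))) \<in> cspan (num_span_gens M n)"
      unfolding \<kappa>_def by (rule f_coeff_in_num_span[OF M n h(3-5) \<epsilon>2(1) j' k' um2])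
    moreover have "f_coeff M \<kappa> \<epsilon>2 (\<sigma>' / 2) (\<sigma> / 2) (k - 2 * (\<sigma>' / 2)) (j + 2 * (\<sigma>' / 2)) =
      (\<lambda>x. ee (\<kappa> * (2 * (\<sigma> / 2) * (j - k) + 4 * (\<sigma>' / 2) * (\<sigma> / 2))) * f_coeff M \<kappa> \<epsilon> (\<sigma>' / 2) (\<sigma> / 2) j k x)"
    proof (rule ext)
      fix x
      have s4: "4 * (\<sigma> / 2) = of_int s" using s by simp
      have "f_coeff M \<kappa> (\<epsilon> + 2 * (\<sigma> / 2)) (\<sigma>' / 2) (\<sigma> / 2) (k - 2 * (\<sigma>' / 2)) (j + 2 * (\<sigma>' / 2)) x =
         ee (\<kappa> * (2 * (\<sigma> / 2) * (j - k) + 4 * (\<sigma>' / 2) * (\<sigma> / 2))) * f_coeff M \<kappa> \<epsilon> (\<sigma>' / 2) (\<sigma> / 2) j k x"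
        unfolding \<kappa>_def by (rule f_coeff_swap[OF M s4])
      thus "f_coeff M \<kappa> \<epsilon>2 (\<sigma>' / 2) (\<sigma> / 2) (k - 2 * (\<sigma>' / 2)) (j + 2 * (\<sigma>' / 2)) x =
         ee (\<kappa> * (2 * (\<sigma> / 2) * (j - k) + 4 * (\<sigma>' / 2) * (\<sigma> / 2))) * f_coeff M \<kappa> \<epsilon> (\<sigma>' / 2) (\<sigma> / 2) j k x"
        unfolding \<epsilon>2(2) \<kappa>_def f_coeff_eps[OF M] .
    qed
    ultimately show ?thesis by (simp only: on_dom_lat_scale fscale_mem_iff[OF ee_nonzero])
  qed
  thus "F \<in> cspan (num_span_gens M n)"
    unfolding F on_dom_f_fun[OF M n half_eps[OF h(1)] half_eps[OF h(3)] half_eps[OF h(4)] j2 k2] \<kappa>_def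
    by (simp only: fscale_mem_iff[OF f_const_nonzero])
qed

theorem theorem4p12:
  fixes M n :: nat and m C :: real
  assumes "M > 0" and "odd M"
    and "4 * m \<in> \<int>" and "real n = - 4 * m - 2" and "n > 0" and "coprime n M"
    and "C = 3 * real n / (2 * real M) - 1/2"
  shows
    "V M n m = cspan {on_dom (f_fun M n \<epsilon> \<sigma> \<sigma>' j k) | \<epsilon> \<epsilon>' \<sigma> \<sigma>' j k.
        \<epsilon> \<in> {0, 1/2} \<and> \<epsilon>' \<in> {0, 1/2} \<and> \<sigma> \<in> {0, 1/2} \<and> \<sigma>' \<in> {0, 1/2} \<and>
        (\<sigma>, \<sigma>') \<noteq> (0, 0) \<and> j - \<epsilon>' \<in> \<int> \<and> k - \<epsilon>' \<in> \<int>}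
     \<and> (\<forall>a b c d :: int. a * d - b * c = 1 \<longrightarrow>
           (\<forall>F \<in> V M n m. slash C a b c d F \<in> V M n m))"
proof -
  have Vf: "V M n m = cspan (f_span_gens M n)"
    unfolding V_eq_num_span using span_num_subset_f[OF assms(2)] span_f_subset_num[OF assms(1,5,2)] by blast
  \<comment> \<open>Invariance is visible only in these generators: \<open>slash\<close> permutes
    them, whereas it turns a single f into a combination of many.\<close>
  have Vg: "V M n m = cspan (g_span_gens M n)"
    unfolding Vf using span_f_subset_g[OF assms(1,5,6)] span_g_subset_f[OF assms(1,5,6)] by blast
  have C: "C + 1/2 = 3 * (real n / real M) / 2" using assms(7) by simp
  have "slash C a b c d F \<in> V M n m" if "a * d - b * c = 1" "F \<in> V M n m" for a b c d F
    using slash_g_span[OF that(1) C] that(2) unfolding Vg by blast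
  thus ?thesis using Vf unfolding f_span_gens_def by blast
qed

end
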